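(* Let $(x_j)_{j\in\mathbb{Z}}$ and $(y_j)_{j\in\mathbb{Z}}$ be two (one-dimensional) Riesz-basis sequences, let $z_{(l,k)}:=(x_l,y_k)\in\mathbb{R}^2$ for $l,k\in\mathbb{Z}$, and for $\lambda>0$ let $I^{(2)}_\lambda$ be the 2-dimensional Gaussian interpolation operator corresponding to $(z_{(l,k)})_{l,k\in\mathbb{Z}}$. Suppose that $F\in PW^{(2)}_\pi$. Then $\lim_{\lambda\to0^+}\|I^{(2)}_\lambda(F)-F\|_{L_2(\mathbb{R}^2)}=0$, and $\lim_{\lambda\to0^+}I^{(2)}_\lambda(F)(z)=F(z)$ uniformly for $z\in\mathbb{R}^2$.
   Context: A real sequence $(x_j)_{j\in\mathbb{Z}}$ is a Riesz-basis sequence if $x_j<x_{j+1}$ for all $j\in\mathbb{Z}$ and the functions $t\mapsto e^{-ix_jt}$, $j\in\mathbb{Z}$, form a Riesz basis for $L_2[-\pi,\pi]$. Here $(\varphi_j)$ is a Riesz basis of a Hilbert space $\mathcal{H}$ if every $h\in\mathcal{H}$ has a unique representation $h=\sum_j a_j\varphi_j$ with $\sum_j|a_j|^2<\infty$, and there is a constant $B$ such that $B^{-1}(\sum|c_j|^2)^{1/2}\le\|\sum c_j\varphi_j\|_{\mathcal{H}}\le B(\sum|c_j|^2)^{1/2}$ for every square-summable $(c_j)$. A family of points $z$ in $\mathbb{R}^2$ is a 2-dimensional Riesz-basis sequence if the functions $t\mapsto e^{-i\langle z,t\rangle}$ form a Riesz basis of $L_2([-\pi,\pi]^2)$; the family $(z_{(l,k)})_{l,k\in\mathbb{Z}}$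 is such a sequence. $\mathcal{F}^{(2)}$ is the Fourier transform on $L_2(\mathbb{R}^2)$, with $\mathcal{F}^{(2)}[g](x)=\int_{\mathbb{R}^2}g(t)e^{-i\langle x,t\rangle}\,dt$ for $g\in L_1(\mathbb{R}^2)\cap L_2(\mathbb{R}^2)$. $PW^{(2)}_\pi:=\{g\in L_2(\mathbb{R}^2):\mathcal{F}^{(2)}[g]=0\text{ a.e. outside }[-\pi,\pi]^2\}$; its elements are taken to be their continuous representatives. For $\lambda>0$ let $g^{(2)}_\lambda(x_1,x_2)=e^{-\lambda(x_1^2+x_2^2)}$. For $F\in PW^{(2)}_\pi$ there is a unique square-summable family $(a(l,k,\lambda))_{l,k\in\mathbb{Z}}$ such that $\sum_{l,k}a(l,k,\lambda)g^{(2)}_\lambda(z_{(m,n)}-z_{(l,k)})=F(z_{(m,n)})$ for all $m,n\in\mathbb{Z}$, and $I^{(2)}_\lambda(F)(z):=\sum_{l,k\in\mathbb{Z}}a(l,k,\lambda)g^{(2)}_\lambda(z-z_{(l,k)})$, $z\in\mathbb{R}^2$. $I^{(2)}_\lambda$ is a well-defined bounded linear operator from $PW^{(2)}_\pi$ to $L_2(\mathbb{R}^2)$, with values in $C_0(\mathbb{R}^2)$. *)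

theory Defs
  imports "HOL-Analysis.Analysis"
begin

text \<open>The space \<open>L\<^sub>2(M)\<close> is handled through complex-valued functions rather than equivalence classes.
  Since the Bochner integral of a non-integrable function is \<open>0\<close>, \<open>L2_norm\<close> is meaningful only
  together with \<open>square_integrable\<close>; \<open>L2_tendsto\<close> therefore includes membership in the space.\<close>

definition square_integrable :: "'a measure \<Rightarrow> ('a \<Rightarrow> complex) \<Rightarrow> bool" where
  "square_integrable M f \<longleftrightarrow>
     f \<in> borel_measurable M \<and> integrable M (\<lambda>t. (cmod (f t))\<^sup>2)"

definition L2_norm :: "'a measure \<Rightarrow> ('a \<Rightarrow> complex) \<Rightarrow> real" where
  "L2_norm M f = sqrt (\<integral>t. (cmod (f t))\<^sup>2 \<partial>M)"

definition L2_tendsto ::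
  "'a measure \<Rightarrow> ('b \<Rightarrow> 'a \<Rightarrow> complex) \<Rightarrow> ('a \<Rightarrow> complex) \<Rightarrow> 'b filter \<Rightarrow> bool" where
  "L2_tendsto M f g A \<longleftrightarrow>
     square_integrable M g \<and> (\<forall>\<^sub>F i in A. square_integrable M (f i)) \<and>
     ((\<lambda>i. L2_norm M (\<lambda>t. f i t - g t)) \<longlongrightarrow> 0) A"

definition square_summable :: "('i \<Rightarrow> complex) \<Rightarrow> bool" where
  "square_summable c \<longleftrightarrow> (\<lambda>j. (cmod (c j))\<^sup>2) summable_on UNIV"

definition l2_norm :: "('i \<Rightarrow> complex) \<Rightarrow> real" where
  "l2_norm c = sqrt (\<Sum>\<^sub>\<infinity>j. (cmod (c j))\<^sup>2)"

text \<open>\<open>h = \<Sum>\<^sub>j c\<^sub>j \<phi>\<^sub>j\<close> in \<open>L\<^sub>2(M)\<close>, as unconditional convergence (the net of finite partial sums).\<close>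

definition has_L2_sum ::
  "'a measure \<Rightarrow> ('i \<Rightarrow> complex) \<Rightarrow> ('i \<Rightarrow> 'a \<Rightarrow> complex) \<Rightarrow> ('a \<Rightarrow> complex) \<Rightarrow> bool" where
  "has_L2_sum M c \<phi> h \<longleftrightarrow>
     L2_tendsto M (\<lambda>J t. \<Sum>j\<in>J. c j * \<phi> j t) h (finite_subsets_at_top UNIV)"

definition riesz_basis_L2 :: "'a measure \<Rightarrow> ('i \<Rightarrow> 'a \<Rightarrow> complex) \<Rightarrow> bool" where
  "riesz_basis_L2 M \<phi> \<longleftrightarrow>
     (\<forall>j. square_integrable M (\<phi> j)) \<and>
     (\<forall>h. square_integrable M h \<longrightarrow> (\<exists>!a. square_summable a \<and> has_L2_sum M a \<phi> h)) \<and>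
     (\<exists>B>0. \<forall>c. square_summable c \<longrightarrow>
        (\<exists>s. has_L2_sum M c \<phi> s \<and>
             inverse B * l2_norm c \<le> L2_norm M s \<and> L2_norm M s \<le> B * l2_norm c))"

definition riesz_basis_sequence :: "(int \<Rightarrow> real) \<Rightarrow> bool" where
  "riesz_basis_sequence x \<longleftrightarrow>
     (\<forall>j. x j < x (j + 1)) \<and>
     riesz_basis_L2 (lebesgue_on {-pi..pi}) (\<lambda>j t. exp (- (\<i> * complex_of_real (x j * t))))"

definition fourier_integral :: "(real \<times> real \<Rightarrow> complex) \<Rightarrow> real \<times> real \<Rightarrow> complex" where
  "fourier_integral g x = (\<integral>t. g t * exp (- (\<i> * complex_of_real (x \<bullet> t))) \<partial>lebesgue)"

text \<open>\<open>G\<close> is (a representative of) the Fourier transform of \<open>g \<in> L\<^sub>2(\<real>\<^sup>2)\<close>: the continuous extension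
  to \<open>L\<^sub>2\<close> of the integral formula on \<open>L\<^sub>1 \<inter> L\<^sub>2\<close>. By Plancherel, such a \<open>G\<close> exists and is
  unique up to null sets.\<close>

definition fourier_transform_L2 ::
  "(real \<times> real \<Rightarrow> complex) \<Rightarrow> (real \<times> real \<Rightarrow> complex) \<Rightarrow> bool" where
  "fourier_transform_L2 g G \<longleftrightarrow>
     (\<exists>u :: nat \<Rightarrow> real \<times> real \<Rightarrow> complex.
        (\<forall>n. integrable lebesgue (u n) \<and> square_integrable lebesgue (u n)) \<and>
        L2_tendsto lebesgue u g sequentially \<and>
        L2_tendsto lebesgue (\<lambda>n. fourier_integral (u n)) G sequentially)"

text \<open>Continuity selects the continuous representative of each class.\<close>

definition paley_wiener :: "(real \<times> real \<Rightarrow> complex) set" where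
  "paley_wiener = {g. square_integrable lebesgue g \<and> continuous_on UNIV g \<and>
     (\<exists>G. fourier_transform_L2 g G \<and>
          (AE x in lebesgue. x \<notin> {-pi..pi} \<times> {-pi..pi} \<longrightarrow> G x = 0))}"

definition gaussian :: "real \<Rightarrow> real \<times> real \<Rightarrow> real" where
  "gaussian r = (\<lambda>(x1, x2). exp (- r * (x1\<^sup>2 + x2\<^sup>2)))"

text \<open>For the nodes considered here and \<open>r > 0\<close> the interpolation equations have exactly one
  square-summable solution, so the description below denotes it.\<close>

definition interpolation_coeff ::
  "('i \<Rightarrow> real \<times> real) \<Rightarrow> real \<Rightarrow> (real \<times> real \<Rightarrow> complex) \<Rightarrow> 'i \<Rightarrow> complex" where
  "interpolation_coeff z r F = (THE a. square_summable a \<and>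
     (\<forall>m. ((\<lambda>j. a j * complex_of_real (gaussian r (z m - z j))) has_sum F (z m)) UNIV))"

definition gaussian_interpolant ::
  "('i \<Rightarrow> real \<times> real) \<Rightarrow> real \<Rightarrow> (real \<times> real \<Rightarrow> complex) \<Rightarrow> real \<times> real \<Rightarrow> complex" where
  "gaussian_interpolant z r F w =
     (\<Sum>\<^sub>\<infinity>j. interpolation_coeff z r F j * complex_of_real (gaussian r (w - z j)))"

end

theory Submission
  imports Defs "HOL-Probability.Probability"
begin

text \<open>On the Fourier side the interpolation problem in one variable reads
  \<open>\<langle>w \<psi>, e\<^sub>m\<rangle> = f\<^sub>m\<close>, where \<open>w\<close> is the Gaussian weight \<open>gauss_weight r\<close> and \<open>\<psi>\<close> is the
  nonharmonic series of the coefficients. Testing with the coefficients themselves gives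
  \<open>\<integral>w \<bar>\<psi>\<bar>\<^sup>2 \<le> \<langle>f, a\<rangle>\<close>, and the Riesz bounds turn this into an estimate of the coefficients by
  \<open>1 / w \<pi>\<close>, which is exactly the size needed for the part of \<open>w \<psi>\<close> outside \<open>[-\<pi>, \<pi>]\<close> to be bounded,
  uniformly in \<open>r \<le> 1\<close>; if the spectrum lies in \<open>[-\<beta>, \<beta>]\<close> with \<open>\<beta> < \<pi>\<close>, a factor \<open>w \<pi> / w \<beta>\<close>
  is gained and the outer part vanishes as \<open>r\<close> tends to \<open>0\<close>. The inner part is recovered from its moments. On a grid
  the Gaussian factorises: the uniform bounds follow by working in one variable at a time, and
  it remains to treat indicator functions of rectangles as spectra, which are dense.\<close>

section \<open>Energies\<close>

text \<open>Inverting the interpolation matrix gives no bound uniform in \<open>r\<close>: its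
  coercivity constant is a multiple of w pi, which is exponentially small as \<open>r\<close> tends
  to 0. Coercivity of the matrix therefore only provides existence and uniqueness of the
  coefficients. The uniform estimates are proved for finitely many coefficients whose nodal values
  may miss the data by an l2 error \<open>R\<close>; truncation turns an exact infinite solution
  into such a family with an arbitrarily small extra error, so an infinite nonharmonic series is
  never formed.

  Spectral errors carry the additional weight exp (u^2 / 4), affordable because r \<le> 1. One
  weighted inequality then yields the L2 estimate by Plancherel and the uniform estimate by
  Cauchy--Schwarz.

  In the plane the comparison of weights breaks down: the coercivity constant is of the order (w
  pi)^2, while outside the square, near (pi, 0), the weight is as large as w pi * w 0. Hence the
  interpolation is factored through functions that are discrete in one variable and continuous in
  the other.\<close>

definition energy :: "'a measure \<Rightarrow> ('a \<Rightarrow> complex) \<Rightarrow> ennreal" where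
  "energy M f = (\<integral>\<^sup>+t. ennreal ((cmod (f t))\<^sup>2) \<partial>M)"

text \<open>Sequences are functions on a counting measure, so that Fatou and Tonelli serve sums and
  integrals alike. Values in \<open>ennreal\<close> free these rules from integrability conditions;
  \<open>square_integrable\<close> and \<open>square_summable\<close> reappear as finiteness of the
  energy.\<close>

abbreviation l2_energy :: "('i \<Rightarrow> complex) \<Rightarrow> ennreal" where
  "l2_energy c \<equiv> energy (count_space UNIV) c"

abbreviation sq_sum :: "('i \<Rightarrow> complex) \<Rightarrow> 'i set \<Rightarrow> real" where
  "sq_sum a J \<equiv> \<Sum>j\<in>J. (cmod (a j))\<^sup>2"

abbreviation sq_int :: "'a measure \<Rightarrow> ('a \<Rightarrow> complex) \<Rightarrow> real" where
  "sq_int M f \<equiv> \<integral>t. (cmod (f t))\<^sup>2 \<partial>M"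

lemma cmod_add_squared_le: "(cmod (a + b))\<^sup>2 \<le> 2 * (cmod a)\<^sup>2 + 2 * (cmod b)\<^sup>2"
proof -
  have "(cmod (a + b))\<^sup>2 \<le> (cmod a + cmod b)\<^sup>2"
    by (intro power_mono norm_triangle_ineq) auto
  also have "\<dots> \<le> 2 * (cmod a)\<^sup>2 + 2 * (cmod b)\<^sup>2"
    using zero_le_power2[of "cmod a - cmod b"] by (simp add: power2_sum power2_diff)
  finally show ?thesis .
qed

lemma energy_add_le:
  assumes [measurable]: "f \<in> borel_measurable M" "g \<in> borel_measurable M"
  shows "energy M (\<lambda>t. f t + g t) \<le> 2 * energy M f + 2 * energy M g"
proof -
  have "energy M (\<lambda>t. f t + g t)
    \<le> (\<integral>\<^sup>+t. 2 * ennreal ((cmod (f t))\<^sup>2) + 2 * ennreal ((cmod (g t))\<^sup>2) \<partial>M)"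
    unfolding energy_def
  proof (rule nn_integral_mono)
    fix t
    have "ennreal ((cmod (f t + g t))\<^sup>2) \<le> ennreal (2 * (cmod (f t))\<^sup>2 + 2 * (cmod (g t))\<^sup>2)"
      by (intro ennreal_leI cmod_add_squared_le)
    then show "ennreal ((cmod (f t + g t))\<^sup>2)
      \<le> 2 * ennreal ((cmod (f t))\<^sup>2) + 2 * ennreal ((cmod (g t))\<^sup>2)"
      by (simp add: ennreal_plus ennreal_mult)
  qed
  also have "\<dots> = 2 * energy M f + 2 * energy M g"
    unfolding energy_def by (simp add: nn_integral_add nn_integral_cmult)
  finally show ?thesis .
qed

lemma energy_uminus [simp]: "energy M (\<lambda>t. - f t) = energy M f"
  by (simp add: energy_def)

lemma energy_diff_le:
  assumes [measurable]: "f \<in> borel_measurable M" "g \<in> borel_measurable M"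
  shows "energy M (\<lambda>t. f t - g t) \<le> 2 * energy M f + 2 * energy M g"
  using energy_add_le[of f M "\<lambda>t. - g t"] by simp

lemma energy_scale:
  assumes [measurable]: "f \<in> borel_measurable M"
  shows "energy M (\<lambda>t. c * f t) = ennreal ((cmod c)\<^sup>2) * energy M f"
  unfolding energy_def
  by (simp add: norm_mult power_mult_distrib ennreal_mult nn_integral_cmult)

text \<open>The bounds \<open>C n\<close> vary with \<open>n\<close> because they carry truncation
  errors that tend to 0. Pointwise convergence alone then gives the limiting bound, without any
  convergence in L2.\<close>

lemma energy_Fatou:
  fixes C :: "nat \<Rightarrow> ennreal"
  assumes [measurable]: "\<And>n. f n \<in> borel_measurable M"
    and lim: "\<And>t. t \<in> space M \<Longrightarrow> (\<lambda>n. f n t) \<longlonglongrightarrow> g t"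
    and le: "\<And>n. energy M (f n) \<le> C n" and C: "C \<longlonglongrightarrow> L"
  shows "energy M g \<le> L"
proof -
  have "energy M g = (\<integral>\<^sup>+t. liminf (\<lambda>n. ennreal ((cmod (f n t))\<^sup>2)) \<partial>M)"
    unfolding energy_def
  proof (rule nn_integral_cong)
    fix t assume "t \<in> space M"
    then have "(\<lambda>n. ennreal ((cmod (f n t))\<^sup>2)) \<longlonglongrightarrow> ennreal ((cmod (g t))\<^sup>2)"
      by (intro tendsto_intros lim)
    then show "ennreal ((cmod (g t))\<^sup>2) = liminf (\<lambda>n. ennreal ((cmod (f n t))\<^sup>2))"
      by (rule lim_imp_Liminf[symmetric, rotated]) simp
  qed
  also have "\<dots> \<le> liminf (\<lambda>n. energy M (f n))"
    unfolding energy_def by (rule nn_integral_liminf) measurable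
  also have "\<dots> \<le> liminf C"
    by (intro Liminf_mono always_eventually allI le)
  also have "\<dots> = L"
    using C by (simp add: lim_imp_Liminf)
  finally show ?thesis .
qed

lemma sum_le_l2_energy:
  assumes "finite K"
  shows "ennreal (sq_sum c K) \<le> l2_energy c"
proof -
  have "ennreal (sq_sum c K) = (\<integral>\<^sup>+j. ennreal ((cmod (c j))\<^sup>2) \<partial>count_space K)"
    using assms by (simp add: nn_integral_count_space_finite sum_ennreal)
  also have "\<dots> = (\<integral>\<^sup>+j. ennreal ((cmod (c j))\<^sup>2) * indicator K j \<partial>count_space UNIV)"
    by (simp add: nn_integral_count_space_indicator)
  also have "\<dots> \<le> l2_energy c"
    unfolding energy_def by (intro nn_integral_mono) (auto simp: indicator_def)
  finally show ?thesis .
qed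

lemma square_summable_iff_energy: "square_summable c \<longleftrightarrow> l2_energy c < \<infinity>"
proof -
  have "square_summable c \<longleftrightarrow> Infinite_Sum.abs_summable_on (\<lambda>j. (cmod (c j))\<^sup>2) UNIV"
    by (simp add: square_summable_def)
  also have "\<dots> \<longleftrightarrow> integrable (count_space UNIV) (\<lambda>j. (cmod (c j))\<^sup>2)"
    by (simp only: abs_summable_equivalent Infinite_Set_Sum.abs_summable_on_def)
  also have "\<dots> \<longleftrightarrow> l2_energy c < \<infinity>"
    by (simp add: integrable_iff_bounded energy_def)
  finally show ?thesis .
qed

lemma l2_energy_le_iff:
  fixes c :: "'i::countable \<Rightarrow> complex"
  assumes "R \<ge> 0"
  shows "l2_energy c \<le> ennreal R \<longleftrightarrow> (\<forall>K. finite K \<longrightarrow> (sq_sum c K) \<le> R)"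
proof
  assume *: "l2_energy c \<le> ennreal R"
  show "\<forall>K. finite K \<longrightarrow> (sq_sum c K) \<le> R"
    using order_trans[OF sum_le_l2_energy *] assms by (auto simp: ennreal_le_iff)
next
  assume *: "\<forall>K. finite K \<longrightarrow> (sq_sum c K) \<le> R"
  have "(\<lambda>j. (cmod (c j))\<^sup>2) summable_on UNIV"
    by (rule nonneg_bdd_above_summable_on) (use * in \<open>auto intro!: bdd_aboveI2[where M = R]\<close>)
  then have "l2_energy c < \<infinity>"
    using square_summable_iff_energy[of c] by (simp add: square_summable_def)
  \<comment> \<open>\<open>to_nat\<close> exhausts the countable index type by finite sets, so that
    Fatou applies along a sequence instead of the net of all finite sets.\<close>
  define P where "P n = {j :: 'i. to_nat j < n}" for n
  have fin: "finite (P n)" for n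
    unfolding P_def by (rule finite_subset[OF _ finite_vimageI[of "{..<n}" to_nat]]) auto
  show "l2_energy c \<le> ennreal R"
  proof (rule energy_Fatou[where f = "\<lambda>n j. if j \<in> P n then c j else 0" and C = "\<lambda>_. ennreal R"])
    fix n
    have "energy (count_space UNIV) (\<lambda>j. if j \<in> P n then c j else 0)
        = (\<integral>\<^sup>+j. ennreal ((cmod (c j))\<^sup>2) * indicator (P n) j \<partial>count_space UNIV)"
      unfolding energy_def by (intro nn_integral_cong) (auto simp: indicator_def)
    also have "\<dots> = (\<integral>\<^sup>+j. ennreal ((cmod (c j))\<^sup>2) \<partial>count_space (P n))"
      by (simp add: nn_integral_count_space_indicator)
    also have "\<dots> = ennreal (sq_sum c (P n))"
      using fin by (simp add: nn_integral_count_space_finite sum_ennreal)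
    also have "\<dots> \<le> ennreal R" using * fin by (intro ennreal_leI) auto
    finally show "energy (count_space UNIV) (\<lambda>j. if j \<in> P n then c j else 0) \<le> ennreal R" .
  next
    fix j :: 'i
    have "\<forall>\<^sub>F n in sequentially. (if j \<in> P n then c j else 0) = c j"
      unfolding P_def by (auto simp: eventually_sequentially intro!: exI[of _ "Suc (to_nat j)"])
    then show "(\<lambda>n. if j \<in> P n then c j else 0) \<longlonglongrightarrow> c j"
      by (rule tendsto_eventually)
  qed auto
qed

lemma l2_energy_finite:
  assumes "finite J" "\<And>j. j \<notin> J \<Longrightarrow> c j = 0"
  shows "l2_energy c = ennreal (sq_sum c J)"
proof -
  have "l2_energy c = (\<integral>\<^sup>+j. ennreal ((cmod (c j))\<^sup>2) * indicator J j \<partial>count_space UNIV)"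
    unfolding energy_def using assms(2) by (intro nn_integral_cong) (auto simp: indicator_def)
  also have "\<dots> = ennreal (sq_sum c J)"
    using assms(1) by (simp add: nn_integral_count_space_indicator[symmetric]
        nn_integral_count_space_finite sum_ennreal)
  finally show ?thesis .
qed

lemma square_integrable_iff_energy:
  "square_integrable M f \<longleftrightarrow> f \<in> borel_measurable M \<and> energy M f < \<infinity>"
  unfolding square_integrable_def energy_def
  by (auto simp: integrable_iff_bounded)

lemma energy_eq_L2_norm:
  assumes "square_integrable M f"
  shows "energy M f = ennreal ((L2_norm M f)\<^sup>2)"
  using assms unfolding square_integrable_def energy_def L2_norm_def
  by (simp add: nn_integral_eq_integral)

lemma energy_eq_integral:
  assumes "square_integrable M f"
  shows "energy M f = ennreal (sq_int M f)"
  using assms unfolding square_integrable_def energy_def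
  by (simp add: nn_integral_eq_integral)

lemma L2_norm_le:
  assumes "f \<in> borel_measurable M" "energy M f \<le> ennreal (R\<^sup>2)" "R \<ge> 0"
  shows "L2_norm M f \<le> R"
proof -
  have "square_integrable M f"
    using assms by (auto simp: square_integrable_iff_energy intro: le_less_trans)
  then have "(L2_norm M f)\<^sup>2 \<le> R\<^sup>2"
    using assms by (simp add: energy_eq_L2_norm ennreal_le_iff)
  then show ?thesis using assms(3) by (rule power2_le_imp_le)
qed

text \<open>Both claims come from the inequality for nonnegative integrals: finiteness of its left
  side is the integrability of the product. The pairing is bilinear, so callers insert
  \<open>cnj\<close> where a scalar product is meant.\<close>

lemma Cauchy_Schwarz_integral:
  fixes f g :: "'a \<Rightarrow> complex"
  assumes f: "square_integrable M f" and g: "square_integrable M g"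
  shows "integrable M (\<lambda>t. f t * g t)"
    and "(cmod (\<integral>t. f t * g t \<partial>M))\<^sup>2
      \<le> (sq_int M f) * (sq_int M g)"
proof -
  have [measurable]: "f \<in> borel_measurable M" "g \<in> borel_measurable M"
    using f g by (auto simp: square_integrable_def)
  let ?I = "\<integral>\<^sup>+t. ennreal (cmod (f t * g t)) \<partial>M"
  let ?P = "(sq_int M f) * (sq_int M g)"
  have P0: "0 \<le> ?P" by (intro mult_nonneg_nonneg integral_nonneg_AE) auto
  have "?I\<^sup>2 \<le> energy M f * energy M g"
    using Cauchy_Schwarz_nn_integral[of "\<lambda>t. ennreal (cmod (f t))" M "\<lambda>t. ennreal (cmod (g t))"]
    by (simp add: energy_def norm_mult ennreal_mult ennreal_power)
  also have "\<dots> = ennreal ?P"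
    using f g by (simp add: energy_eq_integral ennreal_mult)
  finally have le: "?I\<^sup>2 \<le> ennreal ?P" .
  then have "?I\<^sup>2 < \<infinity>" by (auto intro: le_less_trans)
  then have fin: "?I < \<infinity>" by (auto simp: power2_eq_square ennreal_mult_less_top less_top)
  then show int: "integrable M (\<lambda>t. f t * g t)"
    by (intro integrableI_bounded) auto
  have "?I = ennreal (\<integral>t. cmod (f t * g t) \<partial>M)"
    using int by (intro nn_integral_eq_integral) auto
  with le have "ennreal ((\<integral>t. cmod (f t * g t) \<partial>M)\<^sup>2) \<le> ennreal ?P"
    by (simp add: ennreal_power)
  then have "(\<integral>t. cmod (f t * g t) \<partial>M)\<^sup>2 \<le> ?P"
    using P0 by (simp add: ennreal_le_iff)
  moreover have "(cmod (\<integral>t. f t * g t \<partial>M))\<^sup>2 \<le> (\<integral>t. cmod (f t * g t) \<partial>M)\<^sup>2"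
    by (intro power_mono integral_norm_bound) auto
  ultimately show "(cmod (\<integral>t. f t * g t \<partial>M))\<^sup>2 \<le> ?P" by (rule order_trans[rotated])
qed

section \<open>Positive definite systems on l2\<close>

text \<open>\<open>R\<close> bounds the square of the l2 norm. Testing finite sections makes the
  bound stable under pointwise limits and avoids separate summability proofs; the empty section
  forces 0 \<le> R.\<close>

definition l2_le :: "('i \<Rightarrow> complex) \<Rightarrow> real \<Rightarrow> bool" where
  "l2_le c R \<longleftrightarrow> (\<forall>K. finite K \<longrightarrow> (sq_sum c K) \<le> R)"

lemma l2_le_nonneg: "l2_le c R \<Longrightarrow> 0 \<le> R"
  unfolding l2_le_def by (drule spec[of _ "{}"]) simp

lemma l2_leD: "l2_le c R \<Longrightarrow> finite K \<Longrightarrow> (sq_sum c K) \<le> R"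
  by (simp add: l2_le_def)

lemma l2_le_energy: "0 \<le> R \<Longrightarrow> l2_energy c \<le> ennreal R \<longleftrightarrow> l2_le c R"
  for c :: "'i::countable \<Rightarrow> complex"
  by (simp add: l2_energy_le_iff l2_le_def)

lemma l2_le_of_energy:
  fixes c :: "'i::countable \<Rightarrow> complex"
  assumes "l2_energy c < \<infinity>"
  shows "l2_le c (enn2real (l2_energy c))"
  using assms by (subst l2_le_energy[symmetric]) (auto simp: less_top)

lemma l2_le_cmod_le:
  assumes "l2_le c R" shows "cmod (c j) \<le> sqrt R"
  using l2_leD[OF assms, of "{j}"] by (simp add: real_le_rsqrt)

lemma square_summable_iff_l2_le:
  fixes c :: "'i::countable \<Rightarrow> complex"
  shows "square_summable c \<longleftrightarrow> (\<exists>R. l2_le c R)"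
proof
  assume "square_summable c"
  then show "\<exists>R. l2_le c R"
    using l2_le_of_energy square_summable_iff_energy by blast
next
  assume "\<exists>R. l2_le c R"
  then obtain R where "l2_le c R" by blast
  then have "l2_energy c \<le> ennreal R" using l2_le_energy l2_le_nonneg by blast
  then show "square_summable c"
    by (auto simp: square_summable_iff_energy intro: le_less_trans)
qed

lemma l2_le_add:
  assumes "l2_le a R" "l2_le b S" shows "l2_le (\<lambda>j. a j + b j) (2 * R + 2 * S)"
  unfolding l2_le_def
proof (intro allI impI)
  fix K :: "'a set" assume K: "finite K"
  have "(\<Sum>j\<in>K. (cmod (a j + b j))\<^sup>2) \<le> (\<Sum>j\<in>K. 2 * (cmod (a j))\<^sup>2 + 2 * (cmod (b j))\<^sup>2)"
    by (intro sum_mono cmod_add_squared_le)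
  also have "\<dots> = 2 * (sq_sum a K) + 2 * (sq_sum b K)"
    by (simp add: sum.distrib sum_distrib_left)
  also have "\<dots> \<le> 2 * R + 2 * S"
    using l2_leD[OF assms(1) K] l2_leD[OF assms(2) K] by simp
  finally show "(\<Sum>j\<in>K. (cmod (a j + b j))\<^sup>2) \<le> 2 * R + 2 * S" .
qed

lemma l2_le_uminus: "l2_le (\<lambda>j. - a j) R \<longleftrightarrow> l2_le a R"
  by (simp add: l2_le_def)

lemma l2_le_diff:
  assumes "l2_le a R" "l2_le b S" shows "l2_le (\<lambda>j. a j - b j) (2 * R + 2 * S)"
  using l2_le_add[of a R "\<lambda>j. - b j" S] assms by (simp add: l2_le_uminus)

lemma l2_le_scale:
  assumes "l2_le a R" shows "l2_le (\<lambda>j. c * a j) ((cmod c)\<^sup>2 * R)"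
  unfolding l2_le_def norm_mult power_mult_distrib sum_distrib_left[symmetric]
  using assms by (intro allI impI mult_left_mono l2_leD) auto

section \<open>Symmetric nonnegative matrices with bounded row sums, acting on sequences\<close>

locale nonneg_matrix =
  fixes A :: "'i::countable \<Rightarrow> 'i \<Rightarrow> real" and M :: real
  assumes nonneg: "0 \<le> A i j"
    and sym: "A i j = A j i"
    and rows: "finite J \<Longrightarrow> (\<Sum>j\<in>J. A i j) \<le> M"
begin

text \<open>\<open>infsum\<close> returns 0 for a row that is not summable. Most lemmas below
  therefore assume a bounded sequence, which together with the bound \<open>M\<close> on the row
  sums makes every row absolutely summable.\<close>

definition app :: "('i \<Rightarrow> complex) \<Rightarrow> 'i \<Rightarrow> complex" where
  "app a i = (\<Sum>\<^sub>\<infinity>j. a j * complex_of_real (A i j))"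

lemma M_nonneg: "0 \<le> M"
  using rows[of "{}" undefined] by simp

lemma row_sum_le:
  assumes "\<And>j. cmod (a j) \<le> R" "finite J"
  shows "(\<Sum>j\<in>J. cmod (a j * complex_of_real (A i j))) \<le> R * M"
proof -
  have "0 \<le> R" using assms(1) norm_ge_zero order_trans by blast
  have "(\<Sum>j\<in>J. cmod (a j * complex_of_real (A i j))) \<le> (\<Sum>j\<in>J. R * A i j)"
    using assms(1) nonneg by (intro sum_mono) (auto simp: norm_mult intro!: mult_right_mono)
  also have "\<dots> \<le> R * M"
    using rows[OF assms(2)] \<open>0 \<le> R\<close> by (auto simp: sum_distrib_left[symmetric] intro!: mult_left_mono)
  finally show ?thesis .
qed

lemma row_abs_summable:
  assumes "\<And>j. cmod (a j) \<le> R"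
  shows "(\<lambda>j. cmod (a j * complex_of_real (A i j))) summable_on UNIV"
proof (rule nonneg_bdd_above_summable_on)
  show "bdd_above (sum (\<lambda>j. cmod (a j * complex_of_real (A i j))) ` {F. F \<subseteq> UNIV \<and> finite F})"
    by (rule bdd_aboveI2[where M = "R * M"], rule row_sum_le[OF assms]) simp
qed (rule norm_ge_zero)

lemma row_summable:
  assumes "\<And>j. cmod (a j) \<le> R"
  shows "(\<lambda>j. a j * complex_of_real (A i j)) summable_on UNIV"
  by (rule abs_summable_summable[OF row_abs_summable[OF assms]])

lemma row_has_sum:
  assumes "\<And>j. cmod (a j) \<le> R"
  shows "((\<lambda>j. a j * complex_of_real (A i j)) has_sum app a i) UNIV"
  unfolding app_def by (rule has_sum_infsum[OF row_summable[OF assms]])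

lemma app_bound:
  assumes "\<And>j. cmod (a j) \<le> R"
  shows "cmod (app a i) \<le> R * M"
proof -
  have "cmod (app a i) \<le> (\<Sum>\<^sub>\<infinity>j. cmod (a j * complex_of_real (A i j)))"
    unfolding app_def by (rule norm_infsum_bound[OF row_abs_summable[OF assms]])
  also have "\<dots> \<le> R * M"
    by (rule infsum_le_finite_sums[OF row_abs_summable[OF assms]]) (rule row_sum_le[OF assms])
  finally show ?thesis .
qed

lemma app_unique:
  assumes "\<And>i. ((\<lambda>j. a j * complex_of_real (A i j)) has_sum f i) UNIV"
  shows "app a = f"
  by (rule ext) (simp only: app_def infsumI[OF assms])

lemma app_add:
  assumes "\<And>j. cmod (a j) \<le> R" "\<And>j. cmod (b j) \<le> S"
  shows "app (\<lambda>j. a j + b j) i = app a i + app b i"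
  unfolding app_def ring_distribs
  by (intro infsum_add row_summable[OF assms(1)] row_summable[OF assms(2)])

lemma app_scale: "app (\<lambda>j. c * a j) i = c * app a i"
  unfolding app_def mult.assoc by (rule infsum_cmult_right')

lemma app_diff:
  assumes "\<And>j. cmod (a j) \<le> R" "\<And>j. cmod (b j) \<le> S"
  shows "app (\<lambda>j. a j - b j) i = app a i - app b i"
proof -
  have "app (\<lambda>j. a j + (- 1) * b j) i = app a i + (- 1) * app b i"
    unfolding app_scale[symmetric] by (rule app_add[OF assms(1), where S = S]) (simp_all add: assms(2))
  then show ?thesis by simp
qed

lemma app_finite:
  assumes "finite J" "\<And>j. j \<notin> J \<Longrightarrow> a j = 0"
  shows "app a i = (\<Sum>j\<in>J. a j * complex_of_real (A i j))"
proof -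
  have "app a i = infsum (\<lambda>j. a j * complex_of_real (A i j)) J"
    unfolding app_def using assms(2) by (intro infsum_cong_neutral) auto
  then show ?thesis using assms(1) by simp
qed

text \<open>Schur's test, by the weighted Cauchy--Schwarz inequality in each row.\<close>

lemma Schur_finite:
  assumes "finite J" "finite K"
  shows "(\<Sum>i\<in>K. (cmod (\<Sum>j\<in>J. a j * complex_of_real (A i j)))\<^sup>2) \<le> M\<^sup>2 * (sq_sum a J)"
proof -
  have row: "(cmod (\<Sum>j\<in>J. a j * complex_of_real (A i j)))\<^sup>2 \<le> M * (\<Sum>j\<in>J. A i j * (cmod (a j))\<^sup>2)" for i
  proof -
    have "cmod (\<Sum>j\<in>J. a j * complex_of_real (A i j)) \<le> (\<Sum>j\<in>J. sqrt (A i j) * (sqrt (A i j) * cmod (a j)))"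
      using nonneg by (intro sum_norm_le) (auto simp: norm_mult mult.assoc[symmetric])
    then have "(cmod (\<Sum>j\<in>J. a j * complex_of_real (A i j)))\<^sup>2
      \<le> (\<Sum>j\<in>J. sqrt (A i j) * (sqrt (A i j) * cmod (a j)))\<^sup>2"
      by (intro power_mono) auto
    also have "\<dots> \<le> (\<Sum>j\<in>J. (sqrt (A i j))\<^sup>2) * (\<Sum>j\<in>J. (sqrt (A i j) * cmod (a j))\<^sup>2)"
      by (rule Cauchy_Schwarz_ineq_sum)
    also have "\<dots> = (\<Sum>j\<in>J. A i j) * (\<Sum>j\<in>J. A i j * (cmod (a j))\<^sup>2)"
      using nonneg by (simp add: power_mult_distrib)
    also have "\<dots> \<le> M * (\<Sum>j\<in>J. A i j * (cmod (a j))\<^sup>2)"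
      using nonneg rows[OF assms(1)] by (intro mult_right_mono sum_nonneg) auto
    finally show ?thesis .
  qed
  have "(\<Sum>i\<in>K. (cmod (\<Sum>j\<in>J. a j * complex_of_real (A i j)))\<^sup>2)
    \<le> (\<Sum>i\<in>K. M * (\<Sum>j\<in>J. A i j * (cmod (a j))\<^sup>2))"
    by (intro sum_mono row)
  also have "\<dots> = M * (\<Sum>j\<in>J. (\<Sum>i\<in>K. A j i) * (cmod (a j))\<^sup>2)"
  proof -
    have "(\<Sum>i\<in>K. \<Sum>j\<in>J. A i j * (cmod (a j))\<^sup>2) = (\<Sum>j\<in>J. \<Sum>i\<in>K. A i j * (cmod (a j))\<^sup>2)"
      by (rule sum.swap)
    also have "\<dots> = (\<Sum>j\<in>J. \<Sum>i\<in>K. A j i * (cmod (a j))\<^sup>2)"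
      by (intro sum.cong refl arg_cong2[where f = "(*)"] sym)
    finally show ?thesis by (simp add: sum_distrib_left[symmetric] sum_distrib_right)
  qed
  also have "\<dots> \<le> M * (\<Sum>j\<in>J. M * (cmod (a j))\<^sup>2)"
    using rows[OF assms(2)] M_nonneg by (intro mult_left_mono sum_mono mult_right_mono) auto
  finally show ?thesis by (simp add: sum_distrib_left power2_eq_square mult.assoc)
qed

text \<open>For a fixed finite set of rows \<open>K\<close> the finite inequality passes to the
  limit along the net of column sets, since each row sum converges.\<close>

lemma Schur_l2_le:
  assumes a: "l2_le a R"
  shows "l2_le (app a) (M\<^sup>2 * R)"
  unfolding l2_le_def
proof (intro allI impI)
  fix K :: "'i set" assume K: "finite K"
  have *: "((\<lambda>J. \<Sum>j\<in>J. a j * complex_of_real (A i j)) \<longlongrightarrow> app a i) (finite_subsets_at_top UNIV)" for i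
    using row_has_sum[OF l2_le_cmod_le[OF a]] by (simp add: has_sum_def)
  show "(\<Sum>i\<in>K. (cmod (app a i))\<^sup>2) \<le> M\<^sup>2 * R"
  proof (rule tendsto_upperbound)
    show "((\<lambda>J. \<Sum>i\<in>K. (cmod (\<Sum>j\<in>J. a j * complex_of_real (A i j)))\<^sup>2)
      \<longlongrightarrow> (\<Sum>i\<in>K. (cmod (app a i))\<^sup>2)) (finite_subsets_at_top UNIV)"
      by (intro tendsto_intros *)
    show "\<forall>\<^sub>F J in finite_subsets_at_top UNIV.
      (\<Sum>i\<in>K. (cmod (\<Sum>j\<in>J. a j * complex_of_real (A i j)))\<^sup>2) \<le> M\<^sup>2 * R"
    proof (rule eventually_finite_subsets_at_top_weakI)
      fix J :: "'i set" assume J: "finite J"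
      show "(\<Sum>i\<in>K. (cmod (\<Sum>j\<in>J. a j * complex_of_real (A i j)))\<^sup>2) \<le> M\<^sup>2 * R"
        using Schur_finite[OF J K, of a] mult_left_mono[OF l2_leD[OF a J], of "M\<^sup>2"] by simp
    qed
  qed auto
qed

end

section \<open>Coercive matrices: unique solvability by a contraction\<close>

locale coercive_matrix = nonneg_matrix A M for A :: "'i::countable \<Rightarrow> 'i \<Rightarrow> real" and M +
  fixes \<delta> :: real
  assumes \<delta>_pos: "0 < \<delta>"
    and coercive: "finite J \<Longrightarrow> \<delta> * (sq_sum a J)
      \<le> Re (\<Sum>i\<in>J. (\<Sum>j\<in>J. a j * complex_of_real (A i j)) * cnj (a i))"
begin

text \<open>The map a - \<tau> A a has squared norm at most 1 - 2 \<tau> \<delta> + \<tau>^2 M^2.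
  This \<tau> is the minimiser of that quadratic, and the square of \<open>q\<close> is its
  minimum.\<close>

definition \<tau> :: real where "\<tau> = \<delta> / M\<^sup>2"

definition q :: real where "q = sqrt (1 - \<delta>\<^sup>2 / M\<^sup>2)"

text \<open>Testing with a unit vector puts a diagonal entry between \<delta> and
  \<open>M\<close>.\<close>

lemma \<delta>_le_M: "\<delta> \<le> M"
  using coercive[of "{undefined}" "\<lambda>_. 1"] rows[of "{undefined}" undefined] by simp

lemma M_pos: "0 < M" using \<delta>_le_M \<delta>_pos by simp

lemma \<tau>_pos: "0 < \<tau>" using M_pos \<delta>_pos by (simp add: \<tau>_def)

lemma ratio_le_1: "\<delta>\<^sup>2 / M\<^sup>2 \<le> 1"
proof -
  have "\<delta>\<^sup>2 \<le> M\<^sup>2" using \<delta>_le_M \<delta>_pos by (intro power_mono) auto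
  then show ?thesis using M_pos by (simp add: divide_le_eq_1)
qed

lemma q_squared: "q\<^sup>2 = 1 - \<delta>\<^sup>2 / M\<^sup>2"
  unfolding q_def by (rule real_sqrt_pow2) (use ratio_le_1 in linarith)

lemma q_bounds: "0 \<le> q" "q < 1"
proof -
  show "0 \<le> q" unfolding q_def by (rule real_sqrt_ge_zero) (use ratio_le_1 in linarith)
  have "\<delta>\<^sup>2 / M\<^sup>2 > 0" using \<delta>_pos M_pos by simp
  then have "q\<^sup>2 < 1\<^sup>2" by (simp add: q_squared)
  then show "q < 1" by (rule power2_less_imp_less) simp
qed

text \<open>In the expansion of |a - \<tau> A a|^2 coercivity bounds the cross term and Schur's test
  the last term. The rows \<open>K\<close> may exceed the support \<open>J\<close>, because A a does
  not vanish outside \<open>J\<close>; the cross term sees only \<open>J\<close>.\<close>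

lemma contraction_finite:
  assumes J: "finite J" and K: "finite K" "J \<subseteq> K" and a: "\<And>j. j \<notin> J \<Longrightarrow> a j = 0"
  shows "(\<Sum>i\<in>K. (cmod (a i - complex_of_real \<tau> * (\<Sum>j\<in>J. a j * complex_of_real (A i j))))\<^sup>2)
    \<le> q\<^sup>2 * (sq_sum a J)"
proof -
  define b where "b i = (\<Sum>j\<in>J. a j * complex_of_real (A i j))" for i
  define S where "S = (sq_sum a J)"
  have expand: "(cmod (a i - complex_of_real \<tau> * b i))\<^sup>2
    = (cmod (a i))\<^sup>2 - 2 * \<tau> * Re (b i * cnj (a i)) + \<tau>\<^sup>2 * (cmod (b i))\<^sup>2" for i
    unfolding cmod_power2 by (simp add: power2_eq_square algebra_simps)
  have "(\<Sum>i\<in>K. (cmod (a i - complex_of_real \<tau> * b i))\<^sup>2)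
    = (sq_sum a K) - 2 * \<tau> * Re (\<Sum>i\<in>K. b i * cnj (a i)) + \<tau>\<^sup>2 * (sq_sum b K)"
    unfolding expand Re_sum sum.distrib sum_subtractf sum_distrib_left by (rule refl)
  also have "(sq_sum a K) = S"
    unfolding S_def using K a by (intro sum.mono_neutral_right) auto
  also have "(\<Sum>i\<in>K. b i * cnj (a i)) = (\<Sum>i\<in>J. b i * cnj (a i))"
    using K a by (intro sum.mono_neutral_right) auto
  also have "S - 2 * \<tau> * Re (\<Sum>i\<in>J. b i * cnj (a i)) + \<tau>\<^sup>2 * (sq_sum b K)
    \<le> S - 2 * \<tau> * (\<delta> * S) + \<tau>\<^sup>2 * (M\<^sup>2 * S)"
    using coercive[OF J, of a] Schur_finite[OF J K(1), of a] \<tau>_pos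
    unfolding b_def S_def by (intro add_mono diff_mono mult_left_mono order_refl) auto
  also have "\<dots> = q\<^sup>2 * S"
  proof -
    have "\<tau> * \<delta> = \<delta>\<^sup>2 / M\<^sup>2" "\<tau>\<^sup>2 * M\<^sup>2 = \<delta>\<^sup>2 / M\<^sup>2"
      using M_pos by (simp_all add: \<tau>_def power2_eq_square)
    then have "2 * \<tau> * (\<delta> * S) = 2 * (\<delta>\<^sup>2 / M\<^sup>2) * S" "\<tau>\<^sup>2 * (M\<^sup>2 * S) = (\<delta>\<^sup>2 / M\<^sup>2) * S"
      by (metis mult.assoc)+
    then show ?thesis unfolding q_squared by (simp add: algebra_simps)
  qed
  finally show ?thesis unfolding b_def S_def .
qed

lemma contraction:
  assumes a: "l2_le a R"
  shows "l2_le (\<lambda>i. a i - complex_of_real \<tau> * app a i) (q\<^sup>2 * R)"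
  unfolding l2_le_def
proof (intro allI impI)
  fix K :: "'i set" assume K: "finite K"
  have *: "((\<lambda>J. \<Sum>j\<in>J. a j * complex_of_real (A i j)) \<longlongrightarrow> app a i) (finite_subsets_at_top UNIV)" for i
    using row_has_sum[OF l2_le_cmod_le[OF a]] by (simp add: has_sum_def)
  show "(\<Sum>i\<in>K. (cmod (a i - complex_of_real \<tau> * app a i))\<^sup>2) \<le> q\<^sup>2 * R"
  proof (rule tendsto_upperbound)
    show "((\<lambda>J. \<Sum>i\<in>K. (cmod (a i - complex_of_real \<tau> * (\<Sum>j\<in>J. a j * complex_of_real (A i j))))\<^sup>2)
      \<longlongrightarrow> (\<Sum>i\<in>K. (cmod (a i - complex_of_real \<tau> * app a i))\<^sup>2)) (finite_subsets_at_top UNIV)"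
      by (intro tendsto_intros *)
    show "\<forall>\<^sub>F J in finite_subsets_at_top UNIV.
      (\<Sum>i\<in>K. (cmod (a i - complex_of_real \<tau> * (\<Sum>j\<in>J. a j * complex_of_real (A i j))))\<^sup>2) \<le> q\<^sup>2 * R"
      unfolding eventually_finite_subsets_at_top
    proof (intro exI[of _ K] conjI allI impI)
      show "finite K" "K \<subseteq> UNIV" using K by auto
      \<comment> \<open>For \<open>J\<close> containing \<open>K\<close> the sum over
        \<open>K\<close> is at most the sum over \<open>J\<close>, and the finite contraction
        applies to \<open>a\<close> cut off to \<open>J\<close>.\<close>
      fix J :: "'i set" assume J: "finite J \<and> K \<subseteq> J \<and> J \<subseteq> UNIV"
      define a' where "a' j = (if j \<in> J then a j else 0)" for j
      have "(\<Sum>i\<in>K. (cmod (a i - complex_of_real \<tau> * (\<Sum>j\<in>J. a j * complex_of_real (A i j))))\<^sup>2)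
        \<le> (\<Sum>i\<in>J. (cmod (a i - complex_of_real \<tau> * (\<Sum>j\<in>J. a j * complex_of_real (A i j))))\<^sup>2)"
        using J by (intro sum_mono2) auto
      also have "\<dots> = (\<Sum>i\<in>J. (cmod (a' i - complex_of_real \<tau> * (\<Sum>j\<in>J. a' j * complex_of_real (A i j))))\<^sup>2)"
        unfolding a'_def by (intro sum.cong refl) simp
      also have "\<dots> \<le> q\<^sup>2 * (\<Sum>j\<in>J. (cmod (a' j))\<^sup>2)"
        using J by (intro contraction_finite) (auto simp: a'_def)
      also have "(\<Sum>j\<in>J. (cmod (a' j))\<^sup>2) = (sq_sum a J)"
        unfolding a'_def by (intro sum.cong refl) simp
      also have "q\<^sup>2 * (sq_sum a J) \<le> q\<^sup>2 * R"
        using l2_leD[OF a] J by (intro mult_left_mono) auto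
      finally show "(\<Sum>i\<in>K. (cmod (a i - complex_of_real \<tau> * (\<Sum>j\<in>J. a j * complex_of_real (A i j))))\<^sup>2) \<le> q\<^sup>2 * R" .
    qed
  qed auto
qed

text \<open>If A d = 0, the contraction maps \<open>d\<close> to itself, so its l2 bound may be
  multiplied by the square of \<open>q\<close> arbitrarily often.\<close>

lemma app_eq_0:
  assumes d: "l2_le d R" and "\<And>i. app d i = 0"
  shows "d i = 0"
proof -
  have "l2_le d ((q\<^sup>2) ^ n * R)" for n
  proof (induction n)
    case (Suc n)
    show ?case using contraction[OF Suc] assms(2) by (simp add: mult_ac)
  qed (simp add: d)
  then have "(cmod (d i))\<^sup>2 \<le> (q\<^sup>2) ^ n * R" for n
    using l2_leD[of d _ "{i}"] by fastforce
  moreover have "(\<lambda>n. (q\<^sup>2) ^ n * R) \<longlonglongrightarrow> 0 * R"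
    using q_bounds by (intro tendsto_intros LIMSEQ_power_zero) (simp add: power_less_one_iff abs_square_less_1)
  ultimately have "(cmod (d i))\<^sup>2 \<le> 0"
    by (intro LIMSEQ_le_const) auto
  then show ?thesis by simp
qed

text \<open>The solution is the Neumann series of \<open>\<tau> A = I - (I - \<tau> A)\<close>.\<close>

lemma solution_exists:
  assumes f: "l2_le f R"
  obtains a S where "l2_le a S" "app a = f"
proof -
  define T where "T c i = c i - complex_of_real \<tau> * app c i" for c :: "'i \<Rightarrow> complex" and i
  \<comment> \<open>\<open>r n\<close> plays two roles: it is the n-th term of the series, and by
    \<open>app_s\<close> also the residual left by the n-th partial sum \<open>s n\<close>.\<close>
  define r where "r n = (T ^^ n) f" for n
  define F where "F = sqrt R"
  have R: "0 \<le> R" using l2_le_nonneg[OF f] .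
  have F: "0 \<le> F" by (simp add: F_def R)
  have r_Suc: "r (Suc n) i = r n i - complex_of_real \<tau> * app (r n) i" for n i
    by (simp add: r_def T_def)
  have r_l2: "l2_le (r n) ((q\<^sup>2) ^ n * R)" for n
  proof (induction n)
    case (Suc n)
    have "r (Suc n) = (\<lambda>i. r n i - complex_of_real \<tau> * app (r n) i)" using r_Suc by auto
    then show ?case using contraction[OF Suc] by (simp add: mult_ac)
  qed (simp add: r_def f)
  have sq: "sqrt ((q\<^sup>2) ^ n * R) = q ^ n * F" for n
    unfolding F_def using q_bounds by (simp add: real_sqrt_mult real_sqrt_power)
  have r_le: "cmod (r n j) \<le> q ^ n * F" for n j
    using l2_le_cmod_le[OF r_l2] sq by metis
  have geo: "summable (\<lambda>n. q ^ n * F)" using q_bounds by (intro summable_mult2 summable_geometric) auto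
  have summ: "summable (\<lambda>n. r n j)" for j
    by (rule summable_comparison_test'[OF geo]) (use r_le in auto)
  define s where "s n j = (\<Sum>k<n. r k j)" for n j
  define a where "a j = (\<Sum>k. r k j)" for j
  have s_lim: "(\<lambda>n. s n j) \<longlonglongrightarrow> a j" for j
    unfolding s_def a_def by (rule summable_LIMSEQ[OF summ])
  define G where "G = F / (1 - q)"
  have geo_le: "(\<Sum>k<n. q ^ k * F) \<le> G" for n
  proof -
    have "(\<Sum>k<n. q ^ k * F) \<le> (\<Sum>k. q ^ k * F)"
      using F q_bounds by (intro sum_le_suminf geo) auto
    also have "\<dots> = G" using q_bounds by (simp add: suminf_mult2[symmetric] suminf_geometric G_def)
    finally show ?thesis .
  qed
  have tail: "cmod (a j - s n j) \<le> q ^ n * G" for n j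
  proof -
    have "a j - s n j = (\<Sum>k. r (k + n) j)"
      unfolding a_def s_def by (rule suminf_minus_initial_segment[OF summ, symmetric])
    also have "cmod \<dots> \<le> (\<Sum>k. q ^ (k + n) * F)"
      by (rule norm_suminf_le[OF r_le]) (rule summable_ignore_initial_segment[OF geo])
    also have "\<dots> = (\<Sum>k. q ^ n * (q ^ k * F))" by (simp add: power_add mult_ac)
    also have "\<dots> = q ^ n * G"
      using q_bounds by (simp add: suminf_mult geo suminf_mult2[symmetric] suminf_geometric G_def)
    finally show ?thesis .
  qed
  \<comment> \<open>The triangle inequality is taken in \<open>L2_set\<close>: the factors 2 of
    \<open>l2_le_add\<close> would accumulate over the \<open>n\<close> summands.\<close>
  have s_l2: "(\<Sum>j\<in>K. (cmod (s n j))\<^sup>2) \<le> G\<^sup>2" if K: "finite K" for K n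
  proof -
    have L: "L2_set (\<lambda>j. cmod (r k j)) K \<le> q ^ k * F" for k
      unfolding L2_set_def using l2_leD[OF r_l2 K, of k] sq[of k] by (metis real_sqrt_le_iff)
    have "L2_set (\<lambda>j. cmod (s n j)) K \<le> (\<Sum>k<n. q ^ k * F)"
    proof (induction n)
      case (Suc n)
      have "L2_set (\<lambda>j. cmod (s (Suc n) j)) K \<le> L2_set (\<lambda>j. cmod (s n j) + cmod (r n j)) K"
        by (intro L2_set_mono) (auto simp: s_def norm_triangle_ineq)
      also have "\<dots> \<le> L2_set (\<lambda>j. cmod (s n j)) K + L2_set (\<lambda>j. cmod (r n j)) K"
        by (rule L2_set_triangle_ineq)
      finally show ?case using Suc L[of n] by simp
    qed (simp add: s_def L2_set_def)
    also have "\<dots> \<le> G" by (rule geo_le)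
    finally have "L2_set (\<lambda>j. cmod (s n j)) K \<le> G" .
    then show ?thesis unfolding L2_set_def
      using real_sqrt_le_iff sqrt_le_D by blast
  qed
  have a_l2: "l2_le a (G\<^sup>2)"
    unfolding l2_le_def
  proof (intro allI impI)
    fix K :: "'i set" assume K: "finite K"
    have "(\<lambda>n. \<Sum>j\<in>K. (cmod (s n j))\<^sup>2) \<longlonglongrightarrow> (sq_sum a K)"
      by (intro tendsto_intros s_lim)
    then show "(sq_sum a K) \<le> G\<^sup>2"
      by (rule LIMSEQ_le_const2) (use s_l2[OF K] in auto)
  qed
  have s_bound: "cmod (s n j) \<le> G" for n j
    using order_trans[OF sum_norm_le[of "{..<n}" "\<lambda>k. r k j" "\<lambda>k. q ^ k * F"] geo_le] r_le
    by (simp add: s_def)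
  have a_bound: "cmod (a j) \<le> \<bar>G\<bar>" for j using l2_le_cmod_le[OF a_l2] by simp
  have app_s: "complex_of_real \<tau> * app (s n) i = f i - r n i" for n i
  proof (induction n)
    case 0
    then show ?case by (simp add: s_def app_def r_def)
  next
    case (Suc n)
    have "app (s (Suc n)) i = app (s n) i + app (r n) i"
    proof -
      have "s (Suc n) = (\<lambda>j. s n j + r n j)" by (rule ext) (simp add: s_def)
      then show ?thesis using app_add[OF s_bound r_le] by simp
    qed
    then show ?case using Suc by (simp add: r_Suc ring_distribs)
  qed
  \<comment> \<open>By \<open>tail\<close> the partial sums converge uniformly in the index, and
    \<open>app_bound\<close> carries this over to each row.\<close>
  have "(\<lambda>n. complex_of_real \<tau> * app (s n) i) \<longlonglongrightarrow> complex_of_real \<tau> * app a i" for i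
  proof (intro tendsto_intros, rule LIM_zero_cancel, rule Lim_null_comparison)
    show "\<forall>\<^sub>F n in sequentially. cmod (app (s n) i - app a i) \<le> q ^ n * G * M"
    proof (intro always_eventually allI)
      fix n
      show "cmod (app (s n) i - app a i) \<le> q ^ n * G * M"
        using app_bound[of "\<lambda>j. a j - s n j" "q ^ n * G" i] tail[of _ n]
          app_diff[of a "\<bar>G\<bar>" "s n" G i] a_bound s_bound by (simp add: norm_minus_commute)
    qed
    have "(\<lambda>n. q ^ n * G * M) \<longlonglongrightarrow> 0 * G * M"
      using q_bounds by (intro tendsto_intros LIMSEQ_power_zero) auto
    then show "(\<lambda>n. q ^ n * G * M) \<longlonglongrightarrow> 0" by simp
  qed
  moreover have "(\<lambda>n. f i - r n i) \<longlonglongrightarrow> f i - 0" for i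
    using summable_LIMSEQ_zero[OF summ] by (intro tendsto_intros)
  ultimately have "complex_of_real \<tau> * app a i = f i" for i
    unfolding app_s by (auto dest: LIMSEQ_unique)
  then have "app (\<lambda>j. complex_of_real \<tau> * a j) = f"
    by (auto simp: app_scale)
  moreover have "l2_le (\<lambda>j. complex_of_real \<tau> * a j) ((cmod (complex_of_real \<tau>))\<^sup>2 * G\<^sup>2)"
    by (rule l2_le_scale[OF a_l2])
  ultimately show thesis using that by blast
qed

text \<open>The statement has the shape of the description in \<open>interpolation_coeff\<close>, so
  that \<open>THE\<close> there can be evaluated for square-summable data.\<close>

lemma solution_unique:
  assumes "square_summable f"
  shows "\<exists>!a. square_summable a \<and> (\<forall>i. ((\<lambda>j. a j * complex_of_real (A i j)) has_sum f i) UNIV)"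
proof (rule ex_ex1I)
  obtain R where "l2_le f R" using assms square_summable_iff_l2_le by blast
  then obtain a S where a: "l2_le a S" "app a = f" using solution_exists by blast
  have "cmod (a j) \<le> sqrt S" for j by (rule l2_le_cmod_le[OF a(1)])
  then have "((\<lambda>j. a j * complex_of_real (A i j)) has_sum app a i) UNIV" for i
    by (rule row_has_sum)
  then have "((\<lambda>j. a j * complex_of_real (A i j)) has_sum f i) UNIV" for i
    unfolding a(2) .
  moreover have "square_summable a" using a(1) by (auto simp: square_summable_iff_l2_le)
  ultimately show "\<exists>a. square_summable a \<and> (\<forall>i. ((\<lambda>j. a j * complex_of_real (A i j)) has_sum f i) UNIV)"
    by (intro exI[of _ a] conjI allI)
next
  fix a b
  assume a: "square_summable a \<and> (\<forall>i. ((\<lambda>j. a j * complex_of_real (A i j)) has_sum f i) UNIV)"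
    and b: "square_summable b \<and> (\<forall>i. ((\<lambda>j. b j * complex_of_real (A i j)) has_sum f i) UNIV)"
  obtain R S where R: "l2_le a R" and S: "l2_le b S"
    using a b square_summable_iff_l2_le by blast
  have "app a = f" by (rule app_unique) (use a in simp)
  moreover have "app b = f" by (rule app_unique) (use b in simp)
  ultimately have "app (\<lambda>j. a j - b j) i = 0" for i
    by (subst app_diff[OF l2_le_cmod_le[OF R] l2_le_cmod_le[OF S]]) simp
  then have "a i - b i = 0" for i by (rule app_eq_0[OF l2_le_diff[OF R S]])
  then show "a = b" by (intro ext) simp
qed

end

section \<open>The Fourier transform and Gaussian weights\<close>

text \<open>The inverse transform without its factor 1 / (2 pi)^d, in any dimension d. Spectra are
  the primary objects of the proof; functions appear as their images under
  \<open>ift\<close>.\<close>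

definition ift :: "('a::euclidean_space \<Rightarrow> complex) \<Rightarrow> 'a \<Rightarrow> complex" where
  "ift g z = (\<integral>t. g t * cis (z \<bullet> t) \<partial>lborel)"

lemma measurable_cis [measurable (raw)]:
  "f \<in> borel_measurable M \<Longrightarrow> (\<lambda>x. cis (f x)) \<in> borel_measurable M"
  by (rule borel_measurable_continuous_on[where f = cis])
     (auto simp: cis_conv_exp intro!: continuous_intros)

lemma measurable_cnj [measurable (raw)]:
  "f \<in> borel_measurable M \<Longrightarrow> (\<lambda>x. cnj (f x)) \<in> borel_measurable M"
  by (rule borel_measurable_continuous_on[where f = cnj]) (auto intro!: continuous_intros)

lemma measurable_ift [measurable]:
  assumes "g \<in> borel_measurable borel"
  shows "ift g \<in> borel_measurable borel"
proof -
  have [measurable]: "g \<in> borel_measurable lborel" using assms by simp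
  have "(\<lambda>z. \<integral>t. g t * cis (z \<bullet> t) \<partial>lborel) \<in> borel_measurable borel"
    by measurable
  then show ?thesis by (simp add: ift_def[abs_def])
qed

lemma integrable_mult_cis:
  fixes g :: "'a::euclidean_space \<Rightarrow> complex"
  assumes "integrable lborel g" "\<phi> \<in> borel_measurable borel"
  shows "integrable lborel (\<lambda>t. g t * cis (\<phi> t))"
proof (rule Bochner_Integration.integrable_bound[OF assms(1)])
  show "(\<lambda>t. g t * cis (\<phi> t)) \<in> borel_measurable lborel"
    using assms by measurable
qed (simp add: norm_mult)

lemma norm_ift_le:
  "cmod (ift g z) \<le> (\<integral>t. cmod (g t) \<partial>lborel)"
proof -
  have "cmod (ift g z) \<le> (\<integral>t. cmod (g t * cis (z \<bullet> t)) \<partial>lborel)"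
    unfolding ift_def by (rule integral_norm_bound)
  then show ?thesis by (simp add: norm_mult)
qed

lemma integrable_mult_ift:
  assumes f: "integrable lborel f" and g: "integrable lborel g"
  shows "integrable lborel (\<lambda>s. f s * ift g s)"
proof (rule Bochner_Integration.integrable_bound[OF integrable_mult_left[OF f, of "complex_of_real (\<integral>t. cmod (g t) \<partial>lborel)"]])
  have "0 \<le> (\<integral>t. cmod (g t) \<partial>lborel)" by (intro integral_nonneg_AE) auto
  then show "AE s in lborel. norm (f s * ift g s) \<le> norm (f s * complex_of_real (\<integral>t. cmod (g t) \<partial>lborel))"
    by (intro AE_I2) (simp add: norm_mult mult_left_mono norm_ift_le)
qed (use f g in measurable)

lemma ift_add:
  assumes "integrable lborel f" "integrable lborel g"
  shows "ift (\<lambda>t. f t + g t) z = ift f z + ift g z"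
  unfolding ift_def ring_distribs using assms
  by (intro Bochner_Integration.integral_add integrable_mult_cis) measurable

lemma ift_diff:
  assumes "integrable lborel f" "integrable lborel g"
  shows "ift (\<lambda>t. f t - g t) z = ift f z - ift g z"
  unfolding ift_def left_diff_distrib using assms
  by (intro Bochner_Integration.integral_diff integrable_mult_cis) measurable

lemma ift_scale: "ift (\<lambda>t. c * g t) z = c * ift g z"
  unfolding ift_def mult.assoc by simp

text \<open>Fubini for f s * g x * cis (x \<bullet> s). Together with the explicit transforms of
  Gaussians it yields the Plancherel inequality, and later the test of the L2 transform against
  Gaussians.\<close>

lemma ift_multiplication_formula:
  fixes f g :: "'a::euclidean_space \<Rightarrow> complex"
  assumes f: "integrable lborel f" and g: "integrable lborel g"
  shows "(\<integral>x. ift f x * g x \<partial>lborel) = (\<integral>s. f s * ift g s \<partial>lborel)"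
proof -
  have [measurable]: "f \<in> borel_measurable borel" "g \<in> borel_measurable borel"
    using f g by auto
  have int: "integrable (lborel \<Otimes>\<^sub>M lborel) (\<lambda>(s, x). f s * g x * cis (x \<bullet> s))"
  proof (rule lborel_pair.Fubini_integrable)
    show "integrable lborel (\<lambda>s. \<integral>x. norm (case (s, x) of (s, x) \<Rightarrow> f s * g x * cis (x \<bullet> s)) \<partial>lborel)"
      using f g by (simp add: norm_mult)
    show "AE s in lborel. integrable lborel (\<lambda>x. case (s, x) of (s, x) \<Rightarrow> f s * g x * cis (x \<bullet> s))"
      using g by (auto intro!: AE_I2 integrable_mult_cis)
  qed measurable
  have "(\<integral>x. ift f x * g x \<partial>lborel) = (\<integral>x. (\<integral>s. f s * g x * cis (x \<bullet> s) \<partial>lborel) \<partial>lborel)"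
  proof (rule Bochner_Integration.integral_cong[OF refl])
    fix x
    have "ift f x * g x = (\<integral>s. (f s * cis (x \<bullet> s)) * g x \<partial>lborel)"
      unfolding ift_def by simp
    then show "ift f x * g x = (\<integral>s. f s * g x * cis (x \<bullet> s) \<partial>lborel)"
      by (simp only: mult_ac)
  qed
  also have "\<dots> = (\<integral>s. (\<integral>x. f s * g x * cis (x \<bullet> s) \<partial>lborel) \<partial>lborel)"
    using lborel_pair.Fubini_integral[OF int] by simp
  also have "\<dots> = (\<integral>s. f s * ift g s \<partial>lborel)"
    unfolding ift_def by (simp add: inner_commute mult.assoc)
  finally show ?thesis .
qed

text \<open>The normal density of variance 2 r, whose transform is the kernel exp (- r s^2).
  Translating the kernel to a node multiplies this weight by an exponential, which is how
  nonharmonic sums arise.\<close>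

definition gauss_weight :: "real \<Rightarrow> real \<Rightarrow> real" where
  "gauss_weight r u = exp (- (u\<^sup>2) / (4 * r)) / sqrt (4 * pi * r)"

lemma measurable_gauss_weight [measurable]: "gauss_weight r \<in> borel_measurable borel"
  unfolding gauss_weight_def[abs_def] by measurable

lemma gauss_weight_pos: "r > 0 \<Longrightarrow> 0 < gauss_weight r u"
  by (simp add: gauss_weight_def)

lemma gauss_weight_nonneg: "r > 0 \<Longrightarrow> 0 \<le> gauss_weight r u"
  by (simp add: gauss_weight_def)

lemma gauss_weight_le: "r > 0 \<Longrightarrow> gauss_weight r u \<le> 1 / sqrt (4 * pi * r)"
  by (simp add: gauss_weight_def divide_right_mono)

lemma gauss_weight_normal: "r > 0 \<Longrightarrow> gauss_weight r = normal_density 0 (sqrt (2 * r))"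
  by (auto simp: gauss_weight_def normal_density_def fun_eq_iff mult_ac)

lemma integrable_gauss_weight: "r > 0 \<Longrightarrow> integrable lborel (gauss_weight r)"
  by (simp add: gauss_weight_normal)

lemma integral_gauss_weight: "r > 0 \<Longrightarrow> (\<integral>u. gauss_weight r u \<partial>lborel) = 1"
  by (simp add: gauss_weight_normal)

lemma nn_integral_gauss_weight:
  assumes "r > 0"
  shows "(\<integral>\<^sup>+u. ennreal (gauss_weight r (t + u)) \<partial>lborel) = 1"
proof -
  have "(\<integral>\<^sup>+u. ennreal (gauss_weight r (t + 1 * u)) \<partial>lborel) = (\<integral>\<^sup>+u. ennreal (gauss_weight r u) \<partial>lborel)"
    by (subst nn_integral_real_affine[where c = 1 and t = t]) auto
  also have "\<dots> = ennreal 1"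
    using nn_integral_eq_integral[OF integrable_gauss_weight[OF assms]] assms
    by (simp add: gauss_weight_nonneg integral_gauss_weight)
  finally show ?thesis by simp
qed

text \<open>The substitution u = sqrt (2 r) v reduces the claim to the characteristic function of
  the standard normal law.\<close>

lemma ift_gauss_weight:
  assumes r: "r > 0"
  shows "ift (\<lambda>u. complex_of_real (gauss_weight r u)) s = complex_of_real (exp (- r * s\<^sup>2))"
proof -
  let ?c = "sqrt (2 * r)"
  have "ift (\<lambda>u. complex_of_real (gauss_weight r u)) s
    = ?c *\<^sub>R (\<integral>v. complex_of_real (gauss_weight r (0 + ?c * v)) * cis (s * (0 + ?c * v)) \<partial>lborel)"
    unfolding ift_def inner_real_def
    using r by (subst lborel_integral_real_affine[where c = ?c and t = 0]) auto
  also have "\<dots> = (\<integral>v. complex_of_real (std_normal_density v) * cis (s * ?c * v) \<partial>lborel)"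
  proof -
    have "?c * gauss_weight r (?c * v) = std_normal_density v" for v
      using r by (simp add: gauss_weight_def std_normal_density_def power_mult_distrib
          real_sqrt_mult field_simps)
    then have "?c *\<^sub>R (complex_of_real (gauss_weight r (0 + ?c * v)) * cis (s * (0 + ?c * v)))
      = complex_of_real (std_normal_density v) * cis (s * ?c * v)" for v
      by (simp add: scaleR_conv_of_real mult.assoc[symmetric] flip: of_real_mult)
    then show ?thesis by (subst integral_scaleR_right[symmetric]) simp
  qed
  also have "\<dots> = char std_normal_distribution (s * ?c)"
    unfolding char_def by (subst integral_density) (auto simp: cis_conv_exp scaleR_conv_of_real mult_ac)
  also have "\<dots> = complex_of_real (exp (- r * s\<^sup>2))"
    using r by (simp add: char_std_normal_distribution power_mult_distrib)
  finally show ?thesis .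
qed

lemma gauss_eq_weight:
  assumes "e > 0"
  shows "exp (- e * u\<^sup>2) = sqrt (pi / e) * gauss_weight (1 / (4 * e)) u"
  using assms by (simp add: gauss_weight_def real_sqrt_divide real_sqrt_mult field_simps)

lemma integrable_gauss:
  fixes e :: real
  assumes "e > 0" shows "integrable lborel (\<lambda>u. exp (- e * u\<^sup>2))"
  unfolding gauss_eq_weight[OF assms] using assms by (intro integrable_mult_right integrable_gauss_weight) auto

text \<open>A Gaussian is a multiple of a weight with parameter 1 / (4 e), so the opposite direction
  follows from the same formula.\<close>

lemma ift_gauss:
  assumes e: "e > 0"
  shows "ift (\<lambda>u. complex_of_real (exp (- e * u\<^sup>2))) s = complex_of_real (2 * pi * gauss_weight e s)"
proof -
  have "ift (\<lambda>u. complex_of_real (exp (- e * u\<^sup>2))) s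
    = complex_of_real (sqrt (pi / e)) * ift (\<lambda>u. complex_of_real (gauss_weight (1 / (4 * e)) u)) s"
    unfolding gauss_eq_weight[OF e] of_real_mult by (rule ift_scale)
  also have "\<dots> = complex_of_real (sqrt (pi / e) * exp (- (1 / (4 * e)) * s\<^sup>2))"
    using e by (subst ift_gauss_weight) auto
  also have "sqrt (pi / e) * exp (- (1 / (4 * e)) * s\<^sup>2) = 2 * pi * gauss_weight e s"
    using e by (simp add: gauss_weight_def real_sqrt_divide real_sqrt_mult field_simps)
  finally show ?thesis .
qed

text \<open>Against the Gaussian regularisation \<open>exp (- e x\<^sup>2)\<close>, the energy of the transform becomes a
  quadratic form with a positive kernel of total mass \<open>2 \<pi>\<close>.\<close>

lemma Plancherel_regularised:
  fixes h :: "real \<Rightarrow> complex"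
  assumes h: "integrable lborel h" and e: "e > 0"
  shows "(\<integral>\<^sup>+x. ennreal ((cmod (ift h x))\<^sup>2 * exp (- e * x\<^sup>2)) \<partial>lborel)
    \<le> ennreal (2 * pi) * energy lborel h"
proof -
  have [measurable]: "h \<in> borel_measurable borel" using h by auto
  define k where "k x = cnj (ift h x) * complex_of_real (exp (- e * x\<^sup>2))" for x
  \<comment> \<open>Reflection and conjugation turn the transform of \<open>h\<close> into its
    conjugate. Thus |ift h|^2 is a product of two transforms, and the multiplication formula applies
    twice: once to \<open>h\<close> and \<open>k\<close>, once inside the transform of
    \<open>k\<close>.\<close>
  define h' where "h' t = cnj (h (- t))" for t
  have [measurable]: "h' \<in> borel_measurable borel" "k \<in> borel_measurable borel"
    unfolding h'_def[abs_def] k_def[abs_def] by measurable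
  have h': "integrable lborel h'"
    using lborel_integrable_real_affine[OF h, of "- 1" 0] unfolding h'_def[abs_def] by simp
  have ift_h': "ift h' x = cnj (ift h x)" for x
  proof -
    have "ift h' x = (\<integral>t. cnj (h (- t) * cis (x * (- t))) \<partial>lborel)"
      unfolding ift_def h'_def by (simp add: cis_cnj)
    also have "\<dots> = cnj (\<integral>t. h (- t) * cis (x * (- t)) \<partial>lborel)" by (rule Bochner_Integration.integral_cnj)
    also have "(\<integral>t. h (- t) * cis (x * (- t)) \<partial>lborel) = ift h x"
      unfolding ift_def inner_real_def
      by (subst (2) lborel_integral_real_affine[where c = "- 1" and t = 0]) auto
    finally show ?thesis .
  qed
  have bnd: "cmod (ift h x) \<le> (\<integral>t. cmod (h t) \<partial>lborel)" for x by (rule norm_ift_le)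
  have gauss_c: "integrable lborel (\<lambda>x. complex_of_real (exp (- e * x\<^sup>2)))"
    using integrable_gauss[OF e] by simp
  have k: "integrable lborel k"
    unfolding k_def[abs_def]
    by (rule Bochner_Integration.integrable_bound[OF integrable_mult_right[OF gauss_c, of "complex_of_real (\<integral>t. cmod (h t) \<partial>lborel)"]])
       (use bnd in \<open>auto simp: norm_mult intro!: mult_right_mono intro: order_trans[OF _ abs_ge_self]\<close>)
  have ift_k: "ift k s = (\<integral>t. h' t * complex_of_real (2 * pi * gauss_weight e (s + t)) \<partial>lborel)" for s
  proof -
    have g: "integrable lborel (\<lambda>x. complex_of_real (exp (- e * x\<^sup>2)) * cis (s * x))"
      by (intro integrable_mult_cis gauss_c) measurable
    have G: "ift (\<lambda>x. complex_of_real (exp (- e * x\<^sup>2)) * cis (s * x)) t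
      = complex_of_real (2 * pi * gauss_weight e (s + t))" for t
      unfolding ift_gauss[OF e, symmetric] unfolding ift_def
      by (simp add: mult.assoc cis_mult ring_distribs)
    have "ift k s = (\<integral>x. ift h' x * (complex_of_real (exp (- e * x\<^sup>2)) * cis (s * x)) \<partial>lborel)"
      unfolding ift_def[of k] k_def ift_h' by (simp add: mult.assoc)
    also have "\<dots> = (\<integral>t. h' t * ift (\<lambda>x. complex_of_real (exp (- e * x\<^sup>2)) * cis (s * x)) t \<partial>lborel)"
      by (rule ift_multiplication_formula[OF h' g])
    finally show ?thesis unfolding G .
  qed
  let ?w = "\<lambda>s t. gauss_weight e (s + t)"
  have w0: "0 \<le> ?w s t" for s t using gauss_weight_nonneg[OF e] .
  have "ennreal (\<integral>x. (cmod (ift h x))\<^sup>2 * exp (- e * x\<^sup>2) \<partial>lborel)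
    = ennreal (cmod (\<integral>x. complex_of_real ((cmod (ift h x))\<^sup>2 * exp (- e * x\<^sup>2)) \<partial>lborel))"
  proof -
    have "0 \<le> (\<integral>x. (cmod (ift h x))\<^sup>2 * exp (- e * x\<^sup>2) \<partial>lborel)"
      by (intro integral_nonneg_AE) auto
    then show ?thesis by (simp only: integral_complex_of_real norm_of_real abs_of_nonneg)
  qed
  also have "(\<integral>x. complex_of_real ((cmod (ift h x))\<^sup>2 * exp (- e * x\<^sup>2)) \<partial>lborel) = (\<integral>x. ift h x * k x \<partial>lborel)"
    unfolding k_def by (simp add: complex_norm_square mult_ac del: of_real_power)
  also have "\<dots> = (\<integral>s. h s * ift k s \<partial>lborel)"
    by (rule ift_multiplication_formula[OF h k])
  also have "ennreal (cmod \<dots>) \<le> (\<integral>\<^sup>+s. ennreal (cmod (h s * ift k s)) \<partial>lborel)"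
    by (rule integral_norm_bound_ennreal[OF integrable_mult_ift[OF h k]])
  also have "\<dots> \<le> (\<integral>\<^sup>+s. (\<integral>\<^sup>+t. ennreal pi * (ennreal ((cmod (h s))\<^sup>2) + ennreal ((cmod (h' t))\<^sup>2)) * ennreal (?w s t) \<partial>lborel) \<partial>lborel)"
  proof (rule nn_integral_mono)
    fix s
    have "integrable lborel (\<lambda>t. h' t * complex_of_real (2 * pi * ?w s t))"
    proof (rule Bochner_Integration.integrable_bound[OF integrable_mult_left[OF h', of "complex_of_real (2 * pi * (1 / sqrt (4 * pi * e)))"]])
      have "\<bar>2 * pi * ?w s t\<bar> \<le> \<bar>2 * pi * (1 / sqrt (4 * pi * e))\<bar>" for t
      proof -
        have "2 * pi * ?w s t \<le> 2 * pi * (1 / sqrt (4 * pi * e))"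
          by (intro mult_left_mono gauss_weight_le[OF e]) simp
        moreover have "0 \<le> 2 * pi * ?w s t" using w0[of s t] by simp
        ultimately show ?thesis by linarith
      qed
      then show "AE t in lborel. norm (h' t * complex_of_real (2 * pi * ?w s t)) \<le> norm (h' t * complex_of_real (2 * pi * (1 / sqrt (4 * pi * e))))"
        unfolding norm_mult[of "h' _"] norm_of_real by (intro AE_I2 mult_left_mono norm_ge_zero)
    qed measurable
    then have "ennreal (cmod (ift k s)) \<le> (\<integral>\<^sup>+t. ennreal (cmod (h' t * complex_of_real (2 * pi * ?w s t))) \<partial>lborel)"
      unfolding ift_k by (rule integral_norm_bound_ennreal)
    then have "ennreal (cmod (h s * ift k s))
      \<le> ennreal (cmod (h s)) * (\<integral>\<^sup>+t. ennreal (cmod (h' t * complex_of_real (2 * pi * ?w s t))) \<partial>lborel)"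
      by (simp add: norm_mult ennreal_mult mult_left_mono)
    also have "\<dots> = (\<integral>\<^sup>+t. ennreal (cmod (h s)) * ennreal (cmod (h' t * complex_of_real (2 * pi * ?w s t))) \<partial>lborel)"
      by (simp add: nn_integral_cmult)
    also have "\<dots> \<le> (\<integral>\<^sup>+t. ennreal pi * (ennreal ((cmod (h s))\<^sup>2) + ennreal ((cmod (h' t))\<^sup>2)) * ennreal (?w s t) \<partial>lborel)"
    proof (rule nn_integral_mono)
      fix t
      \<comment> \<open>After this inequality the two squares separate. The weight has mass 1 in
        each variable, so each square contributes pi times the energy of \<open>h\<close>.\<close>
      have "2 * (cmod (h s) * cmod (h' t)) \<le> (cmod (h s))\<^sup>2 + (cmod (h' t))\<^sup>2"
        using sum_squares_bound[of "cmod (h s)" "cmod (h' t)"] by (simp add: mult.assoc)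
      then have "(pi * ?w s t) * (2 * (cmod (h s) * cmod (h' t))) \<le> (pi * ?w s t) * ((cmod (h s))\<^sup>2 + (cmod (h' t))\<^sup>2)"
        using w0 by (intro mult_left_mono) auto
      then have "cmod (h s) * cmod (h' t * complex_of_real (2 * pi * ?w s t))
        \<le> pi * ((cmod (h s))\<^sup>2 + (cmod (h' t))\<^sup>2) * ?w s t"
        using w0[of s t] by (simp add: norm_mult abs_mult mult_ac)
      then show "ennreal (cmod (h s)) * ennreal (cmod (h' t * complex_of_real (2 * pi * ?w s t)))
        \<le> ennreal pi * (ennreal ((cmod (h s))\<^sup>2) + ennreal ((cmod (h' t))\<^sup>2)) * ennreal (?w s t)"
        using w0[of s t] by (simp add: ennreal_leI flip: ennreal_mult ennreal_plus)
    qed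
    finally show "ennreal (cmod (h s * ift k s)) \<le> (\<integral>\<^sup>+t. ennreal pi * (ennreal ((cmod (h s))\<^sup>2) + ennreal ((cmod (h' t))\<^sup>2)) * ennreal (?w s t) \<partial>lborel)" .
  qed
  also have "\<dots> = (\<integral>\<^sup>+s. (\<integral>\<^sup>+t. ennreal pi * ennreal ((cmod (h s))\<^sup>2) * ennreal (?w s t) \<partial>lborel) \<partial>lborel)
      + (\<integral>\<^sup>+s. (\<integral>\<^sup>+t. ennreal pi * ennreal ((cmod (h' t))\<^sup>2) * ennreal (?w s t) \<partial>lborel) \<partial>lborel)"
    by (subst nn_integral_add[symmetric], measurable)
       (simp add: ring_distribs nn_integral_add[symmetric])
  also have "(\<integral>\<^sup>+s. (\<integral>\<^sup>+t. ennreal pi * ennreal ((cmod (h s))\<^sup>2) * ennreal (?w s t) \<partial>lborel) \<partial>lborel) = ennreal pi * energy lborel h"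
    by (simp add: nn_integral_cmult nn_integral_gauss_weight[OF e] energy_def)
  also have "(\<integral>\<^sup>+s. (\<integral>\<^sup>+t. ennreal pi * ennreal ((cmod (h' t))\<^sup>2) * ennreal (?w s t) \<partial>lborel) \<partial>lborel)
    = (\<integral>\<^sup>+t. (\<integral>\<^sup>+s. ennreal pi * ennreal ((cmod (h' t))\<^sup>2) * ennreal (?w s t) \<partial>lborel) \<partial>lborel)"
    by (rule lborel_pair.Fubini') measurable
  also have "\<dots> = ennreal pi * energy lborel h'"
    by (simp add: nn_integral_cmult nn_integral_gauss_weight[OF e] energy_def add.commute[of _ "t::real" for t])
  also have "energy lborel h' = energy lborel h"
    unfolding energy_def h'_def by (subst (2) nn_integral_real_affine[where c = "- 1" and t = 0]) auto
  also have "ennreal pi * energy lborel h + ennreal pi * energy lborel h = ennreal (2 * pi) * energy lborel h"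
  proof -
    have "ennreal (2 * pi) = ennreal pi + ennreal pi"
      using ennreal_plus[of pi pi] by (simp only: mult_2 pi_ge_zero)
    then show ?thesis by (simp only: distrib_right)
  qed
  finally have "ennreal (\<integral>x. (cmod (ift h x))\<^sup>2 * exp (- e * x\<^sup>2) \<partial>lborel) \<le> ennreal (2 * pi) * energy lborel h" .
  moreover have "integrable lborel (\<lambda>x. (cmod (ift h x))\<^sup>2 * exp (- e * x\<^sup>2))"
  proof (rule Bochner_Integration.integrable_bound[OF integrable_mult_right[OF integrable_gauss[OF e], of "(\<integral>t. cmod (h t) \<partial>lborel)\<^sup>2"]])
    show "AE x in lborel. norm ((cmod (ift h x))\<^sup>2 * exp (- e * x\<^sup>2)) \<le> norm ((\<integral>t. cmod (h t) \<partial>lborel)\<^sup>2 * exp (- e * x\<^sup>2))"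
      using bnd by (intro AE_I2) (auto intro!: mult_right_mono power_mono)
  qed measurable
  ultimately show ?thesis by (simp add: nn_integral_eq_integral)
qed

text \<open>The damping factor with parameter 1 / (2 (n + 1)) acquires parameter 1 / (n + 1) when
  squared, which is the regularised situation; Fatou then removes the damping.\<close>

lemma Plancherel_le:
  fixes h :: "real \<Rightarrow> complex"
  assumes h: "integrable lborel h"
  shows "energy lborel (ift h) \<le> ennreal (2 * pi) * energy lborel h"
proof (rule energy_Fatou[where f = "\<lambda>n x. ift h x * complex_of_real (exp (- (1 / (2 * real (Suc n))) * x\<^sup>2))"])
  have [measurable]: "h \<in> borel_measurable borel" using h by auto
  fix n :: nat
  show "(\<lambda>x. ift h x * complex_of_real (exp (- (1 / (2 * real (Suc n))) * x\<^sup>2))) \<in> borel_measurable lborel"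
    by measurable
  have "(cmod (ift h x * complex_of_real (exp (- (1 / (2 * real (Suc n))) * x\<^sup>2))))\<^sup>2
    = (cmod (ift h x))\<^sup>2 * exp (- (1 / real (Suc n)) * x\<^sup>2)" for x
  proof -
    have "2 * (- (1 / (2 * N)) * x\<^sup>2) = - (1 / N) * x\<^sup>2" if "N \<noteq> 0" for N :: real
      using that by (simp add: field_simps)
    then have "(exp (- (1 / (2 * real (Suc n))) * x\<^sup>2))\<^sup>2 = exp (- (1 / real (Suc n)) * x\<^sup>2)"
      unfolding exp_double[symmetric] by (metis of_nat_eq_0_iff nat.distinct(2))
    then show ?thesis by (simp only: norm_mult power_mult_distrib norm_of_real abs_exp_cancel)
  qed
  then show "energy lborel (\<lambda>x. ift h x * complex_of_real (exp (- (1 / (2 * real (Suc n))) * x\<^sup>2)))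
    \<le> ennreal (2 * pi) * energy lborel h"
    using Plancherel_regularised[OF h, of "1 / real (Suc n)"] by (simp add: energy_def)
next
  fix x :: real
  have "(\<lambda>n. - (1 / (2 * real (Suc n))) * x\<^sup>2) \<longlonglongrightarrow> 0"
    by real_asymp
  from tendsto_mult[OF tendsto_const[of "ift h x"] tendsto_of_real[OF tendsto_exp[OF this]]]
  show "(\<lambda>n. ift h x * complex_of_real (exp (- (1 / (2 * real (Suc n))) * x\<^sup>2))) \<longlonglongrightarrow> ift h x"
    by (simp only: exp_zero of_real_1 mult_1_right)
qed auto

text \<open>The transform is taken in the second variable, giving \<open>P\<close>, and then in the
  first. The one-variable inequality is applied to each, with Tonelli in between. Sections of
  \<open>G\<close> are integrable only almost everywhere, which suffices under the outer
  integral.\<close>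

lemma Plancherel_le_2:
  fixes G :: "real \<times> real \<Rightarrow> complex"
  assumes G: "integrable lborel G"
  shows "energy lborel (ift G) \<le> ennreal ((2 * pi)\<^sup>2) * energy lborel G"
proof -
  have [measurable]: "G \<in> borel_measurable borel" "G \<in> borel_measurable (borel \<Otimes>\<^sub>M borel)"
    using G by (simp_all add: borel_prod)
  have G': "integrable (lborel \<Otimes>\<^sub>M lborel) G" using G by (simp add: lborel_prod)
  have Gm [measurable]: "G \<in> borel_measurable (lborel \<Otimes>\<^sub>M lborel)" using G' by auto
  define P where "P y s = ift (\<lambda>t. G (s, t)) y" for y s
  have Pm [measurable]: "(\<lambda>(y, s). P y s) \<in> borel_measurable (borel \<Otimes>\<^sub>M borel)"
    unfolding P_def ift_def by measurable
  have Gc: "integrable (lborel \<Otimes>\<^sub>M lborel) (\<lambda>(s, t). G (s, t) * cis (x * s + y * t))" for x y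
    by (rule Bochner_Integration.integrable_bound[OF G']) (auto simp: norm_mult)
  have P: "integrable lborel (P y)" for y
    using lborel_pair.integrable_fst'[OF Gc[of 0 y]] by (simp add: P_def[abs_def] ift_def)
  have fact: "ift G (x, y) = ift (P y) x" for x y
  proof -
    have "ift G (x, y) = (\<integral>p. (case p of (s, t) \<Rightarrow> G (s, t) * cis (x * s + y * t)) \<partial>(lborel \<Otimes>\<^sub>M lborel))"
      unfolding ift_def lborel_prod by (intro Bochner_Integration.integral_cong) (auto simp: inner_prod_def)
    also have "\<dots> = (\<integral>s. (\<integral>t. G (s, t) * cis (x * s + y * t) \<partial>lborel) \<partial>lborel)"
      using lborel_pair.integral_fst'[OF Gc[of x y]] by simp
    also have "\<dots> = (\<integral>s. (\<integral>t. G (s, t) * cis (y * t) * cis (x * s) \<partial>lborel) \<partial>lborel)"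
      by (simp add: mult.assoc cis_mult add.commute)
    also have "\<dots> = ift (P y) x" by (simp add: ift_def P_def)
    finally show ?thesis .
  qed
  have "energy lborel (ift G) = (\<integral>\<^sup>+p. ennreal ((cmod (ift G p))\<^sup>2) \<partial>(lborel \<Otimes>\<^sub>M lborel))"
    by (simp add: energy_def lborel_prod)
  also have "\<dots> = (\<integral>\<^sup>+y. \<integral>\<^sup>+x. ennreal ((cmod (ift G (x, y)))\<^sup>2) \<partial>lborel \<partial>lborel)"
    by (rule lborel_pair.nn_integral_snd[symmetric]) (simp add: lborel_prod)
  also have "\<dots> = (\<integral>\<^sup>+y. energy lborel (ift (P y)) \<partial>lborel)"
    unfolding fact energy_def ..
  also have "\<dots> \<le> (\<integral>\<^sup>+y. ennreal (2 * pi) * energy lborel (P y) \<partial>lborel)"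
    by (intro nn_integral_mono Plancherel_le P)
  also have "\<dots> = ennreal (2 * pi) * (\<integral>\<^sup>+y. \<integral>\<^sup>+s. ennreal ((cmod (P y s))\<^sup>2) \<partial>lborel \<partial>lborel)"
    unfolding energy_def by (rule nn_integral_cmult) measurable
  finally have 1: "energy lborel (ift G)
    \<le> ennreal (2 * pi) * (\<integral>\<^sup>+y. \<integral>\<^sup>+s. ennreal ((cmod (P y s))\<^sup>2) \<partial>lborel \<partial>lborel)" .
  have "(\<integral>\<^sup>+y. \<integral>\<^sup>+s. ennreal ((cmod (P y s))\<^sup>2) \<partial>lborel \<partial>lborel)
    = (\<integral>\<^sup>+s. \<integral>\<^sup>+y. ennreal ((cmod (P y s))\<^sup>2) \<partial>lborel \<partial>lborel)"
    by (rule lborel_pair.Fubini') measurable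
  also have "\<dots> = (\<integral>\<^sup>+s. energy lborel (ift (\<lambda>t. G (s, t))) \<partial>lborel)"
    unfolding energy_def P_def ..
  also have "\<dots> \<le> (\<integral>\<^sup>+s. ennreal (2 * pi) * energy lborel (\<lambda>t. G (s, t)) \<partial>lborel)"
    using lborel_pair.AE_integrable_fst'[OF G']
    by (intro nn_integral_mono_AE) (auto elim!: eventually_mono intro: Plancherel_le)
  also have "\<dots> = ennreal (2 * pi) * (\<integral>\<^sup>+s. \<integral>\<^sup>+t. ennreal ((cmod (G (s, t)))\<^sup>2) \<partial>lborel \<partial>lborel)"
    unfolding energy_def by (rule nn_integral_cmult) measurable
  also have "(\<integral>\<^sup>+s. \<integral>\<^sup>+t. ennreal ((cmod (G (s, t)))\<^sup>2) \<partial>lborel \<partial>lborel) = energy lborel G"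
    unfolding energy_def lborel_prod[symmetric] by (rule lborel.nn_integral_fst) measurable
  finally have 2: "(\<integral>\<^sup>+y. \<integral>\<^sup>+s. ennreal ((cmod (P y s))\<^sup>2) \<partial>lborel \<partial>lborel)
    \<le> ennreal (2 * pi) * energy lborel G" .
  have "ennreal ((2 * pi)\<^sup>2) = ennreal (2 * pi) * ennreal (2 * pi)"
    by (simp only: power2_eq_square) (rule ennreal_mult, simp_all)
  with order_trans[OF 1 mult_left_mono[OF 2, of "ennreal (2 * pi)"]] show ?thesis
    by (simp only: mult.assoc) simp
qed

section \<open>Riesz bases of exponentials\<close>

text \<open>The given notion of Riesz basis lives on the completed measure; this Borel counterpart
  fits \<open>lborel\<close> and Fubini. For Borel functions the integrals and norms agree, as the
  transfer lemmas below record.\<close>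

definition cell :: "real measure" where
  "cell = restrict_space lborel {-pi..pi}"

lemma space_cell [simp]: "space cell = {-pi..pi}"
  by (simp add: cell_def space_restrict_space)

lemma measurable_cell [measurable (raw)]:
  "f \<in> borel_measurable borel \<Longrightarrow> f \<in> borel_measurable cell"
  unfolding cell_def by (rule measurable_restrict_space1) simp

lemma emeasure_cell: "emeasure cell {-pi..pi} = ennreal (2 * pi)"
  unfolding cell_def by (subst emeasure_restrict_space) auto

interpretation cell: finite_measure cell
  by (rule finite_measureI) (simp add: emeasure_cell)

lemma integral_cell:
  fixes f :: "real \<Rightarrow> 'b::{banach, second_countable_topology}"
  shows "integral\<^sup>L cell f = (\<integral>u. indicator {-pi..pi} u *\<^sub>R f u \<partial>lborel)"
  unfolding cell_def by (rule integral_restrict_space) simp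

lemma square_integrable_cell_bounded:
  assumes [measurable]: "f \<in> borel_measurable borel"
    and bnd: "\<And>u. \<bar>u\<bar> \<le> pi \<Longrightarrow> cmod (f u) \<le> K"
  shows "square_integrable cell f"
  unfolding square_integrable_def
proof
  have "(cmod (f u))\<^sup>2 \<le> K\<^sup>2" if "u \<in> {-pi..pi}" for u
    using bnd[of u] that by (intro power_mono) auto
  then show "integrable cell (\<lambda>t. (cmod (f t))\<^sup>2)"
    by (intro cell.integrable_const_bound[where B = "K\<^sup>2"] AE_I2) auto
qed measurable

lemma integral_lebesgue_on_cell:
  fixes f :: "real \<Rightarrow> 'b::{banach, second_countable_topology}"
  assumes [measurable]: "f \<in> borel_measurable borel"
  shows "integral\<^sup>L (lebesgue_on {-pi..pi}) f = integral\<^sup>L cell f"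
  unfolding integral_cell by (subst integral_restrict_space) (simp_all add: integral_completion)

lemma integrable_lebesgue_on_cell:
  fixes f :: "real \<Rightarrow> 'b::{banach, second_countable_topology}"
  assumes [measurable]: "f \<in> borel_measurable borel"
  shows "integrable (lebesgue_on {-pi..pi}) f \<longleftrightarrow> integrable cell f"
  unfolding cell_def by (simp add: integrable_restrict_space integrable_completion)

lemma square_integrable_lebesgue_on_cell:
  assumes [measurable]: "f \<in> borel_measurable borel"
  shows "square_integrable (lebesgue_on {-pi..pi}) f \<longleftrightarrow> square_integrable cell f"
proof -
  have "f \<in> borel_measurable (lebesgue_on {-pi..pi})"
    by (rule measurable_restrict_space1) (simp add: measurable_completion)
  then show ?thesis
    by (simp add: square_integrable_def integrable_lebesgue_on_cell measurable_cell)
qed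

lemma L2_norm_lebesgue_on_cell:
  assumes [measurable]: "f \<in> borel_measurable borel"
  shows "L2_norm (lebesgue_on {-pi..pi}) f = L2_norm cell f"
  unfolding L2_norm_def by (subst integral_lebesgue_on_cell) auto

section \<open>Nonharmonic trigonometric sums and the inequalities of a Riesz basis\<close>

definition trig_sum :: "(int \<Rightarrow> real) \<Rightarrow> int set \<Rightarrow> (int \<Rightarrow> complex) \<Rightarrow> real \<Rightarrow> complex" where
  "trig_sum x J a u = (\<Sum>j\<in>J. a j * cis (- (x j * u)))"

lemma measurable_trig_sum [measurable]: "trig_sum x J a \<in> borel_measurable borel"
  unfolding trig_sum_def[abs_def] by measurable

lemma norm_trig_sum_le: "cmod (trig_sum x J a u) \<le> (\<Sum>j\<in>J. cmod (a j))"
  unfolding trig_sum_def by (intro sum_norm_le) (simp add: norm_mult)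

lemma square_integrable_trig_sum: "square_integrable cell (trig_sum x J a)"
  by (rule square_integrable_cell_bounded) (auto intro: norm_trig_sum_le)

lemma L2_norm_squared: "(L2_norm M f)\<^sup>2 = (sq_int M f)"
  unfolding L2_norm_def by (simp add: integral_nonneg_AE)

lemma square_integrable_diff:
  assumes "square_integrable M f" "square_integrable M g"
  shows "square_integrable M (\<lambda>t. f t - g t)"
proof -
  have [measurable]: "f \<in> borel_measurable M" "g \<in> borel_measurable M"
    using assms by (auto simp: square_integrable_def)
  have "energy M (\<lambda>t. f t - g t) \<le> 2 * energy M f + 2 * energy M g"
    by (rule energy_diff_le) auto
  also have "\<dots> < \<infinity>"
    using assms by (simp add: square_integrable_iff_energy ennreal_mult_less_top)
  finally show ?thesis by (simp add: square_integrable_iff_energy)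
qed

lemma Cauchy_Schwarz_sum_complex:
  "cmod (\<Sum>j\<in>J. a j * b j) \<le> sqrt (sq_sum a J) * sqrt (sq_sum b J)"
proof -
  have "cmod (\<Sum>j\<in>J. a j * b j) \<le> (\<Sum>j\<in>J. cmod (a j) * cmod (b j))"
    by (intro sum_norm_le) (simp add: norm_mult)
  also have "\<dots> \<le> sqrt ((sq_sum a J) * (sq_sum b J))"
    by (intro real_le_rsqrt Cauchy_Schwarz_ineq_sum)
  finally show ?thesis by (simp add: real_sqrt_mult)
qed

text \<open>For coefficients extended by zero the net of partial sums is eventually constant. Hence
  the L2 sum \<open>s\<close> equals the trigonometric sum almost everywhere, and the two Riesz
  inequalities can be squared and moved to \<open>cell\<close>.\<close>

lemma riesz_basis_sequence_bounds:
  assumes "riesz_basis_sequence x"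
  obtains B where "B > 0"
    and "\<And>J a. finite J \<Longrightarrow> (sq_sum a J) \<le> B\<^sup>2 * (sq_int cell (trig_sum x J a))"
    and "\<And>J a. finite J \<Longrightarrow> (sq_int cell (trig_sum x J a)) \<le> B\<^sup>2 * (sq_sum a J)"
proof -
  define \<phi> where "\<phi> j t = exp (- (\<i> * complex_of_real (x j * t)))" for j t
  define M where "M = lebesgue_on {-pi..pi}"
  have \<phi>: "\<phi> j t = cis (- (x j * t))" for j t by (simp add: \<phi>_def cis_conv_exp)
  have riesz: "riesz_basis_L2 M \<phi>"
    using assms unfolding riesz_basis_sequence_def M_def \<phi>_def[abs_def] by simp
  then obtain B where B: "B > 0" and
    bounds: "\<And>c. square_summable c \<Longrightarrow> \<exists>s. has_L2_sum M c \<phi> s \<and>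
      inverse B * l2_norm c \<le> L2_norm M s \<and> L2_norm M s \<le> B * l2_norm c"
    unfolding riesz_basis_L2_def by blast
  have *: "(sq_sum a J) \<le> B\<^sup>2 * (sq_int cell (trig_sum x J a)) \<and>
    (sq_int cell (trig_sum x J a)) \<le> B\<^sup>2 * (sq_sum a J)"
    if J: "finite J" for J a
  proof -
    define c where "c j = (if j \<in> J then a j else 0)" for j
    have "l2_energy c < \<infinity>"
      by (subst l2_energy_finite[OF J]) (auto simp: c_def)
    then have "square_summable c" by (simp add: square_summable_iff_energy)
    then obtain s where s: "has_L2_sum M c \<phi> s" and le: "inverse B * l2_norm c \<le> L2_norm M s"
      "L2_norm M s \<le> B * l2_norm c" using bounds by blast
    have "(\<Sum>\<^sub>\<infinity>j. (cmod (c j))\<^sup>2) = infsum (\<lambda>j. (cmod (a j))\<^sup>2) J"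
      by (intro infsum_cong_neutral) (auto simp: c_def)
    then have l2: "(l2_norm c)\<^sup>2 = (sq_sum a J)" "0 \<le> l2_norm c"
      using J by (simp_all add: l2_norm_def sum_nonneg)
    let ?p = "trig_sum x J a"
    have sum_c: "(\<Sum>j\<in>I. c j * \<phi> j t) = ?p t" if "finite I" "J \<subseteq> I" for I t
    proof -
      have "(\<Sum>j\<in>I. c j * \<phi> j t) = (\<Sum>j\<in>J. c j * \<phi> j t)"
        using that by (intro sum.mono_neutral_right) (auto simp: c_def)
      then show ?thesis by (simp add: trig_sum_def c_def \<phi>)
    qed
    have sq_s: "square_integrable M s"
      and lim: "((\<lambda>I. L2_norm M (\<lambda>t. (\<Sum>j\<in>I. c j * \<phi> j t) - s t)) \<longlongrightarrow> 0) (finite_subsets_at_top UNIV)"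
      using s unfolding has_L2_sum_def L2_tendsto_def by auto
    have "\<forall>\<^sub>F I in finite_subsets_at_top UNIV.
      L2_norm M (\<lambda>t. (\<Sum>j\<in>I. c j * \<phi> j t) - s t) = L2_norm M (\<lambda>t. ?p t - s t)"
      unfolding eventually_finite_subsets_at_top using J sum_c by (intro exI[of _ J]) auto
    then have "((\<lambda>I. L2_norm M (\<lambda>t. (\<Sum>j\<in>I. c j * \<phi> j t) - s t)) \<longlongrightarrow> L2_norm M (\<lambda>t. ?p t - s t)) (finite_subsets_at_top UNIV)"
      by (rule tendsto_eventually)
    then have zero: "L2_norm M (\<lambda>t. ?p t - s t) = 0"
      using lim by (rule tendsto_unique[OF finite_subsets_at_top_neq_bot])
    have sq_p: "square_integrable M ?p"
      unfolding M_def by (subst square_integrable_lebesgue_on_cell) (auto intro: square_integrable_trig_sum)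
    have sq_d: "square_integrable M (\<lambda>t. ?p t - s t)"
      by (rule square_integrable_diff[OF sq_p sq_s])
    have "AE t in M. (cmod (?p t - s t))\<^sup>2 = 0"
      using zero sq_d unfolding L2_norm_def square_integrable_def
      by (subst integral_nonneg_eq_0_iff_AE[symmetric]) auto
    then have ae: "AE t in M. (cmod (s t))\<^sup>2 = (cmod (?p t))\<^sup>2" by eventually_elim simp
    have "(sq_int M s) = (\<integral>t. (cmod (?p t))\<^sup>2 \<partial>M)"
      by (intro integral_cong_AE ae borel_measurable_integrable)
         (use sq_s sq_p in \<open>auto simp: square_integrable_def\<close>)
    then have "L2_norm M s = L2_norm M ?p" by (simp add: L2_norm_def)
    also have "\<dots> = L2_norm cell ?p" unfolding M_def by (rule L2_norm_lebesgue_on_cell) simp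
    finally have eq: "(L2_norm M s)\<^sup>2 = (\<integral>u. (cmod (?p u))\<^sup>2 \<partial>cell)"
      by (simp add: L2_norm_squared)
    have "l2_norm c \<le> B * L2_norm M s"
      using le(1) B by (simp add: field_simps)
    then have "(l2_norm c)\<^sup>2 \<le> (B * L2_norm M s)\<^sup>2" using l2(2) by (rule power_mono)
    moreover have "(L2_norm M s)\<^sup>2 \<le> (B * l2_norm c)\<^sup>2"
      using le(2) by (rule power_mono) (simp add: L2_norm_def integral_nonneg_AE)
    ultimately show ?thesis by (simp add: power_mult_distrib eq l2(1))
  qed
  show thesis using that[OF B] * by blast
qed

lemma integral_mult_cnj_trig_sum:
  assumes k: "\<And>j. j \<in> J \<Longrightarrow> integrable M (\<lambda>u. k u * cis (x j * u))"
  shows "(\<integral>u. k u * cnj (trig_sum x J a u) \<partial>M)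
    = (\<Sum>j\<in>J. cnj (a j) * (\<integral>u. k u * cis (x j * u) \<partial>M))"
proof -
  have "k u * cnj (trig_sum x J a u) = (\<Sum>j\<in>J. cnj (a j) * (k u * cis (x j * u)))" for u
    by (simp add: trig_sum_def sum_distrib_left cis_cnj mult_ac)
  then have "(\<integral>u. k u * cnj (trig_sum x J a u) \<partial>M) = (\<integral>u. (\<Sum>j\<in>J. cnj (a j) * (k u * cis (x j * u))) \<partial>M)"
    by simp
  also have "\<dots> = (\<Sum>j\<in>J. \<integral>u. cnj (a j) * (k u * cis (x j * u)) \<partial>M)"
    by (intro Bochner_Integration.integral_sum integrable_mult_right k)
  finally show ?thesis by simp
qed

lemma integrable_cell_mult_cis:
  assumes k: "square_integrable cell k"
  shows "integrable cell (\<lambda>u. k u * cis (t * u))"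
  by (rule Cauchy_Schwarz_integral(1)[OF k square_integrable_cell_bounded[where K = 1]]) auto

text \<open>\<open>k\<close> is paired with its own expansion, whose coefficients the lower Riesz bound controls.\<close>

lemma riesz_basis_sequence_frame:
  assumes riesz: "riesz_basis_sequence x" and B: "B > 0"
    and lower: "\<And>J a. finite J \<Longrightarrow> (sq_sum a J) \<le> B\<^sup>2 * (sq_int cell (trig_sum x J a))"
    and [measurable]: "k \<in> borel_measurable borel" and k: "square_integrable cell k"
    and S: "l2_le (\<lambda>m. \<integral>u. k u * cis (x m * u) \<partial>cell) S"
  shows "(sq_int cell k) \<le> 2 * B\<^sup>2 * S"
proof -
  define M where "M = lebesgue_on {-pi..pi}"
  define E where "E = (sq_int cell k)"
  define f where "f m = (\<integral>u. k u * cis (x m * u) \<partial>cell)" for m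
  have E0: "0 \<le> E" unfolding E_def by (intro integral_nonneg_AE) auto
  have S0: "0 \<le> S" using l2_le_nonneg[OF S] .
  have "square_integrable M k" unfolding M_def using k by (simp add: square_integrable_lebesgue_on_cell)
  then obtain c where c: "has_L2_sum M c (\<lambda>j t. exp (- (\<i> * complex_of_real (x j * t)))) k"
    using riesz unfolding riesz_basis_sequence_def riesz_basis_L2_def M_def by blast
  define e where "e I = L2_norm cell (\<lambda>u. trig_sum x I c u - k u)" for I
  have "((\<lambda>I. L2_norm M (\<lambda>t. (\<Sum>j\<in>I. c j * exp (- (\<i> * complex_of_real (x j * t)))) - k t)) \<longlongrightarrow> 0) (finite_subsets_at_top UNIV)"
    using c unfolding has_L2_sum_def L2_tendsto_def by auto
  moreover have "L2_norm M (\<lambda>t. (\<Sum>j\<in>I. c j * exp (- (\<i> * complex_of_real (x j * t)))) - k t) = e I" for I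
  proof -
    have "(\<lambda>t. (\<Sum>j\<in>I. c j * exp (- (\<i> * complex_of_real (x j * t)))) - k t) = (\<lambda>u. trig_sum x I c u - k u)"
      by (simp add: trig_sum_def cis_conv_exp)
    then show ?thesis unfolding M_def e_def by (simp add: L2_norm_lebesgue_on_cell)
  qed
  ultimately have lim: "(e \<longlongrightarrow> 0) (finite_subsets_at_top UNIV)" by simp
  \<comment> \<open>The pairing of \<open>k\<close> with itself is its pairing with the partial sum
    minus its pairing with the remainder, of norm \<open>e I\<close>. The first consists of moments
    and coefficients, and the coefficients are bounded by the partial sum, hence by 2 E + 2 (e I)^2.
    This is the origin of the 2 in the conclusion.\<close>
  have main: "E \<le> sqrt E * e I + sqrt S * (B * sqrt (2 * E + 2 * (e I)\<^sup>2))" if I: "finite I" for I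
  proof -
    let ?p = "trig_sum x I c"
    have sq_d: "square_integrable cell (\<lambda>u. ?p u - k u)"
      by (rule square_integrable_diff[OF square_integrable_trig_sum k])
    have sq_c: "square_integrable cell (\<lambda>u. cnj (f u))" if "square_integrable cell f" for f
      using that unfolding square_integrable_def by auto
    have i1: "integrable cell (\<lambda>u. k u * cnj (?p u))" "integrable cell (\<lambda>u. k u * cnj (?p u - k u))"
      using Cauchy_Schwarz_integral(1)[OF k sq_c[OF square_integrable_trig_sum]]
        Cauchy_Schwarz_integral(1)[OF k sq_c[OF sq_d]] by auto
    have "complex_of_real E = (\<integral>u. k u * cnj (k u) \<partial>cell)"
      unfolding E_def by (simp only: complex_norm_square[symmetric] integral_complex_of_real)
    also have "\<dots> = (\<integral>u. k u * cnj (?p u) - k u * cnj (?p u - k u) \<partial>cell)"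
      by (simp add: algebra_simps)
    also have "\<dots> = (\<integral>u. k u * cnj (?p u) \<partial>cell) - (\<integral>u. k u * cnj (?p u - k u) \<partial>cell)"
      by (intro Bochner_Integration.integral_diff i1)
    finally have *: "complex_of_real E
      = (\<integral>u. k u * cnj (?p u) \<partial>cell) - (\<integral>u. k u * cnj (?p u - k u) \<partial>cell)" .
    have "E = cmod (complex_of_real E)" using E0 by simp
    also have "\<dots> \<le> cmod (\<integral>u. k u * cnj (?p u) \<partial>cell) + cmod (\<integral>u. k u * cnj (?p u - k u) \<partial>cell)"
      unfolding * by (rule norm_triangle_ineq4)
    finally have "E \<le> cmod (\<integral>u. k u * cnj (?p u) \<partial>cell) + cmod (\<integral>u. k u * cnj (?p u - k u) \<partial>cell)" .
    also have "cmod (\<integral>u. k u * cnj (?p u - k u) \<partial>cell) \<le> sqrt E * e I"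
    proof -
      have "(cmod (\<integral>u. k u * cnj (?p u - k u) \<partial>cell))\<^sup>2 \<le> E * (e I)\<^sup>2"
        using Cauchy_Schwarz_integral(2)[OF k sq_c[OF sq_d]] by (simp only: complex_mod_cnj E_def e_def L2_norm_squared)
      then have "cmod (\<integral>u. k u * cnj (?p u - k u) \<partial>cell) \<le> sqrt (E * (e I)\<^sup>2)"
        by (rule real_le_rsqrt)
      moreover have "0 \<le> e I" unfolding e_def L2_norm_def by (simp add: integral_nonneg_AE)
      ultimately show ?thesis by (simp add: real_sqrt_mult)
    qed
    also have "cmod (\<integral>u. k u * cnj (?p u) \<partial>cell) \<le> sqrt S * (B * sqrt (2 * E + 2 * (e I)\<^sup>2))"
    proof -
      have "cmod (\<integral>u. k u * cnj (?p u) \<partial>cell) = cmod (\<Sum>j\<in>I. cnj (c j) * f j)"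
        unfolding f_def by (subst integral_mult_cnj_trig_sum[OF integrable_cell_mult_cis[OF k]]) simp
      also have "\<dots> \<le> sqrt (\<Sum>j\<in>I. (cmod (cnj (c j)))\<^sup>2) * sqrt (sq_sum f I)"
        by (rule Cauchy_Schwarz_sum_complex)
      also have "\<dots> \<le> (B * sqrt (2 * E + 2 * (e I)\<^sup>2)) * sqrt S"
      proof (intro mult_mono)
        have "(\<integral>u. (cmod (?p u))\<^sup>2 \<partial>cell) \<le> (\<integral>u. 2 * (cmod (k u))\<^sup>2 + 2 * (cmod (?p u - k u))\<^sup>2 \<partial>cell)"
        proof (rule integral_mono)
          show "(cmod (?p u))\<^sup>2 \<le> 2 * (cmod (k u))\<^sup>2 + 2 * (cmod (?p u - k u))\<^sup>2" for u
            using cmod_add_squared_le[of "k u" "?p u - k u"] by simp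
        qed (use k sq_d square_integrable_trig_sum in \<open>auto simp: square_integrable_def\<close>)
        also have "\<dots> = 2 * E + 2 * (e I)\<^sup>2"
          unfolding E_def e_def L2_norm_squared using k sq_d
          by (subst Bochner_Integration.integral_add) (auto simp: square_integrable_def)
        finally have "(sq_sum c I) \<le> B\<^sup>2 * (2 * E + 2 * (e I)\<^sup>2)"
          using lower[OF I, of c] B by (meson mult_left_mono order_trans zero_le_power2)
        then show "sqrt (\<Sum>j\<in>I. (cmod (cnj (c j)))\<^sup>2) \<le> B * sqrt (2 * E + 2 * (e I)\<^sup>2)"
          using B by (intro real_le_lsqrt) (auto simp: power_mult_distrib E0)
        show "sqrt (sq_sum f I) \<le> sqrt S"
          using l2_leD[OF S I] unfolding f_def by simp
      qed (use B E0 in \<open>auto intro!: sum_nonneg\<close>)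
      finally show ?thesis by (simp add: mult.commute)
    qed
    finally show ?thesis by simp
  qed
  have "((\<lambda>I. sqrt E * e I + sqrt S * (B * sqrt (2 * E + 2 * (e I)\<^sup>2))) \<longlongrightarrow>
    sqrt E * 0 + sqrt S * (B * sqrt (2 * E + 2 * 0\<^sup>2))) (finite_subsets_at_top UNIV)"
    by (intro tendsto_intros lim)
  then have "E \<le> sqrt E * 0 + sqrt S * (B * sqrt (2 * E + 2 * 0\<^sup>2))"
    by (rule tendsto_lowerbound) (auto intro!: eventually_finite_subsets_at_top_weakI main)
  then have "E \<le> sqrt S * (B * sqrt (2 * E))" by simp
  then have "E\<^sup>2 \<le> (sqrt S * (B * sqrt (2 * E)))\<^sup>2" using E0 by (intro power_mono)
  also have "\<dots> = E * (2 * B\<^sup>2 * S)"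
    using E0 S0 by (simp add: power_mult_distrib)
  finally have "E * E \<le> E * (2 * B\<^sup>2 * S)" by (simp only: power2_eq_square)
  then have "E \<le> 2 * B\<^sup>2 * S"
    using E0 S0 by (cases "E = 0") (auto simp: mult_le_cancel_left)
  then show ?thesis by (simp add: E_def)
qed

text \<open>What the estimates take from a Riesz basis. \<open>lower\<close> and
  \<open>upper\<close> compare finite coefficient families with their sums; \<open>frame\<close>,
  the quantitative form of completeness, recovers the size of a function on the cell from its
  moments at the nodes.\<close>

locale riesz_nodes =
  fixes x :: "int \<Rightarrow> real" and B :: real
  assumes B_pos: "B > 0"
    and nodes_less: "x j < x (j + 1)"
    and lower: "finite J \<Longrightarrow> (sq_sum a J) \<le> B\<^sup>2 * (sq_int cell (trig_sum x J a))"
    and upper: "finite J \<Longrightarrow> (sq_int cell (trig_sum x J a)) \<le> B\<^sup>2 * (sq_sum a J)"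
    and frame: "k \<in> borel_measurable borel \<Longrightarrow> square_integrable cell k \<Longrightarrow>
      l2_le (\<lambda>m. \<integral>u. k u * cis (x m * u) \<partial>cell) S \<Longrightarrow>
      (sq_int cell k) \<le> 2 * B\<^sup>2 * S"

lemma riesz_nodes_exist:
  assumes "riesz_basis_sequence x"
  obtains B where "riesz_nodes x B"
proof -
  obtain B where B: "B > 0"
    and lower: "\<And>J a. finite J \<Longrightarrow> (sq_sum a J) \<le> B\<^sup>2 * (sq_int cell (trig_sum x J a))"
    and upper: "\<And>J a. finite J \<Longrightarrow> (sq_int cell (trig_sum x J a)) \<le> B\<^sup>2 * (sq_sum a J)"
    using riesz_basis_sequence_bounds[OF assms] by blast
  have "riesz_nodes x B"
  proof (rule riesz_nodes.intro)
    show "x j < x (j + 1)" for j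
      using assms by (simp add: riesz_basis_sequence_def)
    show "(sq_int cell k) \<le> 2 * B\<^sup>2 * S"
      if "k \<in> borel_measurable borel" "square_integrable cell k"
        "l2_le (\<lambda>m. \<integral>u. k u * cis (x m * u) \<partial>cell) S" for k S
      by (rule riesz_basis_sequence_frame[OF assms B lower that])
  qed (fact B lower upper)+
  then show thesis by (rule that)
qed

lemma cmod_cis_diff_le: "cmod (cis a - cis b) \<le> \<bar>a - b\<bar>"
proof -
  have "cis a - cis b = cis b * (cis (a - b) - 1)"
    by (simp add: cis_mult right_diff_distrib)
  then have "cis a - cis b = cis b * (iexp (a - b) - 1)" by (simp only: cis_conv_exp)
  then have "cmod (cis a - cis b) = cmod (iexp (a - b) - 1)" by (simp add: norm_mult)
  also have "\<dots> \<le> \<bar>a - b\<bar>" using iexp_approx1[of "a - b" 0] by simp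
  finally show ?thesis .
qed

text \<open>On each side of \<open>i\<close> the distance to \<open>i\<close> determines
  \<open>j\<close>, so each half is dominated by one geometric series.\<close>

lemma sum_geometric_int_le:
  fixes c :: real
  assumes c: "0 \<le> c" "c < 1" and J: "finite J"
  shows "(\<Sum>j\<in>J. c ^ nat \<bar>i - j\<bar>) \<le> 2 / (1 - c)"
proof -
  have geo: "(\<Sum>n\<in>N. c ^ n) \<le> 1 / (1 - c)" if "finite N" for N
  proof -
    have "(\<Sum>n\<in>N. c ^ n) \<le> (\<Sum>n. c ^ n)"
      using c by (intro sum_le_suminf summable_geometric that) auto
    then show ?thesis using c by (simp add: suminf_geometric)
  qed
  have half: "(\<Sum>j\<in>L. c ^ nat \<bar>i - j\<bar>) \<le> 1 / (1 - c)"
    if "finite L" "inj_on (\<lambda>j. nat \<bar>i - j\<bar>) L" for L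
  proof -
    have "(\<Sum>j\<in>L. c ^ nat \<bar>i - j\<bar>) = (\<Sum>n\<in>(\<lambda>j. nat \<bar>i - j\<bar>) ` L. c ^ n)"
      by (simp add: sum.reindex[OF that(2)])
    then show ?thesis using geo that(1) by simp
  qed
  have "(\<Sum>j\<in>J. c ^ nat \<bar>i - j\<bar>) = (\<Sum>j\<in>{j\<in>J. j \<le> i}. c ^ nat \<bar>i - j\<bar>) + (\<Sum>j\<in>{j\<in>J. \<not> j \<le> i}. c ^ nat \<bar>i - j\<bar>)"
    using J by (subst sum.union_disjoint[symmetric]) (auto intro!: sum.cong)
  also have "\<dots> \<le> 1 / (1 - c) + 1 / (1 - c)"
    using J by (intro add_mono half) (auto simp: inj_on_def)
  finally show ?thesis by simp
qed

lemma integrable_gauss_dominated: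
  fixes f :: "real \<Rightarrow> 'b::{banach, second_countable_topology}"
  assumes [measurable]: "f \<in> borel_measurable borel"
    and bnd: "\<And>u. norm (f u) \<le> K * exp (- (1/4) * u\<^sup>2)"
  shows "integrable lborel f"
proof (rule Bochner_Integration.integrable_bound)
  show "integrable lborel (\<lambda>u. K * exp (- (1/4) * u\<^sup>2))"
    by (intro integrable_mult_right integrable_gauss) simp
  show "AE u in lborel. norm (f u) \<le> norm (K * exp (- (1/4) * u\<^sup>2))"
    using bnd by (intro AE_I2) (metis order_trans abs_ge_self real_norm_def)
qed measurable

lemma gauss_weight_mono:
  assumes "r > 0" "\<bar>u\<bar> \<le> \<bar>v\<bar>"
  shows "gauss_weight r v \<le> gauss_weight r u"
proof -
  have "u\<^sup>2 \<le> v\<^sup>2" using assms(2) by (simp add: abs_le_square_iff)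
  then show ?thesis using assms(1) unfolding gauss_weight_def
    by (intro divide_right_mono) (auto simp: divide_right_mono)
qed

text \<open>For r \<le> 1 the weight decays beyond |v| at least as fast as exp (- u^2 / 4), relative
  to its value at \<open>v\<close>. Through this fixed Gaussian the later constants become
  independent of \<open>r\<close>.\<close>

lemma gauss_weight_ratio_le:
  assumes "0 < r" "r \<le> 1" "\<bar>v\<bar> \<le> \<bar>u\<bar>"
  shows "gauss_weight r u \<le> gauss_weight r v * exp (v\<^sup>2 / 4) * exp (- (1/4) * u\<^sup>2)"
proof -
  have "v\<^sup>2 \<le> u\<^sup>2" using assms(3) by (simp add: abs_le_square_iff)
  then have "(u\<^sup>2 - v\<^sup>2) / 4 \<le> (u\<^sup>2 - v\<^sup>2) / (4 * r)"
    using assms by (intro divide_left_mono) auto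
  then have "- (u\<^sup>2) / (4 * r) \<le> - (v\<^sup>2) / (4 * r) + (v\<^sup>2 / 4 + - (1/4) * u\<^sup>2)"
    by (simp add: diff_divide_distrib)
  then have "exp (- (u\<^sup>2) / (4 * r)) \<le> exp (- (v\<^sup>2) / (4 * r)) * (exp (v\<^sup>2 / 4) * exp (- (1/4) * u\<^sup>2))"
    by (simp only: exp_add[symmetric] exp_le_cancel_iff)
  then show ?thesis
    using assms(1) unfolding gauss_weight_def
    by (simp add: divide_right_mono mult.assoc)
qed

lemma gauss_weight_le_exp:
  assumes "0 < r" "r \<le> 1"
  shows "gauss_weight r u \<le> gauss_weight r 0 * exp (- (1/4) * u\<^sup>2)"
  using gauss_weight_ratio_le[OF assms, of 0 u] by simp

lemma exp_eq_gauss_weight: "exp (- (1/4) * u\<^sup>2) = sqrt (4 * pi) * gauss_weight 1 u"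
  by (simp add: gauss_weight_def)

section \<open>The Gram matrix of Gaussian translates at Riesz nodes\<close>

context riesz_nodes
begin

definition gram :: "real \<Rightarrow> int \<Rightarrow> int \<Rightarrow> real" where
  "gram r i j = exp (- r * (x i - x j)\<^sup>2)"

abbreviation gram_sum :: "real \<Rightarrow> int set \<Rightarrow> (int \<Rightarrow> complex) \<Rightarrow> int \<Rightarrow> complex" where
  "gram_sum r J a m \<equiv> \<Sum>j\<in>J. a j * complex_of_real (gram r m j)"

abbreviation gauss_sum :: "real \<Rightarrow> int set \<Rightarrow> (int \<Rightarrow> complex) \<Rightarrow> real \<Rightarrow> complex" where
  "gauss_sum r J a t \<equiv> \<Sum>j\<in>J. a j * complex_of_real (exp (- r * (t - x j)\<^sup>2))"

abbreviation gauss_series :: "real \<Rightarrow> (int \<Rightarrow> complex) \<Rightarrow> real \<Rightarrow> complex" where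
  "gauss_series r a t \<equiv> \<Sum>\<^sub>\<infinity>j. a j * complex_of_real (exp (- r * (t - x j)\<^sup>2))"

text \<open>The lower Riesz bound keeps neighbouring exponentials apart: their difference has
  coefficient energy 2, while for nodes at distance \<open>d\<close> its energy on the cell is at
  most 2 pi (d pi)^2. Solving for \<open>d\<close> gives the constant \<open>q\<close>; longer
  distances follow by adding up neighbouring gaps.\<close>

lemma gap: obtains q where "q > 0" "\<And>i j. q * \<bar>real_of_int (i - j)\<bar> \<le> \<bar>x i - x j\<bar>"
proof -
  define q where "q = 1 / (B * pi * sqrt pi)"
  have q: "q > 0" using B_pos by (simp add: q_def)
  have step: "q \<le> x (j + 1) - x j" for j
  proof -
    define a :: "int \<Rightarrow> complex" where "a i = (if i = j then 1 else - 1)" for i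
    define d where "d = x (j + 1) - x j"
    have d: "d > 0" using nodes_less by (simp add: d_def)
    have le: "cmod (trig_sum x {j, j + 1} a u) \<le> d * pi" if "\<bar>u\<bar> \<le> pi" for u
    proof -
      have "trig_sum x {j, j + 1} a u = cis (- (x j * u)) - cis (- (x (j + 1) * u))"
        by (simp add: trig_sum_def a_def)
      also have "cmod \<dots> \<le> \<bar>- (x j * u) - (- (x (j + 1) * u))\<bar>" by (rule cmod_cis_diff_le)
      also have "\<dots> = \<bar>d * u\<bar>" by (simp add: d_def algebra_simps)
      also have "\<dots> \<le> d * pi" using d that by (simp add: abs_mult)
      finally show ?thesis .
    qed
    have "2 = (\<Sum>i\<in>{j, j + 1}. (cmod (a i))\<^sup>2)" by (simp add: a_def)
    also have "\<dots> \<le> B\<^sup>2 * (\<integral>u. (cmod (trig_sum x {j, j + 1} a u))\<^sup>2 \<partial>cell)"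
      by (rule lower) simp
    also have "\<dots> \<le> B\<^sup>2 * (\<integral>u. (d * pi)\<^sup>2 \<partial>cell)"
    proof (intro mult_left_mono integral_mono)
      show "integrable cell (\<lambda>u. (cmod (trig_sum x {j, j + 1} a u))\<^sup>2)"
        using square_integrable_trig_sum by (auto simp: square_integrable_def)
    qed (auto intro!: power_mono le)
    also have "\<dots> = 2 * (B * d * pi * sqrt pi)\<^sup>2"
      using emeasure_cell by (simp add: measure_def power_mult_distrib)
    finally have "1 \<le> (B * d * pi * sqrt pi)\<^sup>2" by simp
    then have "1 \<le> B * d * pi * sqrt pi"
      using B_pos d by (intro power2_le_imp_le[of 1]) auto
    then show ?thesis using B_pos by (simp add: q_def d_def field_simps)
  qed
  have chain: "q * real n \<le> x (j + int n) - x j" for n j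
  proof (induction n)
    case (Suc n)
    have e: "j + int (Suc n) = j + int n + 1" "q * real (Suc n) = q + q * real n"
      by (simp_all add: distrib_left)
    show ?case unfolding e using Suc step[of "j + int n"] by linarith
  qed simp
  have "q * \<bar>real_of_int (i - j)\<bar> \<le> \<bar>x i - x j\<bar>" for i j
  proof (cases "i \<le> j")
    case True
    then show ?thesis using chain[of "nat (j - i)" i] by simp
  next
    case False
    then show ?thesis using chain[of "nat (i - j)" j] by simp
  qed
  with q show thesis by (rule that)
qed

lemma gram_row_bound:
  assumes r: "r > 0"
  obtains M where "M > 0" "\<And>i J. finite J \<Longrightarrow> (\<Sum>j\<in>J. gram r i j) \<le> M"
proof -
  obtain q where q: "q > 0" "\<And>i j. q * \<bar>real_of_int (i - j)\<bar> \<le> \<bar>x i - x j\<bar>" using gap by blast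
  define c where "c = exp (- (r * q\<^sup>2))"
  have c: "0 \<le> c" "c < 1" using r q(1) by (auto simp: c_def)
  have le: "gram r i j \<le> c ^ nat \<bar>i - j\<bar>" for i j
  proof -
    define n where "n = nat \<bar>i - j\<bar>"
    have n: "\<bar>real_of_int (i - j)\<bar> = real n" by (simp add: n_def)
    \<comment> \<open>A natural number is at most its square, which trades the Gaussian decay for a
      geometric series.\<close>
    have "real n \<le> (real n)\<^sup>2" by (cases n) (auto simp: power2_eq_square)
    then have "q\<^sup>2 * real n \<le> (q * real n)\<^sup>2" by (simp add: power_mult_distrib mult_left_mono)
    also have "\<dots> \<le> \<bar>x i - x j\<bar>\<^sup>2" using q(2)[of i j] q(1) unfolding n by (intro power_mono) auto
    finally have "r * (q\<^sup>2 * real n) \<le> r * (x i - x j)\<^sup>2" using r by (simp add: mult_left_mono)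
    then have "gram r i j \<le> exp (real n * - (r * q\<^sup>2))" by (simp add: gram_def mult_ac)
    also have "\<dots> = c ^ n" by (simp only: c_def exp_of_nat_mult)
    finally show ?thesis by (simp only: n_def)
  qed
  have "(\<Sum>j\<in>J. gram r i j) \<le> 2 / (1 - c)" if "finite J" for i J
    by (rule order_trans[OF sum_mono[OF le] sum_geometric_int_le[OF c that]])
  moreover have "2 / (1 - c) > 0" using c by simp
  ultimately show thesis using that by blast
qed

text \<open>An arbitrary point is compared with the node \<open>x 0\<close>, at the price of halving
  \<open>r\<close>. The bound depends on \<open>t\<close>; it serves summability at that
  point.\<close>

lemma gauss_row_bound:
  assumes r: "r > 0"
  obtains M where "\<And>J. finite J \<Longrightarrow> (\<Sum>j\<in>J. exp (- r * (t - x j)\<^sup>2)) \<le> M"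
proof -
  obtain M where M: "\<And>i J. finite J \<Longrightarrow> (\<Sum>j\<in>J. gram (r / 2) i j) \<le> M"
    using gram_row_bound[OF half_gt_zero[OF r]] by blast
  have le: "exp (- r * (t - x j)\<^sup>2) \<le> exp (r * (t - x 0)\<^sup>2) * gram (r / 2) 0 j" for j
  proof -
    have "(x 0 - x j)\<^sup>2 \<le> 2 * (t - x 0)\<^sup>2 + 2 * (t - x j)\<^sup>2"
      using zero_le_power2[of "(t - x 0) + (t - x j)"] by (simp add: power2_eq_square algebra_simps)
    then have "(r / 2) * (x 0 - x j)\<^sup>2 \<le> (r / 2) * (2 * (t - x 0)\<^sup>2 + 2 * (t - x j)\<^sup>2)"
      using r by (intro mult_left_mono) auto
    then have "- r * (t - x j)\<^sup>2 \<le> r * (t - x 0)\<^sup>2 + - (r / 2) * (x 0 - x j)\<^sup>2"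
      by (simp add: algebra_simps)
    then show ?thesis unfolding gram_def exp_add[symmetric] exp_le_cancel_iff .
  qed
  show thesis
  proof (rule that)
    fix J :: "int set" assume J: "finite J"
    have "(\<Sum>j\<in>J. exp (- r * (t - x j)\<^sup>2)) \<le> (\<Sum>j\<in>J. exp (r * (t - x 0)\<^sup>2) * gram (r / 2) 0 j)"
      by (intro sum_mono le)
    also have "\<dots> \<le> exp (r * (t - x 0)\<^sup>2) * M"
      using M[OF J] by (simp add: sum_distrib_left[symmetric])
    finally show "(\<Sum>j\<in>J. exp (- r * (t - x j)\<^sup>2)) \<le> exp (r * (t - x 0)\<^sup>2) * M" .
  qed
qed

lemma integrable_weight_trig_sum:
  assumes r: "r > 0"
  shows "integrable lborel (\<lambda>u. complex_of_real (gauss_weight r u) * trig_sum x J a u)"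
proof (rule Bochner_Integration.integrable_bound)
  show "integrable lborel (\<lambda>u. gauss_weight r u * (\<Sum>j\<in>J. cmod (a j)))"
    by (intro integrable_mult_left integrable_gauss_weight r)
  show "AE u in lborel. norm (complex_of_real (gauss_weight r u) * trig_sum x J a u)
    \<le> norm (gauss_weight r u * (\<Sum>j\<in>J. cmod (a j)))"
    using norm_trig_sum_le gauss_weight_nonneg[OF r]
    by (intro AE_I2) (auto simp: norm_mult sum_nonneg intro!: mult_left_mono)
qed measurable

lemma ift_weight_trig_sum:
  assumes r: "r > 0"
  shows "ift (\<lambda>u. complex_of_real (gauss_weight r u) * trig_sum x J a u) t
    = (gauss_sum r J a t)"
proof -
  have w: "integrable lborel (\<lambda>u. complex_of_real (gauss_weight r u))"
    using integrable_gauss_weight[OF r] by simp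
  have "ift (\<lambda>u. complex_of_real (gauss_weight r u) * trig_sum x J a u) t
    = (\<integral>u. (\<Sum>j\<in>J. a j * (complex_of_real (gauss_weight r u) * cis ((t - x j) * u))) \<partial>lborel)"
  proof -
    have "cis ((t - x j) * u) = cis (- (x j * u)) * cis (t * u)" for j u
      by (simp add: cis_mult left_diff_distrib)
    then show ?thesis
      unfolding ift_def trig_sum_def inner_real_def by (simp add: sum_distrib_left sum_distrib_right mult_ac)
  qed
  also have "\<dots> = (\<Sum>j\<in>J. \<integral>u. a j * (complex_of_real (gauss_weight r u) * cis ((t - x j) * u)) \<partial>lborel)"
    by (intro Bochner_Integration.integral_sum integrable_mult_right integrable_mult_cis w) measurable
  also have "\<dots> = (\<Sum>j\<in>J. a j * ift (\<lambda>u. complex_of_real (gauss_weight r u)) (t - x j))"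
    by (simp add: ift_def)
  also have "\<dots> = (gauss_sum r J a t)"
    by (simp only: ift_gauss_weight[OF r])
  finally show ?thesis .
qed

lemma gram_quadratic_form:
  assumes r: "r > 0"
  shows "(\<integral>u. complex_of_real (gauss_weight r u) * trig_sum x J a u * cnj (trig_sum x K c u) \<partial>lborel)
    = (\<Sum>i\<in>K. (gram_sum r J a i) * cnj (c i))"
proof -
  have "(\<integral>u. complex_of_real (gauss_weight r u) * trig_sum x J a u * cnj (trig_sum x K c u) \<partial>lborel)
    = (\<Sum>i\<in>K. cnj (c i) * ift (\<lambda>u. complex_of_real (gauss_weight r u) * trig_sum x J a u) (x i))"
    unfolding ift_def inner_real_def
    by (rule integral_mult_cnj_trig_sum) (intro integrable_mult_cis integrable_weight_trig_sum r, measurable)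
  then show ?thesis by (simp only: ift_weight_trig_sum[OF r] gram_def mult.commute)
qed

lemma gram_quadratic_form_real:
  assumes r: "r > 0"
  shows "(\<integral>u. gauss_weight r u * (cmod (trig_sum x J a u))\<^sup>2 \<partial>lborel)
    = Re (\<Sum>i\<in>J. (gram_sum r J a i) * cnj (a i))"
proof -
  have "complex_of_real (\<integral>u. gauss_weight r u * (cmod (trig_sum x J a u))\<^sup>2 \<partial>lborel)
    = (\<integral>u. complex_of_real (gauss_weight r u) * trig_sum x J a u * cnj (trig_sum x J a u) \<partial>lborel)"
    unfolding mult.assoc complex_norm_square[symmetric] of_real_mult[symmetric]
    by (rule integral_complex_of_real[symmetric])
  then show ?thesis unfolding gram_quadratic_form[OF r] by (metis Re_complex_of_real)
qed

lemma integrable_weight_trig_sum_sq: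
  assumes r: "r > 0"
  shows "integrable lborel (\<lambda>u. gauss_weight r u * (cmod (trig_sum x J a u))\<^sup>2)"
proof (rule Bochner_Integration.integrable_bound)
  show "integrable lborel (\<lambda>u. gauss_weight r u * (\<Sum>j\<in>J. cmod (a j))\<^sup>2)"
    by (intro integrable_mult_left integrable_gauss_weight r)
  show "AE u in lborel. norm (gauss_weight r u * (cmod (trig_sum x J a u))\<^sup>2)
    \<le> norm (gauss_weight r u * (\<Sum>j\<in>J. cmod (a j))\<^sup>2)"
    using norm_trig_sum_le gauss_weight_nonneg[OF r]
    by (intro AE_I2) (auto simp: abs_mult intro!: mult_left_mono power_mono)
qed measurable

text \<open>The weight decreases in |u|, so over the cell it is smallest at the endpoints, where it
  equals \<open>gauss_weight r pi\<close>.\<close>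

lemma cell_le_weighted:
  assumes r: "r > 0"
  shows "gauss_weight r pi * (sq_int cell (trig_sum x J a))
    \<le> (\<integral>u. gauss_weight r u * (cmod (trig_sum x J a u))\<^sup>2 \<partial>cell)"
proof -
  have int: "integrable cell (\<lambda>u. (cmod (trig_sum x J a u))\<^sup>2)"
    using square_integrable_trig_sum by (auto simp: square_integrable_def)
  have "(\<integral>u. gauss_weight r pi * (cmod (trig_sum x J a u))\<^sup>2 \<partial>cell)
    \<le> (\<integral>u. gauss_weight r u * (cmod (trig_sum x J a u))\<^sup>2 \<partial>cell)"
  proof (rule integral_mono)
    show "integrable cell (\<lambda>u. gauss_weight r pi * (cmod (trig_sum x J a u))\<^sup>2)"
      using int by simp
    show "integrable cell (\<lambda>u. gauss_weight r u * (cmod (trig_sum x J a u))\<^sup>2)"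
    proof (rule Bochner_Integration.integrable_bound[OF integrable_mult_right[OF int, of "gauss_weight r 0"]])
      show "AE u in cell. norm (gauss_weight r u * (cmod (trig_sum x J a u))\<^sup>2) \<le> norm (gauss_weight r 0 * (cmod (trig_sum x J a u))\<^sup>2)"
        using gauss_weight_nonneg[OF r] gauss_weight_mono[OF r, of 0]
        by (intro AE_I2) (auto simp: abs_mult intro!: mult_right_mono)
    qed measurable
    show "gauss_weight r pi * (cmod (trig_sum x J a u))\<^sup>2 \<le> gauss_weight r u * (cmod (trig_sum x J a u))\<^sup>2"
      if "u \<in> space cell" for u
      using that by (intro mult_right_mono gauss_weight_mono r) auto
  qed
  then show ?thesis by simp
qed

lemma cell_weighted_le_full:
  assumes r: "r > 0"
  shows "(\<integral>u. gauss_weight r u * (cmod (trig_sum x J a u))\<^sup>2 \<partial>cell)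
    \<le> (\<integral>u. gauss_weight r u * (cmod (trig_sum x J a u))\<^sup>2 \<partial>lborel)"
  unfolding integral_cell
proof (rule integral_mono)
  show "integrable lborel (\<lambda>u. indicator {-pi..pi} u *\<^sub>R (gauss_weight r u * (cmod (trig_sum x J a u))\<^sup>2))"
    by (intro integrable_mult_indicator integrable_weight_trig_sum_sq r) auto
qed (use gauss_weight_nonneg[OF r] in \<open>auto simp: indicator_def intro: integrable_weight_trig_sum_sq[OF r]\<close>)

text \<open>Positivity of the constant gives solvability for each \<open>r\<close>; its decay as
  \<open>r\<close> tends to 0 is the ill-conditioning that the uniform estimates have to
  offset.\<close>

lemma gram_coercive:
  assumes r: "r > 0" and J: "finite J"
  shows "gauss_weight r pi / B\<^sup>2 * (sq_sum a J)
    \<le> Re (\<Sum>i\<in>J. (gram_sum r J a i) * cnj (a i))"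
proof -
  have "gauss_weight r pi / B\<^sup>2 * (sq_sum a J)
    \<le> gauss_weight r pi / B\<^sup>2 * (B\<^sup>2 * (sq_int cell (trig_sum x J a)))"
    using gauss_weight_nonneg[OF r] by (intro mult_left_mono lower J) auto
  also have "\<dots> = gauss_weight r pi * (sq_int cell (trig_sum x J a))"
    using B_pos by simp
  also note cell_le_weighted[OF r]
  also note cell_weighted_le_full[OF r]
  finally show ?thesis unfolding gram_quadratic_form_real[OF r] .
qed

lemma coercive_gram:
  assumes r: "r > 0"
  obtains M where "coercive_matrix (gram r) M (gauss_weight r pi / B\<^sup>2)"
proof -
  obtain M where M: "\<And>i J. finite J \<Longrightarrow> (\<Sum>j\<in>J. gram r i j) \<le> M"
    using gram_row_bound[OF r] by blast
  have "coercive_matrix (gram r) M (gauss_weight r pi / B\<^sup>2)"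
  proof
    show "0 < gauss_weight r pi / B\<^sup>2" using gauss_weight_pos[OF r] B_pos by simp
    show "gram r i j = gram r j i" "0 \<le> gram r i j" for i j
      by (simp_all add: gram_def power2_commute)
    show "(\<Sum>j\<in>J. gram r i j) \<le> M" if "finite J" for i J using M[OF that] .
    show "gauss_weight r pi / B\<^sup>2 * (sq_sum a J)
      \<le> Re (\<Sum>i\<in>J. (gram_sum r J a i) * cnj (a i))"
      if "finite J" for J a by (rule gram_coercive[OF r that])
  qed
  then show thesis by (rule that)
qed

end

section \<open>Interpolation on the line\<close>

definition outer :: "(real \<Rightarrow> complex) \<Rightarrow> real \<Rightarrow> complex" where
  "outer f u = (if \<bar>u\<bar> \<le> pi then 0 else f u)"

lemma measurable_outer [measurable]:
  "f \<in> borel_measurable borel \<Longrightarrow> outer f \<in> borel_measurable borel"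
proof -
  assume [measurable]: "f \<in> borel_measurable borel"
  have "outer f = (\<lambda>u. if u \<in> {-pi..pi} then 0 else f u)" by (auto simp: outer_def fun_eq_iff)
  then show "outer f \<in> borel_measurable borel" by simp
qed

section \<open>Estimates on the line for finitely many coefficients, uniform in r \<le> 1\<close>

context riesz_nodes
begin

definition spectrum :: "real \<Rightarrow> int set \<Rightarrow> (int \<Rightarrow> complex) \<Rightarrow> real \<Rightarrow> complex" where
  "spectrum r J a u = complex_of_real (gauss_weight r u) * trig_sum x J a u"

lemma measurable_spectrum [measurable]: "spectrum r J a \<in> borel_measurable borel"
  unfolding spectrum_def[abs_def] by measurable

lemma integrable_spectrum: "r > 0 \<Longrightarrow> integrable lborel (spectrum r J a)"
  unfolding spectrum_def[abs_def] by (rule integrable_weight_trig_sum)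

lemma norm_spectrum_le:
  assumes "0 < r" "r \<le> 1"
  shows "cmod (spectrum r J a u) \<le> gauss_weight r 0 * (\<Sum>j\<in>J. cmod (a j)) * exp (- (1/4) * u\<^sup>2)"
proof -
  have "cmod (spectrum r J a u) = gauss_weight r u * cmod (trig_sum x J a u)"
    using gauss_weight_nonneg[OF assms(1)] by (simp add: spectrum_def norm_mult)
  also have "\<dots> \<le> (gauss_weight r 0 * exp (- (1/4) * u\<^sup>2)) * (\<Sum>j\<in>J. cmod (a j))"
    using gauss_weight_nonneg[OF assms(1)]
    by (intro mult_mono gauss_weight_le_exp assms norm_trig_sum_le) auto
  finally show ?thesis by (simp add: mult_ac)
qed

text \<open>Up to the factor sqrt (4 pi) the weight is \<open>gauss_weight 1\<close>, so the
  integral is the quadratic form of the Gram matrix for r = 1, which Schur's test bounds. In effect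
  the upper Riesz bound is extended from the cell to the whole line.\<close>

lemma gauss_energy_upper:
  obtains G where "G > 0"
    and "\<And>J a. finite J \<Longrightarrow> (\<integral>u. exp (- (1/4) * u\<^sup>2) * (cmod (trig_sum x J a u))\<^sup>2 \<partial>lborel) \<le> G * (sq_sum a J)"
proof -
  obtain M where "coercive_matrix (gram 1) M (gauss_weight 1 pi / B\<^sup>2)"
    using coercive_gram[of 1] by auto
  then interpret coercive_matrix "gram 1" M "gauss_weight 1 pi / B\<^sup>2" .
  have "(\<integral>u. exp (- (1/4) * u\<^sup>2) * (cmod (trig_sum x J a u))\<^sup>2 \<partial>lborel) \<le> sqrt (4 * pi) * M * (sq_sum a J)"
    if J: "finite J" for J a
  proof -
    let ?S = "\<Sum>j\<in>J. (cmod (a j))\<^sup>2"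
    let ?b = "\<lambda>i. \<Sum>j\<in>J. a j * complex_of_real (gram 1 i j)"
    have "(\<integral>u. gauss_weight 1 u * (cmod (trig_sum x J a u))\<^sup>2 \<partial>lborel) = Re (\<Sum>i\<in>J. ?b i * cnj (a i))"
      by (rule gram_quadratic_form_real) simp
    also have "\<dots> \<le> cmod (\<Sum>i\<in>J. ?b i * cnj (a i))" by (rule complex_Re_le_cmod)
    also have "\<dots> \<le> sqrt (\<Sum>i\<in>J. (cmod (?b i))\<^sup>2) * sqrt (\<Sum>i\<in>J. (cmod (cnj (a i)))\<^sup>2)"
      by (rule Cauchy_Schwarz_sum_complex)
    also have "\<dots> \<le> sqrt (M\<^sup>2 * ?S) * sqrt ?S"
      using Schur_finite[OF J J, of a] by (intro mult_mono) (auto intro!: sum_nonneg mult_nonneg_nonneg)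
    also have "\<dots> = M * ?S" using M_pos by (simp add: real_sqrt_mult sum_nonneg)
    finally have "sqrt (4 * pi) * (\<integral>u. gauss_weight 1 u * (cmod (trig_sum x J a u))\<^sup>2 \<partial>lborel) \<le> sqrt (4 * pi) * (M * ?S)"
      by (rule mult_left_mono) simp
    moreover have "(\<integral>u. exp (- (1/4) * u\<^sup>2) * (cmod (trig_sum x J a u))\<^sup>2 \<partial>lborel)
      = sqrt (4 * pi) * (\<integral>u. gauss_weight 1 u * (cmod (trig_sum x J a u))\<^sup>2 \<partial>lborel)"
      unfolding exp_eq_gauss_weight mult.assoc by (rule integral_mult_right_zero)
    ultimately show ?thesis by (simp only: mult.assoc)
  qed
  moreover have "sqrt (4 * pi) * M > 0" using M_pos by simp
  ultimately show thesis using that by blast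
qed

lemma integrable_gauss_trig_sum_sq:
  "integrable lborel (\<lambda>u. exp (- (1/4) * u\<^sup>2) * (cmod (trig_sum x J a u))\<^sup>2)"
  by (rule integrable_gauss_dominated[where K = "(\<Sum>j\<in>J. cmod (a j))\<^sup>2"], measurable)
     (simp add: mult.commute mult_left_mono power_mono norm_trig_sum_le)

text \<open>Squaring the decay estimate produces exp (- u^2 / 2). Half of this exponent pays for the
  weight exp (u^2 / 4), the other half remains as the Gaussian for which an upper bound is
  available.\<close>

lemma outer_spectrum_pointwise:
  assumes r: "0 < r" "r \<le> 1"
  shows "exp (u\<^sup>2 / 4) * (cmod (outer (spectrum r J a) u))\<^sup>2
    \<le> (gauss_weight r pi)\<^sup>2 * exp (pi\<^sup>2 / 2) * (exp (- (1/4) * u\<^sup>2) * (cmod (trig_sum x J a u))\<^sup>2)"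
proof (cases "\<bar>u\<bar> \<le> pi")
  case False
  let ?p = "gauss_weight r pi"
  have "(gauss_weight r u)\<^sup>2 \<le> (?p * exp (pi\<^sup>2 / 4) * exp (- (1/4) * u\<^sup>2))\<^sup>2"
    using False gauss_weight_nonneg[OF r(1)] by (intro power_mono gauss_weight_ratio_le r) auto
  also have "\<dots> = ?p\<^sup>2 * exp (pi\<^sup>2 / 2) * exp (- (1/2) * u\<^sup>2)"
    by (simp add: power_mult_distrib exp_double[symmetric])
  finally have "exp (u\<^sup>2 / 4) * (gauss_weight r u)\<^sup>2 \<le> exp (u\<^sup>2 / 4) * (?p\<^sup>2 * exp (pi\<^sup>2 / 2) * exp (- (1/2) * u\<^sup>2))"
    by (rule mult_left_mono) simp
  also have "\<dots> = ?p\<^sup>2 * exp (pi\<^sup>2 / 2) * (exp (u\<^sup>2 / 4) * exp (- (1/2) * u\<^sup>2))" by (simp only: mult_ac)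
  also have "exp (u\<^sup>2 / 4) * exp (- (1/2) * u\<^sup>2) = exp (- (1/4) * u\<^sup>2)"
    unfolding exp_add[symmetric] by simp
  finally have "exp (u\<^sup>2 / 4) * (gauss_weight r u)\<^sup>2 * (cmod (trig_sum x J a u))\<^sup>2
    \<le> ?p\<^sup>2 * exp (pi\<^sup>2 / 2) * exp (- (1/4) * u\<^sup>2) * (cmod (trig_sum x J a u))\<^sup>2"
    by (rule mult_right_mono) simp
  then show ?thesis using False gauss_weight_nonneg[OF r(1)]
    by (simp add: outer_def spectrum_def norm_mult power_mult_distrib mult.assoc)
qed (simp add: outer_def)

lemma integrable_outer_spectrum_sq:
  assumes r: "0 < r" "r \<le> 1"
  shows "integrable lborel (\<lambda>u. exp (u\<^sup>2 / 4) * (cmod (outer (spectrum r J a) u))\<^sup>2)"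
proof (rule Bochner_Integration.integrable_bound[OF integrable_mult_right[OF integrable_gauss_trig_sum_sq]])
  show "AE u in lborel. norm (exp (u\<^sup>2 / 4) * (cmod (outer (spectrum r J a) u))\<^sup>2)
    \<le> norm (((gauss_weight r pi)\<^sup>2 * exp (pi\<^sup>2 / 2)) * (exp (- (1/4) * u\<^sup>2) * (cmod (trig_sum x J a u))\<^sup>2))"
  proof (rule AE_I2)
    fix u
    have "0 \<le> exp (u\<^sup>2 / 4) * (cmod (outer (spectrum r J a) u))\<^sup>2" by simp
    with outer_spectrum_pointwise[OF r, of u J a]
    show "norm (exp (u\<^sup>2 / 4) * (cmod (outer (spectrum r J a) u))\<^sup>2)
      \<le> norm (((gauss_weight r pi)\<^sup>2 * exp (pi\<^sup>2 / 2)) * (exp (- (1/4) * u\<^sup>2) * (cmod (trig_sum x J a u))\<^sup>2))"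
      unfolding real_norm_def by linarith
  qed
qed measurable

lemma outer_energy:
  assumes r: "0 < r" "r \<le> 1" and J: "finite J"
    and G: "\<And>J a. finite J \<Longrightarrow> (\<integral>u. exp (- (1/4) * u\<^sup>2) * (cmod (trig_sum x J a u))\<^sup>2 \<partial>lborel) \<le> G * (sq_sum a J)"
  shows "(\<integral>u. exp (u\<^sup>2 / 4) * (cmod (outer (spectrum r J a) u))\<^sup>2 \<partial>lborel)
    \<le> exp (pi\<^sup>2 / 2) * G * ((gauss_weight r pi)\<^sup>2 * (sq_sum a J))"
proof -
  let ?c = "(gauss_weight r pi)\<^sup>2 * exp (pi\<^sup>2 / 2)"
  have "(\<integral>u. exp (u\<^sup>2 / 4) * (cmod (outer (spectrum r J a) u))\<^sup>2 \<partial>lborel)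
    \<le> (\<integral>u. ?c * (exp (- (1/4) * u\<^sup>2) * (cmod (trig_sum x J a u))\<^sup>2) \<partial>lborel)"
    by (intro integral_mono integrable_outer_spectrum_sq r integrable_mult_right
        integrable_gauss_trig_sum_sq outer_spectrum_pointwise)
  also have "\<dots> = ?c * (\<integral>u. exp (- (1/4) * u\<^sup>2) * (cmod (trig_sum x J a u))\<^sup>2 \<partial>lborel)"
    by (rule integral_mult_right_zero)
  also have "\<dots> \<le> ?c * (G * (sq_sum a J))"
    by (intro mult_left_mono G J) simp
  finally show ?thesis by (simp only: mult_ac)
qed

text \<open>The moments are paired with their own trigonometric sum. Splitting 1 into exp (u^2 / 8)
  and exp (- u^2 / 8) before Cauchy--Schwarz leaves the weighted outer energy in one factor and the
  Gaussian upper bound in the other; one factor \<open>S\<close> then cancels.\<close>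

lemma outer_moments:
  assumes r: "0 < r" "r \<le> 1" and J: "finite J" and "G > 0"
    and G: "\<And>J a. finite J \<Longrightarrow> (\<integral>u. exp (- (1/4) * u\<^sup>2) * (cmod (trig_sum x J a u))\<^sup>2 \<partial>lborel) \<le> G * (sq_sum a J)"
    and W: "(\<integral>u. exp (u\<^sup>2 / 4) * (cmod (outer (spectrum r J a) u))\<^sup>2 \<partial>lborel) \<le> W"
  shows "l2_le (\<lambda>m. \<integral>u. outer (spectrum r J a) u * cis (x m * u) \<partial>lborel) (W * G)"
  unfolding l2_le_def
proof (intro allI impI)
  fix K :: "int set" assume K: "finite K"
  let ?o = "outer (spectrum r J a)"
  define c where "c m = (\<integral>u. ?o u * cis (x m * u) \<partial>lborel)" for m
  define S where "S = (sq_sum c K)"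
  have S0: "0 \<le> S" unfolding S_def by (intro sum_nonneg) auto
  have int_o: "integrable lborel ?o"
    by (rule Bochner_Integration.integrable_bound[OF integrable_spectrum[OF r(1), of J a]])
       (measurable, auto simp: outer_def)
  have "complex_of_real S = (\<Sum>m\<in>K. cnj (c m) * c m)"
    unfolding S_def by (simp add: complex_norm_square mult.commute del: of_real_power)
  also have "\<dots> = (\<integral>u. ?o u * cnj (trig_sum x K c u) \<partial>lborel)"
    unfolding c_def by (rule integral_mult_cnj_trig_sum[symmetric]) (intro integrable_mult_cis int_o, measurable)
  also have "\<dots> = (\<integral>u. (complex_of_real (exp (u\<^sup>2 / 8)) * ?o u) * (complex_of_real (exp (- (u\<^sup>2 / 8))) * cnj (trig_sum x K c u)) \<partial>lborel)"
  proof -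
    have *: "complex_of_real (exp (u\<^sup>2 / 8)) * complex_of_real (exp (- (u\<^sup>2 / 8))) = 1" for u :: real
      unfolding of_real_mult[symmetric] exp_add[symmetric] by simp
    have "(complex_of_real (exp (u\<^sup>2 / 8)) * ?o u) * (complex_of_real (exp (- (u\<^sup>2 / 8))) * cnj (trig_sum x K c u))
      = ?o u * cnj (trig_sum x K c u)" for u
    proof -
      have "(complex_of_real (exp (u\<^sup>2 / 8)) * ?o u) * (complex_of_real (exp (- (u\<^sup>2 / 8))) * cnj (trig_sum x K c u))
        = (complex_of_real (exp (u\<^sup>2 / 8)) * complex_of_real (exp (- (u\<^sup>2 / 8)))) * (?o u * cnj (trig_sum x K c u))"
        by (simp only: mult_ac)
      then show ?thesis unfolding * by simp
    qed
    then show ?thesis by (simp only:)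
  qed
  finally have eq: "complex_of_real S = \<dots>" .
  have e1: "(cmod (complex_of_real (exp (u\<^sup>2 / 8)) * ?o u))\<^sup>2 = exp (u\<^sup>2 / 4) * (cmod (?o u))\<^sup>2" for u
    by (simp add: norm_mult power_mult_distrib exp_double[symmetric])
  have e2: "(cmod (complex_of_real (exp (- (u\<^sup>2 / 8))) * cnj (trig_sum x K c u)))\<^sup>2
    = exp (- (1/4) * u\<^sup>2) * (cmod (trig_sum x K c u))\<^sup>2" for u
    by (simp add: norm_mult power_mult_distrib exp_double[symmetric])
  have sq1: "square_integrable lborel (\<lambda>u. complex_of_real (exp (u\<^sup>2 / 8)) * ?o u)"
    unfolding square_integrable_def e1 by (intro conjI integrable_outer_spectrum_sq r) measurable
  have sq2: "square_integrable lborel (\<lambda>u. complex_of_real (exp (- (u\<^sup>2 / 8))) * cnj (trig_sum x K c u))"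
    unfolding square_integrable_def e2 by (intro conjI integrable_gauss_trig_sum_sq) measurable
  have "S\<^sup>2 = (cmod (complex_of_real S))\<^sup>2" by simp
  also have "\<dots> \<le> (\<integral>u. exp (u\<^sup>2 / 4) * (cmod (?o u))\<^sup>2 \<partial>lborel) * (\<integral>u. exp (- (1/4) * u\<^sup>2) * (cmod (trig_sum x K c u))\<^sup>2 \<partial>lborel)"
    unfolding eq using Cauchy_Schwarz_integral(2)[OF sq1 sq2] unfolding e1 e2 .
  also have "\<dots> \<le> W * (G * S)"
    unfolding S_def
  proof (intro mult_mono W G K)
    show "0 \<le> W" by (rule order_trans[OF _ W]) (intro integral_nonneg_AE, auto)
  qed (intro integral_nonneg_AE, auto)
  finally have "S * S \<le> (W * G) * S" by (simp add: power2_eq_square mult_ac)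
  moreover have "0 \<le> W * G"
    using \<open>G > 0\<close> by (intro mult_nonneg_nonneg order_trans[OF _ W] integral_nonneg_AE) auto
  ultimately have "S \<le> W * G"
    using S0 by (cases "S = 0") (auto simp: mult_le_cancel_right)
  then show "(\<Sum>m\<in>K. (cmod (\<integral>u. ?o u * cis (x m * u) \<partial>lborel))\<^sup>2) \<le> W * G"
    by (simp add: S_def c_def)
qed

text \<open>The discrete problem is tested against \<open>a\<close> itself: positivity of the quadratic form bounds the
  part of the spectrum inside the band, whose conditioning \<open>1 / gauss_weight r pi\<close> is then exactly
  compensated by the size \<open>gauss_weight r pi\<close> of the weight outside.\<close>

lemma coefficient_bound:
  assumes r: "0 < r" and \<beta>: "0 \<le> \<beta>" "\<beta> \<le> pi" and J: "finite J"
    and [measurable]: "h \<in> borel_measurable borel" and h_bnd: "\<And>u. cmod (h u) \<le> H"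
    and h_supp: "\<And>u. \<beta> < \<bar>u\<bar> \<Longrightarrow> h u = 0"
    and R: "l2_le (\<lambda>m. (gram_sum r J a m) - (\<integral>u. h u * cis (x m * u) \<partial>lborel)) R"
  shows "(gauss_weight r pi)\<^sup>2 * (sq_sum a J)
    \<le> (2 * B\<^sup>2 + 2 * (B\<^sup>2)\<^sup>2) * (gauss_weight r pi / gauss_weight r \<beta> * (sq_int lborel h) + R)"
proof -
  define p where "p = gauss_weight r pi"
  define b where "b = gauss_weight r \<beta>"
  define N where "N = (sq_sum a J)"
  define E where "E = (sq_int lborel h)"
  define X where "X = (\<integral>u. gauss_weight r u * (cmod (trig_sum x J a u))\<^sup>2 \<partial>cell)"
  have p: "p > 0" and b: "b > 0" using gauss_weight_pos[OF r] by (auto simp: p_def b_def)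
  have N0: "0 \<le> N" and E0: "0 \<le> E" and X0: "0 \<le> X" and R0: "0 \<le> R"
    using l2_le_nonneg[OF R] gauss_weight_nonneg[OF r]
    by (auto simp: N_def E_def X_def intro!: sum_nonneg integral_nonneg_AE)
  have h_dom: "cmod (h u) \<le> (H * exp (pi\<^sup>2 / 4)) * exp (- (1/4) * u\<^sup>2)" for u
  proof (cases "\<beta> < \<bar>u\<bar>")
    case True
    then show ?thesis using h_supp[OF True] h_bnd[of u] by simp
  next
    case False
    then have "u\<^sup>2 \<le> pi\<^sup>2" using \<beta> by (simp add: abs_le_square_iff[symmetric])
    then have "1 \<le> exp (pi\<^sup>2 / 4) * exp (- (1/4) * u\<^sup>2)" unfolding exp_add[symmetric] by simp
    moreover have "0 \<le> H" using h_bnd[of 0] norm_ge_zero order_trans by blast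
    ultimately have "H * 1 \<le> H * (exp (pi\<^sup>2 / 4) * exp (- (1/4) * u\<^sup>2))" by (intro mult_left_mono)
    then show ?thesis using h_bnd[of u] by (simp add: mult.assoc)
  qed
  have h_int: "integrable lborel h" by (rule integrable_gauss_dominated[OF _ h_dom]) measurable
  have h_sq: "square_integrable lborel h"
    unfolding square_integrable_def
  proof
    show "integrable lborel (\<lambda>t. (cmod (h t))\<^sup>2)"
    proof (rule Bochner_Integration.integrable_bound[OF integrable_mult_right[OF h_int, of "complex_of_real H"]])
      show "AE u in lborel. norm ((cmod (h u))\<^sup>2) \<le> norm (complex_of_real H * h u)"
        using h_bnd order_trans[OF norm_ge_zero h_bnd] 
        by (intro AE_I2) (simp add: norm_mult power2_eq_square mult_right_mono)
    qed measurable
  qed measurable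
  have 1: "p * N \<le> B\<^sup>2 * X"
  proof -
    have "p * N \<le> p * (B\<^sup>2 * (sq_int cell (trig_sum x J a)))"
      unfolding N_def using p by (intro mult_left_mono lower J) auto
    also have "\<dots> = B\<^sup>2 * (p * (sq_int cell (trig_sum x J a)))" by (simp only: mult_ac)
    also have "\<dots> \<le> B\<^sup>2 * X"
      unfolding p_def X_def by (intro mult_left_mono cell_le_weighted r) simp
    finally show ?thesis .
  qed
  define f where "f m = (\<integral>u. h u * cis (x m * u) \<partial>lborel)" for m
  define d where "d m = (gram_sum r J a m) - f m" for m
  have d: "(sq_sum d J) \<le> R" using l2_leD[OF R J] by (simp add: d_def f_def)
  let ?U = "cmod (\<Sum>m\<in>J. f m * cnj (a m))" and ?V = "cmod (\<Sum>m\<in>J. d m * cnj (a m))"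
  have "X \<le> Re (\<Sum>i\<in>J. (gram_sum r J a i) * cnj (a i))"
    unfolding X_def gram_quadratic_form_real[OF r, symmetric] by (rule cell_weighted_le_full[OF r])
  also have "\<dots> \<le> cmod (\<Sum>i\<in>J. (gram_sum r J a i) * cnj (a i))"
    by (rule complex_Re_le_cmod)
  also have "(\<Sum>i\<in>J. (gram_sum r J a i) * cnj (a i))
    = (\<Sum>m\<in>J. f m * cnj (a m)) + (\<Sum>m\<in>J. d m * cnj (a m))"
    by (simp add: d_def sum.distrib[symmetric] algebra_simps)
  also have "cmod \<dots> \<le> ?U + ?V" by (rule norm_triangle_ineq)
  finally have X_le: "X \<le> ?U + ?V" .
  \<comment> \<open>The residual \<open>d\<close> is tested against \<open>a\<close>, whose energy
    \<open>N\<close> is in turn at most B^2 X / p by inequality \<open>1\<close>.\<close>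
  have V: "?V\<^sup>2 \<le> R * (B\<^sup>2 * X / p)"
  proof -
    have "?V \<le> sqrt (sq_sum d J) * sqrt (\<Sum>m\<in>J. (cmod (cnj (a m)))\<^sup>2)"
      by (rule Cauchy_Schwarz_sum_complex)
    also have "\<dots> \<le> sqrt R * sqrt N"
      using d by (intro mult_mono) (auto simp: N_def R0 sum_nonneg)
    finally have "?V\<^sup>2 \<le> (sqrt R * sqrt N)\<^sup>2" by (intro power_mono) auto
    also have "\<dots> = R * N" using R0 N0 by (simp add: power_mult_distrib)
    also have "\<dots> \<le> R * (B\<^sup>2 * X / p)"
      using 1 p R0 by (intro mult_left_mono) (auto simp: field_simps)
    finally show ?thesis .
  qed
  have U: "?U\<^sup>2 \<le> E * (X / b)"
  proof -
    \<comment> \<open>On the support of \<open>h\<close> the weight is at least \<open>b\<close>, so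
      the sum cut off to [-\<beta>, \<beta>] has energy at most X / b. This is where a narrower
      spectrum gains.\<close>
    define g where "g u = (if \<bar>u\<bar> \<le> \<beta> then cnj (trig_sum x J a u) else 0)" for u
    have "g = (\<lambda>u. if u \<in> {-\<beta>..\<beta>} then cnj (trig_sum x J a u) else 0)" by (auto simp: g_def fun_eq_iff)
    then have [measurable]: "g \<in> borel_measurable borel" by simp
    have "(\<Sum>m\<in>J. f m * cnj (a m)) = (\<integral>u. h u * cnj (trig_sum x J a u) \<partial>lborel)"
      unfolding f_def by (subst integral_mult_cnj_trig_sum) (auto intro!: integrable_mult_cis h_int simp: mult.commute)
    also have "\<dots> = (\<integral>u. h u * g u \<partial>lborel)"
      by (intro Bochner_Integration.integral_cong refl) (auto simp: g_def h_supp)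
    finally have eq: "(\<Sum>m\<in>J. f m * cnj (a m)) = (\<integral>u. h u * g u \<partial>lborel)" .
    have g_le: "b * (cmod (g u))\<^sup>2 \<le> indicator {-pi..pi} u *\<^sub>R (gauss_weight r u * (cmod (trig_sum x J a u))\<^sup>2)" for u
    proof (cases "\<bar>u\<bar> \<le> \<beta>")
      case True
      have "b \<le> gauss_weight r u" unfolding b_def by (rule gauss_weight_mono[OF r]) (use True in auto)
      moreover have "u \<in> {-pi..pi}" using True \<beta> by auto
      ultimately show ?thesis using True by (simp add: g_def mult_right_mono)
    next
      case False
      then show ?thesis using gauss_weight_nonneg[OF r] by (simp add: g_def indicator_def)
    qed
    have int_c: "integrable lborel (\<lambda>u. indicator {-pi..pi} u *\<^sub>R (gauss_weight r u * (cmod (trig_sum x J a u))\<^sup>2))"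
      by (intro integrable_mult_indicator integrable_weight_trig_sum_sq r) auto
    have int_g: "integrable lborel (\<lambda>u. b * (cmod (g u))\<^sup>2)"
    proof (rule Bochner_Integration.integrable_bound[OF int_c])
      show "AE u in lborel. norm (b * (cmod (g u))\<^sup>2) \<le> norm (indicator {-pi..pi} u *\<^sub>R (gauss_weight r u * (cmod (trig_sum x J a u))\<^sup>2))"
      proof (rule AE_I2)
        fix u
        have "0 \<le> b * (cmod (g u))\<^sup>2" using b by simp
        then show "norm (b * (cmod (g u))\<^sup>2) \<le> norm (indicator {-pi..pi} u *\<^sub>R (gauss_weight r u * (cmod (trig_sum x J a u))\<^sup>2))"
          using g_le[of u] by (simp only: real_norm_def)
      qed
    qed measurable
    then have g_sq: "square_integrable lborel g"
      using b unfolding square_integrable_def by simp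
    have "b * (sq_int lborel g) = (\<integral>u. b * (cmod (g u))\<^sup>2 \<partial>lborel)" by simp
    also have "\<dots> \<le> X" unfolding X_def integral_cell by (intro integral_mono int_g int_c g_le)
    finally have "(sq_int lborel g) \<le> X / b" using b by (simp add: field_simps)
    then have "E * (sq_int lborel g) \<le> E * (X / b)" using E0 by (rule mult_left_mono)
    then show ?thesis
      unfolding eq using Cauchy_Schwarz_integral(2)[OF h_sq g_sq] by (simp only: E_def) 
  qed
  have "X\<^sup>2 \<le> (?U + ?V)\<^sup>2" using X_le X0 by (intro power_mono)
  also have "\<dots> \<le> 2 * ?U\<^sup>2 + 2 * ?V\<^sup>2"
    using zero_le_power2[of "?U - ?V"] by (simp add: power2_sum power2_diff)
  also have "\<dots> \<le> 2 * (E * (X / b)) + 2 * (R * (B\<^sup>2 * X / p))" using U V by simp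
  also have "\<dots> = X * (2 * E / b + 2 * R * B\<^sup>2 / p)" by (simp add: field_simps)
  finally have "X * X \<le> X * (2 * E / b + 2 * R * B\<^sup>2 / p)" by (simp only: power2_eq_square)
  moreover have "0 \<le> 2 * E / b + 2 * R * B\<^sup>2 / p" using E0 R0 b p by simp
  ultimately have X: "X \<le> 2 * E / b + 2 * R * B\<^sup>2 / p"
    using X0 by (cases "X = 0") (auto simp: mult_le_cancel_left)
  \<comment> \<open>One factor \<open>p\<close> converts \<open>N\<close> into \<open>X\<close>; the
    other multiplies the bound on \<open>X\<close>, cancelling the 1 / p at \<open>R\<close> and
    leaving p / b at \<open>E\<close>.\<close>
  have "p\<^sup>2 * N = p * (p * N)" by (simp add: power2_eq_square mult.assoc)
  also have "\<dots> \<le> p * (B\<^sup>2 * (2 * E / b + 2 * R * B\<^sup>2 / p))"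
    using p by (intro mult_left_mono order_trans[OF 1] X) auto
  also have "\<dots> = 2 * B\<^sup>2 * (p / b * E) + 2 * (B\<^sup>2)\<^sup>2 * R"
    using p b by (simp add: field_simps power2_eq_square)
  also have "\<dots> \<le> (2 * B\<^sup>2 + 2 * (B\<^sup>2)\<^sup>2) * (p / b * E) + (2 * B\<^sup>2 + 2 * (B\<^sup>2)\<^sup>2) * R"
    using p b E0 R0 by (intro add_mono mult_right_mono) auto
  finally show ?thesis by (simp add: p_def b_def N_def E_def distrib_left)
qed

text \<open>Outside the cell the error \<open>k\<close> is the outer spectrum, controlled by the
  coefficients. Inside, the moments of \<open>k\<close> are the data error minus the moments of the
  outer spectrum, and \<open>frame\<close> turns them into a bound of \<open>k\<close>. For \<beta>
  = pi the ratio of weights is 1 and only boundedness results; for \<beta> < pi the term in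
  \<open>h\<close> tends to 0 with \<open>r\<close>.\<close>

lemma spectrum_error:
  obtains C where "C > 0"
    and "\<And>r \<beta> J a h H R. 0 < r \<Longrightarrow> r \<le> 1 \<Longrightarrow> 0 \<le> \<beta> \<Longrightarrow> \<beta> \<le> pi \<Longrightarrow> finite J \<Longrightarrow>
      h \<in> borel_measurable borel \<Longrightarrow> (\<And>u. cmod (h u) \<le> H) \<Longrightarrow> (\<And>u. \<beta> < \<bar>u\<bar> \<Longrightarrow> h u = 0) \<Longrightarrow>
      l2_le (\<lambda>m. (gram_sum r J a m) - ift h (x m)) R \<Longrightarrow>
      integrable lborel (\<lambda>u. exp (u\<^sup>2 / 4) * (cmod (spectrum r J a u - h u))\<^sup>2) \<and>
      (\<integral>u. exp (u\<^sup>2 / 4) * (cmod (spectrum r J a u - h u))\<^sup>2 \<partial>lborel)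
        \<le> C * (gauss_weight r pi / gauss_weight r \<beta> * (sq_int lborel h) + R)"
proof -
  obtain G where G0: "G > 0"
    and G: "\<And>J a. finite J \<Longrightarrow> (\<integral>u. exp (- (1/4) * u\<^sup>2) * (cmod (trig_sum x J a u))\<^sup>2 \<partial>lborel) \<le> G * (sq_sum a J)"
    using gauss_energy_upper by blast
  define c where "c = 2 * B\<^sup>2 + 2 * (B\<^sup>2)\<^sup>2"
  define e where "e = exp (pi\<^sup>2 / 2) * G * c"
  \<comment> \<open>The first summand belongs to the cell, where exp (u^2 / 4) is at most exp (pi^2
    / 4) and \<open>frame\<close> applies; the second bounds the outer energy.\<close>
  define C where "C = exp (pi\<^sup>2 / 4) * (2 * B\<^sup>2 * (2 + 2 * (e * G))) + e"
  have c0: "c > 0" and e0: "e > 0" and C0: "C > 0"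
    using B_pos G0 by (auto simp: c_def e_def C_def intro!: add_pos_pos mult_pos_pos)
  have "integrable lborel (\<lambda>u. exp (u\<^sup>2 / 4) * (cmod (spectrum r J a u - h u))\<^sup>2) \<and>
      (\<integral>u. exp (u\<^sup>2 / 4) * (cmod (spectrum r J a u - h u))\<^sup>2 \<partial>lborel)
        \<le> C * (gauss_weight r pi / gauss_weight r \<beta> * (sq_int lborel h) + R)"
    if r: "0 < r" "r \<le> 1" and \<beta>: "0 \<le> \<beta>" "\<beta> \<le> pi" and J: "finite J"
      and h [measurable]: "h \<in> borel_measurable borel" and h_bnd: "\<And>u. cmod (h u) \<le> H"
      and h_supp: "\<And>u. \<beta> < \<bar>u\<bar> \<Longrightarrow> h u = 0"
      and R: "l2_le (\<lambda>m. (gram_sum r J a m) - ift h (x m)) R"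
    for r \<beta> J a h H R
  proof -
    define T where "T = gauss_weight r pi / gauss_weight r \<beta> * (sq_int lborel h) + R"
    define k where "k u = spectrum r J a u - h u" for u
    let ?o = "outer (spectrum r J a)"
    have [measurable]: "k \<in> borel_measurable borel" unfolding k_def[abs_def] by measurable
    have R0: "0 \<le> R" by (rule l2_le_nonneg[OF R])
    have RT: "R \<le> T"
      unfolding T_def using gauss_weight_nonneg[OF r(1)] by (auto intro!: mult_nonneg_nonneg integral_nonneg_AE)
    have "(gauss_weight r pi)\<^sup>2 * (sq_sum a J) \<le> c * T"
      unfolding c_def T_def
      by (rule coefficient_bound[OF r(1) \<beta> J h h_bnd h_supp R[unfolded ift_def inner_real_def]])
    then have *: "exp (pi\<^sup>2 / 2) * G * ((gauss_weight r pi)\<^sup>2 * (sq_sum a J)) \<le> exp (pi\<^sup>2 / 2) * G * (c * T)"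
      using G0 by (intro mult_left_mono) auto
    have W: "(\<integral>u. exp (u\<^sup>2 / 4) * (cmod (?o u))\<^sup>2 \<partial>lborel) \<le> e * T"
      using order_trans[OF outer_energy[OF r J G] *] by (simp only: e_def mult.assoc)
    have k_bnd: "cmod (k u) \<le> gauss_weight r 0 * (\<Sum>j\<in>J. cmod (a j)) + H" for u
    proof -
      have "cmod (spectrum r J a u) \<le> gauss_weight r 0 * (\<Sum>j\<in>J. cmod (a j)) * 1"
        using gauss_weight_nonneg[OF r(1)]
        by (intro order_trans[OF norm_spectrum_le[OF r]] mult_left_mono) (auto intro!: mult_nonneg_nonneg sum_nonneg)
      then show ?thesis
        using norm_triangle_ineq4[of "spectrum r J a u" "h u"] h_bnd[of u] by (simp add: k_def)
    qed
    have k_sq: "square_integrable cell k" by (rule square_integrable_cell_bounded[OF _ k_bnd]) measurable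
    have int_o: "integrable lborel ?o"
      by (rule Bochner_Integration.integrable_bound[OF integrable_spectrum[OF r(1), of J a]])
         (measurable, auto simp: outer_def)
    have h_int: "integrable lborel h"
    proof (rule Bochner_Integration.integrable_bound)
      show "integrable lborel (\<lambda>u. indicator {-pi..pi} u *\<^sub>R H)" by simp
      show "AE u in lborel. norm (h u) \<le> norm (indicator {-pi..pi} u *\<^sub>R H)"
      proof (rule AE_I2)
        fix u
        show "norm (h u) \<le> norm (indicator {-pi..pi} u *\<^sub>R H)"
          using h_bnd[of u] h_supp[of u] \<beta> by (cases "u \<in> {-pi..pi}") auto
      qed
    qed measurable
    have mom: "(\<integral>u. k u * cis (x m * u) \<partial>cell)
      = ((gram_sum r J a m) - ift h (x m)) - (\<integral>u. ?o u * cis (x m * u) \<partial>lborel)" for m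
    proof -
      have "(\<integral>u. k u * cis (x m * u) \<partial>cell)
        = (\<integral>u. spectrum r J a u * cis (x m * u) - h u * cis (x m * u) - ?o u * cis (x m * u) \<partial>lborel)"
        unfolding integral_cell
      proof (rule Bochner_Integration.integral_cong[OF refl])
        fix u
        show "indicat_real {- pi..pi} u *\<^sub>R (k u * cis (x m * u))
          = spectrum r J a u * cis (x m * u) - h u * cis (x m * u) - ?o u * cis (x m * u)"
          using h_supp[of u] \<beta> by (cases "u \<in> {-pi..pi}") (auto simp: k_def outer_def algebra_simps)
      qed
      also have "\<dots> = (\<integral>u. spectrum r J a u * cis (x m * u) \<partial>lborel) - (\<integral>u. h u * cis (x m * u) \<partial>lborel)
        - (\<integral>u. ?o u * cis (x m * u) \<partial>lborel)"
      proof -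
        have i: "integrable lborel (\<lambda>u. spectrum r J a u * cis (x m * u))" "integrable lborel (\<lambda>u. h u * cis (x m * u))"
          "integrable lborel (\<lambda>u. ?o u * cis (x m * u))"
          by (intro integrable_mult_cis integrable_spectrum r int_o h_int, measurable)+
        show ?thesis by (simp add: Bochner_Integration.integral_diff i)
      qed
      also have "(\<integral>u. spectrum r J a u * cis (x m * u) \<partial>lborel) = (gram_sum r J a m)"
        using ift_weight_trig_sum[OF r(1), of J a "x m"] by (simp add: ift_def spectrum_def gram_def)
      finally show ?thesis by (simp add: ift_def)
    qed
    have "l2_le (\<lambda>m. \<integral>u. k u * cis (x m * u) \<partial>cell) (2 * R + 2 * (e * T * G))"
      unfolding mom by (intro l2_le_diff R outer_moments[OF r J G0 G W])
    then have cell_le: "(sq_int cell k) \<le> 2 * B\<^sup>2 * (2 * R + 2 * (e * T * G))"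
      by (intro frame k_sq) measurable
    have pw: "exp (u\<^sup>2 / 4) * (cmod (k u))\<^sup>2 \<le> indicator {-pi..pi} u *\<^sub>R (exp (pi\<^sup>2 / 4) * (cmod (k u))\<^sup>2)
      + exp (u\<^sup>2 / 4) * (cmod (?o u))\<^sup>2" for u
    proof (cases "u \<in> {-pi..pi}")
      case True
      then have "\<bar>u\<bar> \<le> \<bar>pi\<bar>" by auto
      then have "u\<^sup>2 \<le> pi\<^sup>2" by (simp only: abs_le_square_iff)
      then have "exp (u\<^sup>2 / 4) \<le> exp (pi\<^sup>2 / 4)" by simp
      then have "exp (u\<^sup>2 / 4) * (cmod (k u))\<^sup>2 \<le> exp (pi\<^sup>2 / 4) * (cmod (k u))\<^sup>2" by (rule mult_right_mono) simp
      then show ?thesis using True by (auto simp: outer_def)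
    next
      case False
      then have "k u = ?o u" using h_supp[of u] \<beta> by (auto simp: k_def outer_def)
      then show ?thesis using False by simp
    qed
    have int_k: "integrable lborel (\<lambda>u. indicator {-pi..pi} u *\<^sub>R (exp (pi\<^sup>2 / 4) * (cmod (k u))\<^sup>2))"
    proof -
      have "integrable cell (\<lambda>u. exp (pi\<^sup>2 / 4) * (cmod (k u))\<^sup>2)"
        using k_sq by (simp add: square_integrable_def)
      then show ?thesis unfolding cell_def by (subst (asm) integrable_restrict_space) auto
    qed
    have int_sum: "integrable lborel (\<lambda>u. indicator {-pi..pi} u *\<^sub>R (exp (pi\<^sup>2 / 4) * (cmod (k u))\<^sup>2)
      + exp (u\<^sup>2 / 4) * (cmod (?o u))\<^sup>2)"
      by (intro Bochner_Integration.integrable_add int_k integrable_outer_spectrum_sq r)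
    have int_full: "integrable lborel (\<lambda>u. exp (u\<^sup>2 / 4) * (cmod (k u))\<^sup>2)"
    proof (rule Bochner_Integration.integrable_bound[OF int_sum])
      show "AE u in lborel. norm (exp (u\<^sup>2 / 4) * (cmod (k u))\<^sup>2)
        \<le> norm (indicator {-pi..pi} u *\<^sub>R (exp (pi\<^sup>2 / 4) * (cmod (k u))\<^sup>2) + exp (u\<^sup>2 / 4) * (cmod (?o u))\<^sup>2)"
      proof (rule AE_I2)
        fix u
        have "0 \<le> exp (u\<^sup>2 / 4) * (cmod (k u))\<^sup>2" by simp
        with pw[of u] show "norm (exp (u\<^sup>2 / 4) * (cmod (k u))\<^sup>2)
          \<le> norm (indicator {-pi..pi} u *\<^sub>R (exp (pi\<^sup>2 / 4) * (cmod (k u))\<^sup>2) + exp (u\<^sup>2 / 4) * (cmod (?o u))\<^sup>2)"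
          unfolding real_norm_def by linarith
      qed
    qed measurable
    have "(\<integral>u. exp (u\<^sup>2 / 4) * (cmod (k u))\<^sup>2 \<partial>lborel)
      \<le> (\<integral>u. indicator {-pi..pi} u *\<^sub>R (exp (pi\<^sup>2 / 4) * (cmod (k u))\<^sup>2) + exp (u\<^sup>2 / 4) * (cmod (?o u))\<^sup>2 \<partial>lborel)"
      by (intro integral_mono int_full int_sum pw)
    also have "\<dots> = (\<integral>u. exp (pi\<^sup>2 / 4) * (cmod (k u))\<^sup>2 \<partial>cell) + (\<integral>u. exp (u\<^sup>2 / 4) * (cmod (?o u))\<^sup>2 \<partial>lborel)"
      unfolding integral_cell by (intro Bochner_Integration.integral_add int_k integrable_outer_spectrum_sq r)
    also have "\<dots> \<le> exp (pi\<^sup>2 / 4) * (2 * B\<^sup>2 * (2 * R + 2 * (e * T * G))) + e * T"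
      using cell_le W by (intro add_mono) auto
    also have "\<dots> \<le> exp (pi\<^sup>2 / 4) * (2 * B\<^sup>2 * (2 * T + 2 * (e * T * G))) + e * T"
      using RT by (intro add_right_mono mult_left_mono) auto
    also have "\<dots> = C * T" by (simp add: C_def algebra_simps)
    finally show ?thesis using int_full by (simp add: k_def T_def)
  qed
  with C0 that show thesis by blast
qed

text \<open>The weight exp (u^2 / 4) is at least 1, so Plancherel gives the energy estimate.
  Cauchy--Schwarz against exp (- u^2 / 4), whose integral sqrt (4 pi) is at most 2 pi, gives the
  pointwise estimate with the same constant.\<close>

lemma interpolant_error_finite:
  obtains C where "C > 0"
    and "\<And>r \<beta> J a h H R t. 0 < r \<Longrightarrow> r \<le> 1 \<Longrightarrow> 0 \<le> \<beta> \<Longrightarrow> \<beta> \<le> pi \<Longrightarrow> finite J \<Longrightarrow>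
      h \<in> borel_measurable borel \<Longrightarrow> (\<And>u. cmod (h u) \<le> H) \<Longrightarrow> (\<And>u. \<beta> < \<bar>u\<bar> \<Longrightarrow> h u = 0) \<Longrightarrow>
      l2_le (\<lambda>m. (gram_sum r J a m) - ift h (x m)) R \<Longrightarrow>
      (cmod ((gauss_sum r J a t) - ift h t))\<^sup>2
        \<le> C * (gauss_weight r pi / gauss_weight r \<beta> * (sq_int lborel h) + R) \<and>
      energy lborel (\<lambda>t. (gauss_sum r J a t) - ift h t)
        \<le> ennreal (C * (gauss_weight r pi / gauss_weight r \<beta> * (sq_int lborel h) + R))"
proof -
  obtain C where C0: "C > 0" and C: "\<And>r \<beta> J a h H R. 0 < r \<Longrightarrow> r \<le> 1 \<Longrightarrow> 0 \<le> \<beta> \<Longrightarrow> \<beta> \<le> pi \<Longrightarrow> finite J \<Longrightarrow>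
      h \<in> borel_measurable borel \<Longrightarrow> (\<And>u. cmod (h u) \<le> H) \<Longrightarrow> (\<And>u. \<beta> < \<bar>u\<bar> \<Longrightarrow> h u = 0) \<Longrightarrow>
      l2_le (\<lambda>m. (gram_sum r J a m) - ift h (x m)) R \<Longrightarrow>
      integrable lborel (\<lambda>u. exp (u\<^sup>2 / 4) * (cmod (spectrum r J a u - h u))\<^sup>2) \<and>
      (\<integral>u. exp (u\<^sup>2 / 4) * (cmod (spectrum r J a u - h u))\<^sup>2 \<partial>lborel)
        \<le> C * (gauss_weight r pi / gauss_weight r \<beta> * (sq_int lborel h) + R)"
    using spectrum_error by blast
  define D where "D = 2 * pi * C"
  have D0: "D > 0" using C0 by (simp add: D_def)
  have "(cmod ((gauss_sum r J a t) - ift h t))\<^sup>2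
        \<le> D * (gauss_weight r pi / gauss_weight r \<beta> * (sq_int lborel h) + R) \<and>
      energy lborel (\<lambda>t. (gauss_sum r J a t) - ift h t)
        \<le> ennreal (D * (gauss_weight r pi / gauss_weight r \<beta> * (sq_int lborel h) + R))"
    if r: "0 < r" "r \<le> 1" and \<beta>: "0 \<le> \<beta>" "\<beta> \<le> pi" and J: "finite J"
      and h [measurable]: "h \<in> borel_measurable borel" and h_bnd: "\<And>u. cmod (h u) \<le> H"
      and h_supp: "\<And>u. \<beta> < \<bar>u\<bar> \<Longrightarrow> h u = 0"
      and R: "l2_le (\<lambda>m. (gram_sum r J a m) - ift h (x m)) R"
    for r \<beta> J a h H R t
  proof -
    define T where "T = gauss_weight r pi / gauss_weight r \<beta> * (sq_int lborel h) + R"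
    have T0: "0 \<le> T"
      unfolding T_def using gauss_weight_nonneg[OF r(1)] l2_le_nonneg[OF R]
      by (auto intro!: add_nonneg_nonneg mult_nonneg_nonneg integral_nonneg_AE)
    define k where "k u = spectrum r J a u - h u" for u
    have [measurable]: "k \<in> borel_measurable borel" unfolding k_def[abs_def] by measurable
    have W: "integrable lborel (\<lambda>u. exp (u\<^sup>2 / 4) * (cmod (k u))\<^sup>2)"
        "(\<integral>u. exp (u\<^sup>2 / 4) * (cmod (k u))\<^sup>2 \<partial>lborel) \<le> C * T"
      unfolding k_def T_def using C[OF r \<beta> J h h_bnd h_supp R] by blast+
    have e1: "(cmod (complex_of_real (exp (u\<^sup>2 / 8)) * k u))\<^sup>2 = exp (u\<^sup>2 / 4) * (cmod (k u))\<^sup>2" for u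
      by (simp add: norm_mult power_mult_distrib exp_double[symmetric])
    have e2: "(cmod (complex_of_real (exp (- (u\<^sup>2 / 8))) * cis (t * u)))\<^sup>2 = exp (- (1/4) * u\<^sup>2)" for u t
      by (simp add: norm_mult power_mult_distrib exp_double[symmetric])
    have sq1: "square_integrable lborel (\<lambda>u. complex_of_real (exp (u\<^sup>2 / 8)) * k u)"
      unfolding square_integrable_def e1 using W(1) by (intro conjI) measurable
    have sq2: "square_integrable lborel (\<lambda>u. complex_of_real (exp (- (u\<^sup>2 / 8))) * cis (t * u))" for t
      unfolding square_integrable_def e2 by (rule conjI, measurable) (rule integrable_gauss, simp)
    have prod: "(complex_of_real (exp (u\<^sup>2 / 8)) * k u) * (complex_of_real (exp (- (u\<^sup>2 / 8))) * cis (t * u)) = k u * cis (t * u)" for u t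
    proof -
      have "complex_of_real (exp (u\<^sup>2 / 8)) * complex_of_real (exp (- (u\<^sup>2 / 8))) = 1"
        unfolding of_real_mult[symmetric] exp_add[symmetric] by simp
      moreover have "(complex_of_real (exp (u\<^sup>2 / 8)) * k u) * (complex_of_real (exp (- (u\<^sup>2 / 8))) * cis (t * u))
        = (complex_of_real (exp (u\<^sup>2 / 8)) * complex_of_real (exp (- (u\<^sup>2 / 8)))) * (k u * cis (t * u))"
        by (simp only: mult_ac)
      ultimately show ?thesis by simp
    qed
    have "integrable lborel (\<lambda>u. k u * cis (0 * u))"
      using Cauchy_Schwarz_integral(1)[OF sq1 sq2[of 0]] unfolding prod .
    then have k_int: "integrable lborel k" by simp
    have "integrable lborel (\<lambda>u. spectrum r J a u - k u)"
      by (intro Bochner_Integration.integrable_diff k_int integrable_spectrum r)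
    then have h_int: "integrable lborel h" by (simp add: k_def)
    have ift_k: "(gauss_sum r J a t) - ift h t = ift k t" for t
      unfolding k_def[abs_def] ift_diff[OF integrable_spectrum[OF r(1)] h_int]
      unfolding spectrum_def[abs_def] ift_weight_trig_sum[OF r(1)] ..
    have gauss_int: "(\<integral>u. exp (- (1/4) * u\<^sup>2) \<partial>lborel) \<le> 2 * pi"
    proof -
      have "(\<integral>u. exp (- (1/4) * u\<^sup>2) \<partial>lborel) = sqrt (4 * pi) * (\<integral>u. gauss_weight 1 u \<partial>lborel)"
        unfolding exp_eq_gauss_weight by (rule integral_mult_right_zero)
      also have "\<dots> = sqrt (4 * pi)" by (simp add: integral_gauss_weight)
      also have "\<dots> \<le> 2 * pi" using pi_ge_two by (intro real_le_lsqrt) (auto simp: power2_eq_square)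
      finally show ?thesis .
    qed
    have "(cmod (ift k t))\<^sup>2 \<le> (\<integral>u. exp (u\<^sup>2 / 4) * (cmod (k u))\<^sup>2 \<partial>lborel) * (\<integral>u. exp (- (1/4) * u\<^sup>2) \<partial>lborel)"
      using Cauchy_Schwarz_integral(2)[OF sq1 sq2[of t]] unfolding prod e1 e2 ift_def inner_real_def .
    also have "\<dots> \<le> (C * T) * (2 * pi)"
      using W gauss_int C0 T0 by (intro mult_mono) (auto intro!: integral_nonneg_AE)
    finally have pt: "(cmod (ift k t))\<^sup>2 \<le> D * T" by (simp add: D_def mult_ac)
    have k_sq: "energy lborel k \<le> ennreal (C * T)"
    proof -
      have "energy lborel k \<le> (\<integral>\<^sup>+u. ennreal (exp (u\<^sup>2 / 4) * (cmod (k u))\<^sup>2) \<partial>lborel)"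
        unfolding energy_def
      proof (rule nn_integral_mono, rule ennreal_leI)
        fix u :: real
        have "1 * (cmod (k u))\<^sup>2 \<le> exp (u\<^sup>2 / 4) * (cmod (k u))\<^sup>2" by (intro mult_right_mono) auto
        then show "(cmod (k u))\<^sup>2 \<le> exp (u\<^sup>2 / 4) * (cmod (k u))\<^sup>2" by simp
      qed
      also have "\<dots> = ennreal (\<integral>u. exp (u\<^sup>2 / 4) * (cmod (k u))\<^sup>2 \<partial>lborel)"
        by (intro nn_integral_eq_integral W) auto
      also have "\<dots> \<le> ennreal (C * T)" by (intro ennreal_leI W)
      finally show ?thesis .
    qed
    have "energy lborel (ift k) \<le> ennreal (2 * pi) * energy lborel k" by (rule Plancherel_le[OF k_int])
    also have "\<dots> \<le> ennreal (2 * pi) * ennreal (C * T)" by (intro mult_left_mono k_sq) simp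
    also have "\<dots> = ennreal (D * T)"
    proof -
      have "D * T = (2 * pi) * (C * T)" by (simp add: D_def)
      moreover have "0 \<le> C * T" using C0 T0 by simp
      ultimately show ?thesis by (simp only: ennreal_mult pi_ge_zero mult_nonneg_nonneg zero_le_numeral)
    qed
    finally show ?thesis using pt unfolding ift_k T_def by blast
  qed
  with D0 that show thesis by blast
qed

end

text \<open>Infinite sums converge along the net of finite sets, whereas Fatou works along a
  sequence. The sets \<open>J n\<close> are eventually larger than any finite set, and
  \<open>\<epsilon> n\<close> bounds the squared norm of the tail.\<close>

lemma l2_truncation:
  fixes a :: "'i::countable \<Rightarrow> complex"
  assumes a: "l2_le a R"
  obtains J :: "nat \<Rightarrow> 'i set" and \<epsilon> :: "nat \<Rightarrow> real"
  where "\<And>n. finite (J n)" "filterlim J (finite_subsets_at_top UNIV) sequentially"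
    "\<epsilon> \<longlonglongrightarrow> 0" "\<And>n. l2_le (\<lambda>j. if j \<in> J n then 0 else a j) (\<epsilon> n)"
proof -
  define J where "J n = {j :: 'i. to_nat j < n}" for n
  have fin: "finite (J n)" for n
    unfolding J_def by (rule finite_subset[OF _ finite_vimageI[of "{..<n}" to_nat]]) auto
  have lim: "filterlim J (finite_subsets_at_top UNIV) sequentially"
    unfolding filterlim_finite_subsets_at_top
  proof (intro allI impI)
    fix K :: "'i set" assume "finite K \<and> K \<subseteq> UNIV"
    then have K: "finite K" by simp
    obtain N where N: "\<And>j. j \<in> K \<Longrightarrow> to_nat j < N"
      using finite_nat_set_iff_bounded[of "to_nat ` K"] K by auto
    show "\<forall>\<^sub>F n in sequentially. finite (J n) \<and> K \<subseteq> J n \<and> J n \<subseteq> UNIV"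
      unfolding eventually_sequentially
    proof (intro exI[of _ N] allI impI conjI)
      fix n assume "N \<le> n"
      then show "K \<subseteq> J n" using N by (auto simp: J_def intro: less_le_trans)
    qed (auto simp: fin)
  qed
  define S where "S = (\<Sum>\<^sub>\<infinity>j. (cmod (a j))\<^sup>2)"
  have summ: "(\<lambda>j. (cmod (a j))\<^sup>2) summable_on UNIV"
    using a square_summable_iff_l2_le[of a] by (auto simp: square_summable_def)
  then have S: "((\<lambda>j. (cmod (a j))\<^sup>2) has_sum S) UNIV" unfolding S_def by (rule has_sum_infsum)
  define \<epsilon> where "\<epsilon> n = S - (sq_sum a (J n))" for n
  have "(\<lambda>n. \<Sum>j\<in>J n. (cmod (a j))\<^sup>2) \<longlonglongrightarrow> S"
    by (rule filterlim_compose[OF S[unfolded has_sum_def] lim])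
  then have "\<epsilon> \<longlonglongrightarrow> S - S" unfolding \<epsilon>_def by (intro tendsto_intros)
  then have "\<epsilon> \<longlonglongrightarrow> 0" by simp
  moreover have "l2_le (\<lambda>j. if j \<in> J n then 0 else a j) (\<epsilon> n)" for n
    unfolding l2_le_def
  proof (intro allI impI)
    fix K :: "'i set" assume K: "finite K"
    have "(\<Sum>j\<in>K. (cmod (if j \<in> J n then 0 else a j))\<^sup>2) = (\<Sum>j\<in>K - J n. (cmod (a j))\<^sup>2)"
      using K by (intro sum.mono_neutral_cong_right) auto
    also have "\<dots> + (sq_sum a (J n)) = (\<Sum>j\<in>(K - J n) \<union> J n. (cmod (a j))\<^sup>2)"
      using K fin by (intro sum.union_disjoint[symmetric]) auto
    also have "\<dots> \<le> S"
      unfolding S_def using K fin by (intro finite_sum_le_infsum summ) auto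
    finally show "(\<Sum>j\<in>K. (cmod (if j \<in> J n then 0 else a j))\<^sup>2) \<le> \<epsilon> n" by (simp add: \<epsilon>_def)
  qed
  ultimately show thesis using that fin lim by blast
qed

lemma (in nonneg_matrix) app_truncation:
  assumes a: "l2_le a R" and J: "finite J" and e: "l2_le (\<lambda>j. if j \<in> J then 0 else a j) e"
  shows "l2_le (\<lambda>i. (\<Sum>j\<in>J. a j * complex_of_real (A i j)) - app a i) (M\<^sup>2 * e)"
proof -
  have "app (\<lambda>j. a j - (if j \<in> J then 0 else a j)) i = app a i - app (\<lambda>j. if j \<in> J then 0 else a j) i" for i
    by (rule app_diff[OF l2_le_cmod_le[OF a] l2_le_cmod_le[OF e]])
  moreover have "app (\<lambda>j. a j - (if j \<in> J then 0 else a j)) i = (\<Sum>j\<in>J. a j * complex_of_real (A i j))" for i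
    by (subst app_finite[OF J]) auto
  ultimately have "(\<lambda>i. (\<Sum>j\<in>J. a j * complex_of_real (A i j)) - app a i) = (\<lambda>i. - app (\<lambda>j. if j \<in> J then 0 else a j) i)"
    by (simp add: fun_eq_iff)
  then show ?thesis using Schur_l2_le[OF e] by (simp add: l2_le_uminus)
qed

section \<open>Square-summable coefficients on the line\<close>

context riesz_nodes
begin

text \<open>The dual of \<open>upper\<close>: the moments are paired with their own trigonometric
  sum, and one factor of their energy cancels.\<close>

lemma Bessel:
  assumes k: "square_integrable cell k"
  shows "l2_le (\<lambda>m. \<integral>u. k u * cis (x m * u) \<partial>cell) (B\<^sup>2 * (sq_int cell k))"
  unfolding l2_le_def
proof (intro allI impI)
  fix K :: "int set" assume K: "finite K"
  define c where "c m = (\<integral>u. k u * cis (x m * u) \<partial>cell)" for m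
  define S where "S = (sq_sum c K)"
  define E where "E = (sq_int cell k)"
  have S0: "0 \<le> S" unfolding S_def by (intro sum_nonneg) auto
  have E0: "0 \<le> E" unfolding E_def by (intro integral_nonneg_AE) auto
  have "complex_of_real S = (\<Sum>m\<in>K. cnj (c m) * c m)"
    unfolding S_def by (simp add: complex_norm_square mult.commute del: of_real_power)
  also have "\<dots> = (\<integral>u. k u * cnj (trig_sum x K c u) \<partial>cell)"
    unfolding c_def by (rule integral_mult_cnj_trig_sum[symmetric]) (rule integrable_cell_mult_cis[OF k])
  finally have eq: "complex_of_real S = \<dots>" .
  have sq: "square_integrable cell (\<lambda>u. cnj (trig_sum x K c u))"
    using square_integrable_trig_sum[of x K c] unfolding square_integrable_def by auto
  have "S\<^sup>2 = (cmod (complex_of_real S))\<^sup>2" by simp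
  also have "\<dots> \<le> E * (sq_int cell (trig_sum x K c))"
    unfolding eq E_def using Cauchy_Schwarz_integral(2)[OF k sq] by (simp only: complex_mod_cnj)
  also have "\<dots> \<le> E * (B\<^sup>2 * S)"
    unfolding S_def by (intro mult_left_mono upper K E0)
  finally have "S * S \<le> (B\<^sup>2 * E) * S" by (simp add: power2_eq_square mult_ac)
  then have "S \<le> B\<^sup>2 * E"
    using S0 E0 by (cases "S = 0") (auto simp: mult_le_cancel_right)
  then show "(\<Sum>m\<in>K. (cmod (\<integral>u. k u * cis (x m * u) \<partial>cell))\<^sup>2) \<le> B\<^sup>2 * (sq_int cell k)"
    by (simp add: S_def c_def E_def)
qed

text \<open>The error estimate for h = 0 with the nodal values as residual: an interpolant is
  bounded by its data, uniformly in r \<le> 1. In the \<open>ennreal\<close> form, infinite energies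
  included, it can be inserted under a sum or integral over a second variable.\<close>

lemma interpolant_bound_finite:
  obtains C where "C > 0"
    and "\<And>r J a t. 0 < r \<Longrightarrow> r \<le> 1 \<Longrightarrow> finite J \<Longrightarrow>
      ennreal ((cmod (gauss_sum r J a t))\<^sup>2)
        \<le> ennreal C * l2_energy (gram_sum r J a)"
    and "\<And>r J a. 0 < r \<Longrightarrow> r \<le> 1 \<Longrightarrow> finite J \<Longrightarrow>
      energy lborel (\<lambda>t. \<Sum>j\<in>J. a j * complex_of_real (exp (- r * (t - x j)\<^sup>2)))
        \<le> ennreal C * l2_energy (gram_sum r J a)"
proof -
  obtain C where C0: "C > 0"
    and C: "\<And>r \<beta> J a h H R t. 0 < r \<Longrightarrow> r \<le> 1 \<Longrightarrow> 0 \<le> \<beta> \<Longrightarrow> \<beta> \<le> pi \<Longrightarrow> finite J \<Longrightarrow>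
      h \<in> borel_measurable borel \<Longrightarrow> (\<And>u. cmod (h u) \<le> H) \<Longrightarrow> (\<And>u. \<beta> < \<bar>u\<bar> \<Longrightarrow> h u = 0) \<Longrightarrow>
      l2_le (\<lambda>m. (gram_sum r J a m) - ift h (x m)) R \<Longrightarrow>
      (cmod ((gauss_sum r J a t) - ift h t))\<^sup>2
        \<le> C * (gauss_weight r pi / gauss_weight r \<beta> * (sq_int lborel h) + R) \<and>
      energy lborel (\<lambda>t. (gauss_sum r J a t) - ift h t)
        \<le> ennreal (C * (gauss_weight r pi / gauss_weight r \<beta> * (sq_int lborel h) + R))"
    using interpolant_error_finite by blast
  have main: "ennreal ((cmod (gauss_sum r J a t))\<^sup>2) \<le> ennreal C * L \<and>
      energy lborel (\<lambda>t. \<Sum>j\<in>J. a j * complex_of_real (exp (- r * (t - x j)\<^sup>2))) \<le> ennreal C * L"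
    if r: "0 < r" "r \<le> 1" and J: "finite J"
      and L: "L = l2_energy (gram_sum r J a)" for r J a t L
  proof (cases "L = \<infinity>")
    case True
    then show ?thesis using C0 by (simp add: ennreal_mult_top)
  next
    case False
    then have fin: "L < \<infinity>" by (simp add: less_top[symmetric])
    define R where "R = enn2real L"
    have R: "ennreal R = L" using fin unfolding R_def by (intro ennreal_enn2real) simp
    have z: "ift (\<lambda>u. 0) = (\<lambda>t::real. 0)" by (simp add: ift_def fun_eq_iff)
    have "l2_le (\<lambda>m. (gram_sum r J a m) - ift (\<lambda>u. 0) (x m)) R"
      unfolding z R_def L using l2_le_of_energy[OF fin[unfolded L]] by simp
    from C[of r 0 J "\<lambda>u. 0" 0 a R t, OF r _ _ J _ _ _ this]
    have *: "(cmod (gauss_sum r J a t))\<^sup>2 \<le> C * R"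
      "energy lborel (\<lambda>t. \<Sum>j\<in>J. a j * complex_of_real (exp (- r * (t - x j)\<^sup>2))) \<le> ennreal (C * R)"
      by (simp_all add: z)
    have "ennreal (C * R) = ennreal C * L"
      unfolding R[symmetric] using C0 by (intro ennreal_mult) (auto simp: R_def)
    with * show ?thesis by (metis ennreal_leI)
  qed
  show thesis by (rule that[OF C0]) (use main in blast)+
qed

lemma gauss_series_has_sum:
  assumes r: "r > 0" and a: "\<And>j. cmod (a j) \<le> K"
  shows "((\<lambda>j. a j * complex_of_real (exp (- r * (t - x j)\<^sup>2))) has_sum
    (gauss_series r a t)) UNIV"
proof (rule has_sum_infsum, rule abs_summable_summable, rule nonneg_bdd_above_summable_on)
  obtain M where M: "\<And>J. finite J \<Longrightarrow> (\<Sum>j\<in>J. exp (- r * (t - x j)\<^sup>2)) \<le> M"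
    using gauss_row_bound[OF r] by blast
  have K: "0 \<le> K" using a norm_ge_zero order_trans by blast
  have le: "(\<Sum>j\<in>J. cmod (a j * complex_of_real (exp (- r * (t - x j)\<^sup>2)))) \<le> K * M" if J: "finite J" for J
  proof -
    have "(\<Sum>j\<in>J. cmod (a j * complex_of_real (exp (- r * (t - x j)\<^sup>2)))) \<le> (\<Sum>j\<in>J. K * exp (- r * (t - x j)\<^sup>2))"
      using a by (intro sum_mono) (auto simp: norm_mult)
    also have "\<dots> \<le> K * M" using M[OF J] K by (simp add: sum_distrib_left[symmetric] mult_left_mono)
    finally show ?thesis .
  qed
  show "bdd_above (sum (\<lambda>j. cmod (a j * complex_of_real (exp (- r * (t - x j)\<^sup>2)))) ` {F. F \<subseteq> UNIV \<and> finite F})"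
    by (rule bdd_aboveI2[where M = "K * M"], rule le) simp
qed simp

lemma gram_solution_exists:
  assumes r: "r > 0" and f: "l2_le f R"
  obtains a S where "l2_le a S"
    "\<And>m. ((\<lambda>j. a j * complex_of_real (gram r m j)) has_sum f m) UNIV"
proof -
  obtain M where "coercive_matrix (gram r) M (gauss_weight r pi / B\<^sup>2)"
    using coercive_gram[OF r] by blast
  then interpret coercive_matrix "gram r" M "gauss_weight r pi / B\<^sup>2" .
  obtain a S where a: "l2_le a S" "app a = f" using solution_exists[OF f] by blast
  have "((\<lambda>j. a j * complex_of_real (gram r m j)) has_sum app a m) UNIV" for m
    by (rule row_has_sum[OF l2_le_cmod_le[OF a(1)]])
  then show thesis using that a by blast
qed

text \<open>The factor 2 at \<open>R\<close> comes from separating the residual from the truncation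
  error 2 M^2 \<epsilon>. The matrix bound \<open>M\<close> depends on \<open>r\<close>, but for
  fixed \<open>r\<close> that error vanishes along the truncations and leaves no trace in
  \<open>C\<close>.\<close>

lemma interpolant_error:
  obtains C where "C > 0"
    and "\<And>r \<beta> a S f h H R. 0 < r \<Longrightarrow> r \<le> 1 \<Longrightarrow> 0 \<le> \<beta> \<Longrightarrow> \<beta> \<le> pi \<Longrightarrow> l2_le a S \<Longrightarrow>
      (\<And>m. ((\<lambda>j. a j * complex_of_real (gram r m j)) has_sum f m) UNIV) \<Longrightarrow>
      h \<in> borel_measurable borel \<Longrightarrow> (\<And>u. cmod (h u) \<le> H) \<Longrightarrow> (\<And>u. \<beta> < \<bar>u\<bar> \<Longrightarrow> h u = 0) \<Longrightarrow>
      l2_le (\<lambda>m. f m - ift h (x m)) R \<Longrightarrow>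
      (\<forall>t. (cmod ((gauss_series r a t) - ift h t))\<^sup>2
        \<le> C * (gauss_weight r pi / gauss_weight r \<beta> * (sq_int lborel h) + 2 * R)) \<and>
      energy lborel (\<lambda>t. (gauss_series r a t) - ift h t)
        \<le> ennreal (C * (gauss_weight r pi / gauss_weight r \<beta> * (sq_int lborel h) + 2 * R))"
proof -
  obtain C where C0: "C > 0"
    and C: "\<And>r \<beta> J a h H R t. 0 < r \<Longrightarrow> r \<le> 1 \<Longrightarrow> 0 \<le> \<beta> \<Longrightarrow> \<beta> \<le> pi \<Longrightarrow> finite J \<Longrightarrow>
      h \<in> borel_measurable borel \<Longrightarrow> (\<And>u. cmod (h u) \<le> H) \<Longrightarrow> (\<And>u. \<beta> < \<bar>u\<bar> \<Longrightarrow> h u = 0) \<Longrightarrow>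
      l2_le (\<lambda>m. (gram_sum r J a m) - ift h (x m)) R \<Longrightarrow>
      (cmod ((gauss_sum r J a t) - ift h t))\<^sup>2
        \<le> C * (gauss_weight r pi / gauss_weight r \<beta> * (sq_int lborel h) + R) \<and>
      energy lborel (\<lambda>t. (gauss_sum r J a t) - ift h t)
        \<le> ennreal (C * (gauss_weight r pi / gauss_weight r \<beta> * (sq_int lborel h) + R))"
    using interpolant_error_finite by blast
  have "(\<forall>t. (cmod ((gauss_series r a t) - ift h t))\<^sup>2
        \<le> C * (gauss_weight r pi / gauss_weight r \<beta> * (sq_int lborel h) + 2 * R)) \<and>
      energy lborel (\<lambda>t. (gauss_series r a t) - ift h t)
        \<le> ennreal (C * (gauss_weight r pi / gauss_weight r \<beta> * (sq_int lborel h) + 2 * R))"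
    if r: "0 < r" "r \<le> 1" and \<beta>: "0 \<le> \<beta>" "\<beta> \<le> pi" and a: "l2_le a S"
      and f: "\<And>m. ((\<lambda>j. a j * complex_of_real (gram r m j)) has_sum f m) UNIV"
      and h [measurable]: "h \<in> borel_measurable borel" and h_bnd: "\<And>u. cmod (h u) \<le> H"
      and h_supp: "\<And>u. \<beta> < \<bar>u\<bar> \<Longrightarrow> h u = 0"
      and R: "l2_le (\<lambda>m. f m - ift h (x m)) R" for r \<beta> a S f h H R
  proof -
    obtain M where "coercive_matrix (gram r) M (gauss_weight r pi / B\<^sup>2)"
      using coercive_gram[OF r(1)] by blast
    then interpret coercive_matrix "gram r" M "gauss_weight r pi / B\<^sup>2" .
    have app_a: "app a = f" by (rule app_unique[OF f])
    obtain J \<epsilon> where J: "\<And>n. finite (J n)" "filterlim J (finite_subsets_at_top UNIV) sequentially"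
      and \<epsilon>: "\<epsilon> \<longlonglongrightarrow> 0" "\<And>n. l2_le (\<lambda>j. if j \<in> J n then 0 else a j) (\<epsilon> n)"
      using l2_truncation[OF a] by blast
    let ?g = "\<lambda>t j. complex_of_real (exp (- r * (t - x j)\<^sup>2))"
    let ?P = "\<lambda>R. C * (gauss_weight r pi / gauss_weight r \<beta> * (sq_int lborel h) + R)"
    have l2: "l2_le (\<lambda>m. (gram_sum r (J n) a m) - ift h (x m)) (2 * (M\<^sup>2 * \<epsilon> n) + 2 * R)" for n
    proof -
      have "l2_le (\<lambda>m. ((gram_sum r (J n) a m) - app a m) + (f m - ift h (x m))) (2 * (M\<^sup>2 * \<epsilon> n) + 2 * R)"
        by (intro l2_le_add app_truncation[OF a J(1) \<epsilon>(2)] R)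
      then show ?thesis by (simp add: app_a)
    qed
    note bounds = C[OF r \<beta> J(1) h h_bnd h_supp l2]
    have lim: "(\<lambda>n. (\<Sum>j\<in>J n. a j * ?g t j) - ift h t) \<longlonglongrightarrow> (\<Sum>\<^sub>\<infinity>j. a j * ?g t j) - ift h t" for t
      using filterlim_compose[OF gauss_series_has_sum[OF r(1) l2_le_cmod_le[OF a], unfolded has_sum_def] J(2)]
      by (intro tendsto_intros) simp
    have P_lim: "(\<lambda>n. ?P (2 * (M\<^sup>2 * \<epsilon> n) + 2 * R)) \<longlonglongrightarrow> ?P (2 * (M\<^sup>2 * 0) + 2 * R)"
      by (intro tendsto_intros \<epsilon>(1))
    show ?thesis
    proof (intro conjI allI)
      fix t
      have "(\<lambda>n. (cmod ((\<Sum>j\<in>J n. a j * ?g t j) - ift h t))\<^sup>2) \<longlonglongrightarrow> (cmod ((\<Sum>\<^sub>\<infinity>j. a j * ?g t j) - ift h t))\<^sup>2"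
        by (intro tendsto_intros lim)
      then have "(cmod ((\<Sum>\<^sub>\<infinity>j. a j * ?g t j) - ift h t))\<^sup>2 \<le> ?P (2 * (M\<^sup>2 * 0) + 2 * R)"
        by (rule LIMSEQ_le[OF _ P_lim]) (use bounds in blast)
      then show "(cmod ((\<Sum>\<^sub>\<infinity>j. a j * ?g t j) - ift h t))\<^sup>2 \<le> ?P (2 * R)" by simp
    next
      have "energy lborel (\<lambda>t. (\<Sum>\<^sub>\<infinity>j. a j * ?g t j) - ift h t) \<le> ennreal (?P (2 * (M\<^sup>2 * 0) + 2 * R))"
      proof (rule energy_Fatou)
        show "(\<lambda>t. (\<Sum>j\<in>J n. a j * ?g t j) - ift h t) \<in> borel_measurable lborel" for n
          by measurable
        show "(\<lambda>n. (\<Sum>j\<in>J n. a j * ?g t j) - ift h t) \<longlonglongrightarrow> (\<Sum>\<^sub>\<infinity>j. a j * ?g t j) - ift h t" for t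
          by (rule lim)
        show "energy lborel (\<lambda>t. (\<Sum>j\<in>J n. a j * ?g t j) - ift h t) \<le> ennreal (?P (2 * (M\<^sup>2 * \<epsilon> n) + 2 * R))" for n
          using bounds by blast
      qed (intro tendsto_ennrealI P_lim)
      then show "energy lborel (\<lambda>t. (\<Sum>\<^sub>\<infinity>j. a j * ?g t j) - ift h t) \<le> ennreal (?P (2 * R))" by simp
    qed
  qed
  with C0 that show thesis by blast
qed

end

lemma (in riesz_nodes) measurable_gauss_series:
  assumes r: "r > 0" and a: "l2_le a S"
  shows "(\<lambda>t. \<Sum>\<^sub>\<infinity>j. a j * complex_of_real (exp (- r * (t - x j)\<^sup>2))) \<in> borel_measurable borel"
proof -
  obtain J :: "nat \<Rightarrow> int set" where J: "filterlim J (finite_subsets_at_top UNIV) sequentially"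
    using l2_truncation[OF a] by metis
  have "(\<lambda>n. \<Sum>j\<in>J n. a j * complex_of_real (exp (- r * (t - x j)\<^sup>2)))
    \<longlonglongrightarrow> (gauss_series r a t)" for t
    by (rule filterlim_compose[OF gauss_series_has_sum[OF r l2_le_cmod_le[OF a], unfolded has_sum_def] J])
  then show ?thesis by (rule borel_measurable_LIMSEQ_metric[rotated]) measurable
qed

text \<open>The normalisations cancel and the quotient is exp (- (pi^2 - \<beta>^2) / (4
  r)).\<close>

lemma gauss_weight_ratio_tendsto:
  assumes "0 \<le> \<beta>" "\<beta> < pi"
  shows "((\<lambda>r. gauss_weight r pi / gauss_weight r \<beta>) \<longlongrightarrow> 0) (at_right 0)"
proof -
  define c where "c = (pi\<^sup>2 - \<beta>\<^sup>2) / 4"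
  have c: "c > 0" using assms by (simp add: c_def power_strict_mono)
  have "((\<lambda>r. exp (- c / r)) \<longlongrightarrow> 0) (at_right (0::real))" using c by real_asymp
  moreover have "\<forall>\<^sub>F r in at_right 0. exp (- c / r) = gauss_weight r pi / gauss_weight r \<beta>"
  proof (rule eventually_at_rightI[of 0 1])
    fix r :: real assume "r \<in> {0<..<1}"
    then have r: "r > 0" by simp
    have "gauss_weight r pi / gauss_weight r \<beta> = exp (- (pi\<^sup>2) / (4 * r)) / exp (- (\<beta>\<^sup>2) / (4 * r))"
      using r by (simp add: gauss_weight_def)
    also have "\<dots> = exp (- (pi\<^sup>2) / (4 * r) - - (\<beta>\<^sup>2) / (4 * r))" by (rule exp_diff[symmetric])
    also have "- (pi\<^sup>2) / (4 * r) - - (\<beta>\<^sup>2) / (4 * r) = - c / r"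
      using r by (simp add: c_def field_simps)
    finally show "exp (- c / r) = gauss_weight r pi / gauss_weight r \<beta>" ..
  qed simp
  ultimately show ?thesis by (rule Lim_transform_eventually)
qed

text \<open>A bounded spectrum on the set \<beta> < |u| \<le> pi has energy, transform and energy of
  the transform all controlled by pi - \<beta>. With \<beta> = -1 the set is the whole interval
  [-pi, pi], and the same lemma yields crude bounds for any bounded spectrum there.\<close>

lemma norm_ift_le_measure:
  assumes [measurable]: "k \<in> borel_measurable borel" and bnd: "\<And>u. cmod (k u) \<le> H"
    and \<beta>: "\<beta> \<le> pi" and supp: "\<And>u. \<not> (\<beta> < \<bar>u\<bar> \<and> \<bar>u\<bar> \<le> pi) \<Longrightarrow> k u = 0"
  shows "(sq_int lborel k) \<le> H\<^sup>2 * (2 * (pi - \<beta>))"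
    "cmod (ift k t) \<le> H * (2 * (pi - \<beta>))"
    "energy lborel (ift k) \<le> ennreal (2 * pi * (H\<^sup>2 * (2 * (pi - \<beta>))))"
    "integrable lborel k" "square_integrable lborel k"
proof -
  \<comment> \<open>The two indicators together dominate that of the support, and their sum has
    integral 2 (pi - \<beta>) even when the intervals overlap, as they do for negative
    \<beta>.\<close>
  let ?i = "\<lambda>u. indicator {-pi..-\<beta>} u + indicator {\<beta>..pi} u :: real"
  have i: "integrable lborel ?i"
    by (intro Bochner_Integration.integrable_add) (auto simp: integrable_indicator_iff emeasure_lborel_Icc_eq)
  have I: "(\<integral>u. ?i u \<partial>lborel) = 2 * (pi - \<beta>)"
    using \<beta> by (subst Bochner_Integration.integral_add) auto
  have H: "0 \<le> H" using bnd[of 0] norm_ge_zero order_trans by blast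
  have le: "cmod (k u) \<le> H * ?i u" for u
  proof (cases "\<beta> < \<bar>u\<bar> \<and> \<bar>u\<bar> \<le> pi")
    case True
    then have "1 \<le> ?i u" by (cases "u \<ge> 0") (auto simp: indicator_def)
    then have "H * 1 \<le> H * ?i u" using H by (rule mult_left_mono)
    then show ?thesis using bnd[of u] by simp
  next
    case False
    have "0 \<le> ?i u" by simp
    with False H show ?thesis by (simp add: supp)
  qed
  have le2: "(cmod (k u))\<^sup>2 \<le> H\<^sup>2 * ?i u" for u
  proof -
    have "(cmod (k u))\<^sup>2 \<le> H * (H * ?i u)"
      unfolding power2_eq_square by (intro mult_mono bnd le H) simp
    then show ?thesis by (simp add: power2_eq_square mult.assoc)
  qed
  have norm_le: "norm v \<le> norm w" if "norm v \<le> w" for v :: "'z::real_normed_vector" and w :: real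
    using that by simp
  show int: "integrable lborel k"
    by (rule Bochner_Integration.integrable_bound[OF integrable_mult_right[OF i, of H]])
       (measurable, intro AE_I2 norm_le le)
  have int2: "integrable lborel (\<lambda>u. (cmod (k u))\<^sup>2)"
    by (rule Bochner_Integration.integrable_bound[OF integrable_mult_right[OF i, of "H\<^sup>2"]])
       (measurable, intro AE_I2 norm_le, use le2 in simp)
  show sq: "square_integrable lborel k" using int2 by (simp add: square_integrable_def)
  have "(sq_int lborel k) \<le> (\<integral>u. H\<^sup>2 * ?i u \<partial>lborel)"
    by (intro integral_mono int2 integrable_mult_right i le2)
  also have "\<dots> = H\<^sup>2 * (2 * (pi - \<beta>))" unfolding I[symmetric] by (rule integral_mult_right_zero)
  finally show E: "(sq_int lborel k) \<le> H\<^sup>2 * (2 * (pi - \<beta>))" .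
  have "cmod (ift k t) \<le> (\<integral>u. cmod (k u) \<partial>lborel)" by (rule norm_ift_le)
  also have "\<dots> \<le> (\<integral>u. H * ?i u \<partial>lborel)"
    by (intro integral_mono integrable_norm int integrable_mult_right i le)
  also have "\<dots> = H * (2 * (pi - \<beta>))" unfolding I[symmetric] by (rule integral_mult_right_zero)
  finally show "cmod (ift k t) \<le> H * (2 * (pi - \<beta>))" .
  have "energy lborel (ift k) \<le> ennreal (2 * pi) * energy lborel k" by (rule Plancherel_le[OF int])
  also have "\<dots> \<le> ennreal (2 * pi) * ennreal (H\<^sup>2 * (2 * (pi - \<beta>)))"
    unfolding energy_eq_integral[OF sq] by (intro mult_left_mono ennreal_leI E) simp
  also have "\<dots> = ennreal (2 * pi * (H\<^sup>2 * (2 * (pi - \<beta>))))"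
    using \<beta> by (intro ennreal_mult[symmetric]) auto
  finally show "energy lborel (ift k) \<le> ennreal (2 * pi * (H\<^sup>2 * (2 * (pi - \<beta>))))" .
qed

lemma integral_cell_eq_lborel:
  fixes f :: "real \<Rightarrow> 'b::{banach, second_countable_topology}"
  assumes "\<And>u. pi < \<bar>u\<bar> \<Longrightarrow> f u = 0"
  shows "integral\<^sup>L cell f = integral\<^sup>L lborel f"
  unfolding integral_cell
proof (rule Bochner_Integration.integral_cong[OF refl])
  fix u
  show "indicat_real {- pi..pi} u *\<^sub>R f u = f u"
    using assms[of u] by (cases "u \<in> {-pi..pi}") auto
qed

section \<open>Convergence on the line for bounded spectra\<close>

context riesz_nodes
begin

text \<open>A spectrum that reaches the edge pi gains nothing from the ratio of weights, so it is
  cut off at some \<beta> < pi. For \<open>h1\<close> the ratio tends to 0. The remainder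
  \<open>k\<close> has small energy and enters twice: as a data error, through
  \<open>Bessel\<close>, and directly as \<open>ift k\<close>.\<close>

lemma interpolant_converges:
  assumes h [measurable]: "h \<in> borel_measurable borel" and h_bnd: "\<And>u. cmod (h u) \<le> H"
    and h_supp: "\<And>u. pi < \<bar>u\<bar> \<Longrightarrow> h u = 0" and \<epsilon>: "\<epsilon> > 0"
  shows "\<forall>\<^sub>F r in at_right 0. \<forall>a S. l2_le a S \<longrightarrow>
      (\<forall>m. ((\<lambda>j. a j * complex_of_real (gram r m j)) has_sum ift h (x m)) UNIV) \<longrightarrow>
      (\<forall>t. (cmod ((gauss_series r a t) - ift h t))\<^sup>2 \<le> \<epsilon>) \<and>
      energy lborel (\<lambda>t. (gauss_series r a t) - ift h t) \<le> ennreal \<epsilon>"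
proof -
  obtain C where C0: "C > 0"
    and C: "\<And>r \<beta> a S f h H R. 0 < r \<Longrightarrow> r \<le> 1 \<Longrightarrow> 0 \<le> \<beta> \<Longrightarrow> \<beta> \<le> pi \<Longrightarrow> l2_le a S \<Longrightarrow>
      (\<And>m. ((\<lambda>j. a j * complex_of_real (gram r m j)) has_sum f m) UNIV) \<Longrightarrow>
      h \<in> borel_measurable borel \<Longrightarrow> (\<And>u. cmod (h u) \<le> H) \<Longrightarrow> (\<And>u. \<beta> < \<bar>u\<bar> \<Longrightarrow> h u = 0) \<Longrightarrow>
      l2_le (\<lambda>m. f m - ift h (x m)) R \<Longrightarrow>
      (\<forall>t. (cmod ((gauss_series r a t) - ift h t))\<^sup>2
        \<le> C * (gauss_weight r pi / gauss_weight r \<beta> * (sq_int lborel h) + 2 * R)) \<and>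
      energy lborel (\<lambda>t. (gauss_series r a t) - ift h t)
        \<le> ennreal (C * (gauss_weight r pi / gauss_weight r \<beta> * (sq_int lborel h) + 2 * R))"
    using interpolant_error by blast
  have H0: "0 \<le> H" using h_bnd[of 0] norm_ge_zero order_trans by blast
  \<comment> \<open>\<open>Q\<close> collects the terms linear in the width \<open>s\<close> of the
    removed edge: 8 C B^2 H^2 from the data error and 8 pi H^2 from \<open>ift k\<close>. Then
    \<open>s\<close> is fixed before \<open>r\<close>, so that Q s uses up half of
    \<epsilon>.\<close>
  define Q where "Q = 8 * H\<^sup>2 * (C * B\<^sup>2 + pi)"
  have Q0: "0 \<le> Q" using C0 by (simp add: Q_def)
  define s where "s = min pi (\<epsilon> / (2 * (Q + 1)))"
  have s: "0 < s" "s \<le> pi" using \<epsilon> Q0 by (auto simp: s_def)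
  have "Q * s \<le> (Q + 1) * (\<epsilon> / (2 * (Q + 1)))"
    using Q0 s(1) by (intro mult_mono) (auto simp: s_def)
  also have "\<dots> = \<epsilon> / 2" using Q0 by (simp add: field_simps)
  finally have Qs: "Q * s \<le> \<epsilon> / 2" .
  define \<beta> where "\<beta> = pi - s"
  have \<beta>: "0 \<le> \<beta>" "\<beta> \<le> pi" "\<beta> < pi" using s by (auto simp: \<beta>_def)
  define h1 where "h1 u = (if u \<in> {-\<beta>..\<beta>} then h u else 0)" for u
  define k where "k u = h u - h1 u" for u
  have [measurable]: "h1 \<in> borel_measurable borel" unfolding h1_def[abs_def] by measurable
  have [measurable]: "k \<in> borel_measurable borel" unfolding k_def[abs_def] by measurable
  have h1_bnd: "cmod (h1 u) \<le> H" and k_bnd: "cmod (k u) \<le> H" for u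
    using h_bnd[of u] H0 by (auto simp: h1_def k_def)
  have h1_supp: "h1 u = 0" if "\<beta> < \<bar>u\<bar>" for u using that by (auto simp: h1_def)
  have k_supp: "k u = 0" if "\<not> (\<beta> < \<bar>u\<bar> \<and> \<bar>u\<bar> \<le> pi)" for u
    using that h_supp[of u] by (auto simp: k_def h1_def)
  note k = norm_ift_le_measure[where k = k and H = H and \<beta> = \<beta>, OF _ k_bnd \<beta>(2) k_supp]
  have ps: "pi - \<beta> = s" by (simp add: \<beta>_def)
  have h1_int: "integrable lborel h1"
    by (rule norm_ift_le_measure(4)[where k = h1 and H = H and \<beta> = "- 1", OF _ h1_bnd]) (use \<beta> h1_supp in auto)
  have ift_h: "ift h t = ift h1 t + ift k t" for t
    using ift_add[OF h1_int k(4), of t] by (simp add: k_def)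
  have k_mom: "l2_le (\<lambda>m. ift h (x m) - ift h1 (x m)) (B\<^sup>2 * (H\<^sup>2 * (2 * s)))"
  proof -
    have k_sq: "square_integrable cell k" by (rule square_integrable_cell_bounded[OF _ k_bnd]) measurable
    have "(\<integral>u. k u * cis (x m * u) \<partial>cell) = ift h (x m) - ift h1 (x m)" for m
      unfolding ift_h by (subst integral_cell_eq_lborel) (auto simp: ift_def k_supp)
    moreover have "(sq_int cell k) \<le> H\<^sup>2 * (2 * s)"
      using k(1) by (subst integral_cell_eq_lborel) (auto simp: k_supp ps)
    then have "B\<^sup>2 * (sq_int cell k) \<le> B\<^sup>2 * (H\<^sup>2 * (2 * s))" by (intro mult_left_mono) auto
    ultimately show ?thesis using Bessel[OF k_sq] unfolding l2_le_def by (auto intro: order_trans)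
  qed
  define E where "E = (sq_int lborel h1)"
  have "((\<lambda>r. 2 * C * (gauss_weight r pi / gauss_weight r \<beta> * E)) \<longlongrightarrow> 2 * C * (0 * E)) (at_right 0)"
    by (intro tendsto_intros gauss_weight_ratio_tendsto \<beta>)
  then have "((\<lambda>r. 2 * C * (gauss_weight r pi / gauss_weight r \<beta> * E)) \<longlongrightarrow> 0) (at_right 0)" by simp
  then have ev1: "\<forall>\<^sub>F r in at_right 0. 2 * C * (gauss_weight r pi / gauss_weight r \<beta> * E) < \<epsilon> / 2"
    using \<epsilon> by (intro order_tendstoD) auto
  have ev2: "\<forall>\<^sub>F r in at_right (0::real). r \<in> {0<..<1}"
    by (rule eventually_at_right_real) simp
  show ?thesis
    using ev1 ev2
  proof (eventually_elim, intro allI impI)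
    fix r a S
    assume small: "2 * C * (gauss_weight r pi / gauss_weight r \<beta> * E) < \<epsilon> / 2"
      and "r \<in> {0<..<1}" and a: "l2_le a S"
      and sol: "\<forall>m. ((\<lambda>j. a j * complex_of_real (gram r m j)) has_sum ift h (x m)) UNIV"
    then have r: "0 < r" "r \<le> 1" by auto
    define I where "I t = (gauss_series r a t)" for t
    define T where "T = C * (gauss_weight r pi / gauss_weight r \<beta> * E + 2 * (B\<^sup>2 * (H\<^sup>2 * (2 * s))))"
    have bnd: "\<forall>t. (cmod (I t - ift h1 t))\<^sup>2 \<le> T" "energy lborel (\<lambda>t. I t - ift h1 t) \<le> ennreal T"
      using C[OF r \<beta>(1,2) a sol[rule_format] _ h1_bnd h1_supp k_mom] unfolding I_def T_def E_def by auto
    have split: "I t - ift h t = (I t - ift h1 t) - ift k t" for t by (simp add: ift_h)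
    have T_le: "2 * T + 8 * pi * H\<^sup>2 * s \<le> \<epsilon>"
    proof -
      have "2 * (C * (A + 2 * (B\<^sup>2 * (H\<^sup>2 * (2 * s))))) + 8 * pi * H\<^sup>2 * s = 2 * C * A + Q * s" for A
        by (simp add: Q_def algebra_simps)
      then show ?thesis using small Qs unfolding T_def by (simp only:)
    qed
    have T0: "0 \<le> T" using bnd(1) zero_le_power2 order_trans by blast
    have I_meas: "I \<in> borel_measurable borel"
      unfolding I_def[abs_def] by (rule measurable_gauss_series[OF r(1) a])
    show "(\<forall>t. (cmod ((gauss_series r a t) - ift h t))\<^sup>2 \<le> \<epsilon>) \<and>
      energy lborel (\<lambda>t. (gauss_series r a t) - ift h t) \<le> ennreal \<epsilon>"
      unfolding I_def[symmetric]
    proof (intro conjI allI)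
      fix t
      have "cmod (ift k t) \<le> H * (2 * s)" using k(2)[of t] by (simp add: ps)
      then have "(cmod (ift k t))\<^sup>2 \<le> (H * (2 * s))\<^sup>2" by (intro power_mono) auto
      also have "\<dots> = 4 * H\<^sup>2 * (s * s)" by (simp add: power_mult_distrib power2_eq_square)
      \<comment> \<open>Replacing one factor \<open>s\<close> by pi makes the pointwise contribution
        of \<open>ift k\<close> equal to its energy contribution, so that \<open>T_le\<close> covers
        both.\<close>
      also have "\<dots> \<le> 4 * H\<^sup>2 * (pi * s)" using s by (intro mult_left_mono mult_right_mono) auto
      finally have "(cmod (ift k t))\<^sup>2 \<le> 4 * H\<^sup>2 * (pi * s)" .
      moreover have "(cmod (I t - ift h t))\<^sup>2 \<le> 2 * (cmod (I t - ift h1 t))\<^sup>2 + 2 * (cmod (ift k t))\<^sup>2"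
        unfolding split using cmod_add_squared_le[of "I t - ift h1 t" "- ift k t"] by simp
      moreover have "(cmod (I t - ift h1 t))\<^sup>2 \<le> T" using bnd(1) by blast
      ultimately have "(cmod (I t - ift h t))\<^sup>2 \<le> 2 * T + 2 * (4 * H\<^sup>2 * (pi * s))" by linarith
      also have "\<dots> \<le> \<epsilon>" using T_le by (simp add: mult_ac)
      finally show "(cmod (I t - ift h t))\<^sup>2 \<le> \<epsilon>" .
    next
      have "energy lborel (\<lambda>t. I t - ift h t) \<le> 2 * energy lborel (\<lambda>t. I t - ift h1 t) + 2 * energy lborel (ift k)"
      proof -
        have "ift h1 \<in> borel_measurable borel" "ift k \<in> borel_measurable borel"
          by (rule measurable_ift, measurable)+
        then show ?thesis unfolding split using I_meas by (intro energy_diff_le) auto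
      qed
      also have "\<dots> \<le> 2 * ennreal T + 2 * ennreal (2 * pi * (H\<^sup>2 * (2 * s)))"
        using k(3) by (intro add_mono mult_left_mono bnd) (auto simp: ps)
      also have "\<dots> = ennreal (2 * T + 2 * (2 * pi * (H\<^sup>2 * (2 * s))))"
        using T0 s H0 by (simp add: ennreal_plus ennreal_mult)
      also have "\<dots> \<le> ennreal \<epsilon>" using T_le by (intro ennreal_leI) (simp add: mult_ac)
      finally show "energy lborel (\<lambda>t. I t - ift h t) \<le> ennreal \<epsilon>" .
    qed
  qed
qed

end

section \<open>Interpolation on a grid in the plane\<close>

text \<open>Allows a finite set of grid indices to be replaced by the product of its two
  projections, whereby sums over it become iterated sums.\<close>

definition zero_extend :: "'i set \<Rightarrow> ('i \<Rightarrow> complex) \<Rightarrow> 'i \<Rightarrow> complex" where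
  "zero_extend J a q = (if q \<in> J then a q else 0)"

lemma grid_sum:
  fixes a :: "int \<times> int \<Rightarrow> complex"
  assumes J: "finite J"
  shows "(\<Sum>q\<in>J. a q * (F (fst q) * G (snd q)))
    = (\<Sum>j\<in>fst ` J. (\<Sum>k\<in>snd ` J. zero_extend J a (j, k) * G k) * F j)"
proof -
  have "(\<Sum>q\<in>J. a q * (F (fst q) * G (snd q))) = (\<Sum>q\<in>fst ` J \<times> snd ` J. zero_extend J a q * (F (fst q) * G (snd q)))"
    using J by (intro sum.mono_neutral_cong_left) (auto simp: zero_extend_def subset_fst_snd)
  also have "\<dots> = (\<Sum>j\<in>fst ` J. \<Sum>k\<in>snd ` J. zero_extend J a (j, k) * (F j * G k))"
    by (simp add: sum.cartesian_product case_prod_unfold)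
  also have "\<dots> = (\<Sum>j\<in>fst ` J. (\<Sum>k\<in>snd ` J. zero_extend J a (j, k) * G k) * F j)"
    by (simp add: sum_distrib_left sum_distrib_right mult_ac)
  finally show ?thesis .
qed

lemma grid_sum_swap:
  fixes a :: "int \<times> int \<Rightarrow> complex"
  shows "(\<Sum>j\<in>P. (\<Sum>k\<in>Q. a (j, k) * G k) * F j) = (\<Sum>k\<in>Q. (\<Sum>j\<in>P. a (j, k) * F j) * G k)"
proof -
  have "(\<Sum>j\<in>P. (\<Sum>k\<in>Q. a (j, k) * G k) * F j) = (\<Sum>j\<in>P. \<Sum>k\<in>Q. a (j, k) * F j * G k)"
    by (simp add: sum_distrib_left sum_distrib_right mult_ac)
  also have "\<dots> = (\<Sum>k\<in>Q. \<Sum>j\<in>P. a (j, k) * F j * G k)" by (rule sum.swap)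
  finally show ?thesis by (simp add: sum_distrib_right)
qed

lemma sum_zero_extend_sq:
  assumes J: "finite J"
  shows "(\<Sum>j\<in>fst ` J. \<Sum>k\<in>snd ` J. (cmod (zero_extend J a (j, k)))\<^sup>2) = (sq_sum a J)"
proof -
  have "(sq_sum a J) = (\<Sum>q\<in>fst ` J \<times> snd ` J. (cmod (zero_extend J a q))\<^sup>2)"
    using J by (intro sum.mono_neutral_cong_left) (auto simp: zero_extend_def subset_fst_snd)
  then show ?thesis by (simp add: sum.cartesian_product)
qed

lemma grid_sum_le:
  fixes F G :: "int \<Rightarrow> real"
  assumes J: "finite J" and F: "\<And>j. 0 \<le> F j" and G: "\<And>j. 0 \<le> G j"
    and M: "\<And>J. finite J \<Longrightarrow> sum F J \<le> M" and N: "\<And>J. finite J \<Longrightarrow> sum G J \<le> N"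
  shows "(\<Sum>q\<in>J. F (fst q) * G (snd q)) \<le> M * N"
proof -
  have "(\<Sum>q\<in>J. F (fst q) * G (snd q)) \<le> (\<Sum>q\<in>fst ` J \<times> snd ` J. F (fst q) * G (snd q))"
    using J F G by (intro sum_mono2) (auto simp: subset_fst_snd)
  also have "\<dots> = (\<Sum>j\<in>fst ` J. F j) * (\<Sum>k\<in>snd ` J. G k)"
    by (simp add: sum_product sum.cartesian_product case_prod_unfold)
  also have "\<dots> \<le> M * N"
    using J F G M[of "fst ` J"] N[of "snd ` J"] M[of "{}"] by (intro mult_mono sum_nonneg) auto
  finally show ?thesis .
qed

lemma l2_energy_iterated:
  "l2_energy (c :: int \<times> int \<Rightarrow> complex) = (\<integral>\<^sup>+m. l2_energy (\<lambda>n. c (m, n)) \<partial>count_space UNIV)"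
  unfolding energy_def by (rule nn_integral_fst_count_space[symmetric])

lemma energy_iterated:
  fixes f :: "real \<times> real \<Rightarrow> complex"
  assumes [measurable]: "f \<in> borel_measurable borel"
  shows "energy lborel f = (\<integral>\<^sup>+t. energy lborel (\<lambda>s. f (s, t)) \<partial>lborel)"
proof -
  have [measurable]: "f \<in> borel_measurable (lborel \<Otimes>\<^sub>M lborel)" by (simp add: lborel_prod)
  show ?thesis
    unfolding energy_def lborel_prod[symmetric]
    by (rule lborel_pair.nn_integral_snd[symmetric]) measurable
qed

section \<open>The Gram matrix of the grid and bounds uniform in r \<le> 1\<close>

locale riesz_grid = X: riesz_nodes x B + Y: riesz_nodes y B' for x B y B'
begin

definition gram2 :: "real \<Rightarrow> int \<times> int \<Rightarrow> int \<times> int \<Rightarrow> real" where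
  "gram2 r p q = X.gram r (fst p) (fst q) * Y.gram r (snd p) (snd q)"

definition kern :: "real \<Rightarrow> real \<times> real \<Rightarrow> int \<times> int \<Rightarrow> real" where
  "kern r w q = exp (- r * (fst w - x (fst q))\<^sup>2) * exp (- r * (snd w - y (snd q))\<^sup>2)"

abbreviation gram2_sum ::
  "real \<Rightarrow> (int \<times> int) set \<Rightarrow> (int \<times> int \<Rightarrow> complex) \<Rightarrow> int \<times> int \<Rightarrow> complex" where
  "gram2_sum r J a p \<equiv> \<Sum>q\<in>J. a q * complex_of_real (gram2 r p q)"

abbreviation kern_sum ::
  "real \<Rightarrow> (int \<times> int) set \<Rightarrow> (int \<times> int \<Rightarrow> complex) \<Rightarrow> real \<times> real \<Rightarrow> complex" where
  "kern_sum r J a w \<equiv> \<Sum>q\<in>J. a q * complex_of_real (kern r w q)"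

abbreviation kern_series :: "real \<Rightarrow> (int \<times> int \<Rightarrow> complex) \<Rightarrow> real \<times> real \<Rightarrow> complex" where
  "kern_series r a w \<equiv> \<Sum>\<^sub>\<infinity>q. a q * complex_of_real (kern r w q)"

lemma integrable_weight_trig_prod:
  assumes r: "r > 0"
  shows "integrable lborel (\<lambda>u. complex_of_real (gauss_weight r u) * (trig_sum x J a u * cnj (trig_sum x K c u)))"
proof (rule Bochner_Integration.integrable_bound)
  show "integrable lborel (\<lambda>u. gauss_weight r u * ((\<Sum>j\<in>J. cmod (a j)) * (\<Sum>j\<in>K. cmod (c j))))"
    by (intro integrable_mult_left integrable_gauss_weight r)
  show "AE u in lborel. norm (complex_of_real (gauss_weight r u) * (trig_sum x J a u * cnj (trig_sum x K c u)))
    \<le> norm (gauss_weight r u * ((\<Sum>j\<in>J. cmod (a j)) * (\<Sum>j\<in>K. cmod (c j))))"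
  proof (rule AE_I2)
    fix u
    have "cmod (trig_sum x J a u) * cmod (trig_sum x K c u) \<le> (\<Sum>j\<in>J. cmod (a j)) * (\<Sum>j\<in>K. cmod (c j))"
      by (intro mult_mono norm_trig_sum_le) (auto intro: sum_nonneg)
    then have "gauss_weight r u * (cmod (trig_sum x J a u) * cmod (trig_sum x K c u))
      \<le> gauss_weight r u * ((\<Sum>j\<in>J. cmod (a j)) * (\<Sum>j\<in>K. cmod (c j)))"
      using gauss_weight_nonneg[OF r] by (rule mult_left_mono)
    then show "norm (complex_of_real (gauss_weight r u) * (trig_sum x J a u * cnj (trig_sum x K c u)))
      \<le> norm (gauss_weight r u * ((\<Sum>j\<in>J. cmod (a j)) * (\<Sum>j\<in>K. cmod (c j))))"
      using gauss_weight_nonneg[OF r, of u] by (simp add: norm_mult sum_nonneg)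
  qed
qed measurable

text \<open>The matrix is a Kronecker product. Its first factor is written as an integral over
  frequencies \<open>u\<close>; at each \<open>u\<close> the second factor is coercive on the vector
  of column sums \<open>T n u\<close>. What remains is the first quadratic form of each column
  separately.\<close>

lemma gram2_coercive:
  assumes r: "r > 0" and J: "finite J"
  shows "(gauss_weight r pi / B\<^sup>2) * (gauss_weight r pi / B'\<^sup>2) * (sq_sum a J)
    \<le> Re (\<Sum>p\<in>J. (gram2_sum r J a p) * cnj (a p))"
proof -
  define P where "P = fst ` J"
  define Q where "Q = snd ` J"
  have PQ: "finite P" "finite Q" using J by (auto simp: P_def Q_def)
  define b where "b = zero_extend J a"
  have g2: "(gram2_sum r J a p)
    = (\<Sum>j\<in>P. (\<Sum>k\<in>Q. b (j, k) * complex_of_real (Y.gram r (snd p) k)) * complex_of_real (X.gram r (fst p) j))" for p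
    unfolding gram2_def of_real_mult P_def Q_def b_def by (rule grid_sum[OF J])
  define T where "T k u = trig_sum x P (\<lambda>j. b (j, k)) u" for k u
  define \<delta> where "\<delta> = gauss_weight r pi / B\<^sup>2"
  define \<delta>' where "\<delta>' = gauss_weight r pi / B'\<^sup>2"
  have \<delta>': "0 \<le> \<delta>'" using gauss_weight_nonneg[OF r] by (simp add: \<delta>'_def)
  let ?w = "\<lambda>u. complex_of_real (gauss_weight r u)"
  define \<Phi> where "\<Phi> u = (\<Sum>n\<in>Q. (\<Sum>k\<in>Q. T k u * complex_of_real (Y.gram r n k)) * cnj (T n u))" for u
  have int: "integrable lborel (\<lambda>u. ?w u * (T k u * cnj (T n u)))" for k n
    unfolding T_def by (rule integrable_weight_trig_prod[OF r])
  have \<Phi>_eq: "?w u * \<Phi> u = (\<Sum>n\<in>Q. \<Sum>k\<in>Q. complex_of_real (Y.gram r n k) * (?w u * (T k u * cnj (T n u))))" for u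
    unfolding \<Phi>_def by (simp add: sum_distrib_left sum_distrib_right mult_ac)
  have int_\<Phi>: "integrable lborel (\<lambda>u. ?w u * \<Phi> u)"
    unfolding \<Phi>_eq by (intro Bochner_Integration.integrable_sum integrable_mult_right int)
  have "(\<Sum>p\<in>J. (gram2_sum r J a p) * cnj (a p))
    = (\<Sum>p\<in>P \<times> Q. (gram2_sum r J a p) * cnj (b p))"
    unfolding P_def Q_def b_def
    using J by (intro sum.mono_neutral_cong_left) (auto simp: zero_extend_def subset_fst_snd)
  also have "\<dots> = (\<Sum>p\<in>P \<times> Q. (\<Sum>j\<in>P. (\<Sum>k\<in>Q. b (j, k) * complex_of_real (Y.gram r (snd p) k)) * complex_of_real (X.gram r (fst p) j)) * cnj (b p))"
    unfolding g2 ..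
  also have "\<dots> = (\<Sum>m\<in>P. \<Sum>n\<in>Q. (\<Sum>j\<in>P. (\<Sum>k\<in>Q. b (j, k) * complex_of_real (Y.gram r n k)) * complex_of_real (X.gram r m j)) * cnj (b (m, n)))"
    by (simp add: sum.cartesian_product case_prod_unfold)
  also have "\<dots> = (\<Sum>n\<in>Q. \<Sum>m\<in>P. (\<Sum>k\<in>Q. (\<Sum>j\<in>P. b (j, k) * complex_of_real (X.gram r m j)) * complex_of_real (Y.gram r n k)) * cnj (b (m, n)))"
  proof -
    have "(\<Sum>j\<in>P. (\<Sum>k\<in>Q. b (j, k) * complex_of_real (Y.gram r n k)) * complex_of_real (X.gram r m j))
      = (\<Sum>k\<in>Q. (\<Sum>j\<in>P. b (j, k) * complex_of_real (X.gram r m j)) * complex_of_real (Y.gram r n k))" for m n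
      by (rule grid_sum_swap)
    then show ?thesis by (simp only:) (rule sum.swap)
  qed
  also have "\<dots> = (\<Sum>n\<in>Q. \<Sum>k\<in>Q. complex_of_real (Y.gram r n k) * (\<Sum>m\<in>P. (\<Sum>j\<in>P. b (j, k) * complex_of_real (X.gram r m j)) * cnj (b (m, n))))"
    by (simp add: sum_distrib_left sum_distrib_right sum.swap[of _ Q P] mult_ac)
  also have "\<dots> = (\<Sum>n\<in>Q. \<Sum>k\<in>Q. complex_of_real (Y.gram r n k) * (\<integral>u. ?w u * (T k u * cnj (T n u)) \<partial>lborel))"
    unfolding T_def mult.assoc[symmetric] X.gram_quadratic_form[OF r] ..
  also have "\<dots> = (\<integral>u. ?w u * \<Phi> u \<partial>lborel)"
    unfolding \<Phi>_eq
    by (subst Bochner_Integration.integral_sum, intro Bochner_Integration.integrable_sum integrable_mult_right int)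
       (subst Bochner_Integration.integral_sum, intro integrable_mult_right int, simp)
  finally have "Re (\<Sum>p\<in>J. (gram2_sum r J a p) * cnj (a p)) = Re (\<integral>u. ?w u * \<Phi> u \<partial>lborel)"
    by simp
  also have "\<dots> = (\<integral>u. Re (?w u * \<Phi> u) \<partial>lborel)"
    by (rule integral_Re[symmetric, OF int_\<Phi>])
  also have "\<dots> \<ge> (\<integral>u. (\<Sum>n\<in>Q. \<delta>' * (gauss_weight r u * (cmod (T n u))\<^sup>2)) \<partial>lborel)"
  proof (rule integral_mono)
    show "integrable lborel (\<lambda>u. \<Sum>n\<in>Q. \<delta>' * (gauss_weight r u * (cmod (T n u))\<^sup>2))"
      unfolding T_def by (intro Bochner_Integration.integrable_sum integrable_mult_right X.integrable_weight_trig_sum_sq r)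
    show "integrable lborel (\<lambda>u. Re (?w u * \<Phi> u))" by (rule integrable_Re[OF int_\<Phi>])
    fix u
    have "\<delta>' * (\<Sum>n\<in>Q. (cmod (T n u))\<^sup>2) \<le> Re (\<Phi> u)"
      unfolding \<Phi>_def \<delta>'_def by (rule Y.gram_coercive[OF r PQ(2)])
    then have "gauss_weight r u * (\<delta>' * (\<Sum>n\<in>Q. (cmod (T n u))\<^sup>2)) \<le> gauss_weight r u * Re (\<Phi> u)"
      using gauss_weight_nonneg[OF r] by (rule mult_left_mono)
    then show "(\<Sum>n\<in>Q. \<delta>' * (gauss_weight r u * (cmod (T n u))\<^sup>2)) \<le> Re (?w u * \<Phi> u)"
      by (simp add: sum_distrib_left mult_ac)
  qed
  also have "(\<integral>u. (\<Sum>n\<in>Q. \<delta>' * (gauss_weight r u * (cmod (T n u))\<^sup>2)) \<partial>lborel)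
    = (\<Sum>n\<in>Q. \<delta>' * (\<integral>u. gauss_weight r u * (cmod (T n u))\<^sup>2 \<partial>lborel))"
    unfolding T_def
    by (subst Bochner_Integration.integral_sum, intro integrable_mult_right X.integrable_weight_trig_sum_sq r) simp
  also have "\<dots> \<ge> (\<Sum>n\<in>Q. \<delta>' * (\<delta> * (\<Sum>m\<in>P. (cmod (b (m, n)))\<^sup>2)))"
    unfolding T_def X.gram_quadratic_form_real[OF r] \<delta>_def
    by (intro sum_mono mult_left_mono X.gram_coercive[OF r PQ(1)] \<delta>')
  also have "(\<Sum>n\<in>Q. \<delta>' * (\<delta> * (\<Sum>m\<in>P. (cmod (b (m, n)))\<^sup>2))) = \<delta> * \<delta>' * (\<Sum>m\<in>P. \<Sum>n\<in>Q. (cmod (b (m, n)))\<^sup>2)"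
    by (simp add: sum_distrib_left sum.swap[of _ P Q] mult_ac)
  also have "(\<Sum>m\<in>P. \<Sum>n\<in>Q. (cmod (b (m, n)))\<^sup>2) = (sq_sum a J)"
    unfolding P_def Q_def b_def by (rule sum_zero_extend_sq[OF J])
  finally show ?thesis by (simp only: \<delta>_def \<delta>'_def)
qed

lemma coercive_gram2:
  assumes r: "r > 0"
  obtains M where "coercive_matrix (gram2 r) M ((gauss_weight r pi / B\<^sup>2) * (gauss_weight r pi / B'\<^sup>2))"
proof -
  obtain M where M: "\<And>i J. finite J \<Longrightarrow> (\<Sum>j\<in>J. X.gram r i j) \<le> M"
    using X.gram_row_bound[OF r] by blast
  obtain N where N: "\<And>i J. finite J \<Longrightarrow> (\<Sum>j\<in>J. Y.gram r i j) \<le> N"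
    using Y.gram_row_bound[OF r] by blast
  have "coercive_matrix (gram2 r) (M * N) ((gauss_weight r pi / B\<^sup>2) * (gauss_weight r pi / B'\<^sup>2))"
  proof
    show "0 < (gauss_weight r pi / B\<^sup>2) * (gauss_weight r pi / B'\<^sup>2)"
      using gauss_weight_pos[OF r] X.B_pos Y.B_pos by simp
    show "gram2 r i j = gram2 r j i" "0 \<le> gram2 r i j" for i j
      by (simp_all add: gram2_def X.gram_def Y.gram_def power2_commute)
    show "(\<Sum>q\<in>J. gram2 r p q) \<le> M * N" if "finite J" for p J
      unfolding gram2_def using that
      by (intro grid_sum_le M N) (simp_all add: X.gram_def Y.gram_def)
    show "(gauss_weight r pi / B\<^sup>2) * (gauss_weight r pi / B'\<^sup>2) * (sq_sum a J)
      \<le> Re (\<Sum>p\<in>J. (gram2_sum r J a p) * cnj (a p))"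
      if "finite J" for J a by (rule gram2_coercive[OF r that])
  qed
  then show thesis by (rule that)
qed

lemma kern_bound:
  assumes r: "r > 0"
  obtains M where "\<And>J. finite J \<Longrightarrow> (\<Sum>q\<in>J. kern r w q) \<le> M"
proof -
  obtain M where M: "\<And>J. finite J \<Longrightarrow> (\<Sum>j\<in>J. exp (- r * (fst w - x j)\<^sup>2)) \<le> M"
    using X.gauss_row_bound[OF r] by blast
  obtain N where N: "\<And>J. finite J \<Longrightarrow> (\<Sum>j\<in>J. exp (- r * (snd w - y j)\<^sup>2)) \<le> N"
    using Y.gauss_row_bound[OF r] by blast
  have "(\<Sum>q\<in>J. kern r w q) \<le> M * N" if "finite J" for J
    unfolding kern_def using that by (intro grid_sum_le M N) auto
  then show thesis by (rule that)
qed

lemma kern_has_sum: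
  assumes r: "r > 0" and a: "\<And>q. cmod (a q) \<le> K"
  shows "((\<lambda>q. a q * complex_of_real (kern r w q)) has_sum (kern_series r a w)) UNIV"
proof (rule has_sum_infsum, rule abs_summable_summable, rule nonneg_bdd_above_summable_on)
  obtain M where M: "\<And>J. finite J \<Longrightarrow> (\<Sum>q\<in>J. kern r w q) \<le> M"
    using kern_bound[OF r] by blast
  have K: "0 \<le> K" using a norm_ge_zero order_trans by blast
  have le: "(\<Sum>q\<in>J. cmod (a q * complex_of_real (kern r w q))) \<le> K * M" if J: "finite J" for J
  proof -
    have "(\<Sum>q\<in>J. cmod (a q * complex_of_real (kern r w q))) \<le> (\<Sum>q\<in>J. K * kern r w q)"
      using a by (intro sum_mono) (auto simp: norm_mult kern_def mult_right_mono)
    also have "\<dots> \<le> K * M" using M[OF J] K by (simp add: sum_distrib_left[symmetric] mult_left_mono)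
    finally show ?thesis .
  qed
  show "bdd_above (sum (\<lambda>q. cmod (a q * complex_of_real (kern r w q))) ` {F. F \<subseteq> UNIV \<and> finite F})"
    by (rule bdd_aboveI2[where M = "K * M"], rule le) simp
qed simp

lemma measurable_kern [measurable]: "(\<lambda>w. kern r w q) \<in> borel_measurable borel"
proof -
  have "continuous_on UNIV (\<lambda>w. kern r w q)"
    unfolding kern_def by (intro continuous_intros)
  then show ?thesis by (rule borel_measurable_continuous_onI)
qed

text \<open>The bounds in the plane follow from those on the line, applied to one variable at a time.\<close>

lemma interpolant_bound_finite_2:
  obtains C where "C > 0"
    and "\<And>r J a w. 0 < r \<Longrightarrow> r \<le> 1 \<Longrightarrow> finite J \<Longrightarrow>
      ennreal ((cmod (kern_sum r J a w))\<^sup>2)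
        \<le> ennreal C * l2_energy (gram2_sum r J a)"
    and "\<And>r J a. 0 < r \<Longrightarrow> r \<le> 1 \<Longrightarrow> finite J \<Longrightarrow>
      energy lborel (kern_sum r J a)
        \<le> ennreal C * l2_energy (gram2_sum r J a)"
proof -
  obtain C where C0: "C > 0"
    and C: "\<And>r J a t. 0 < r \<Longrightarrow> r \<le> 1 \<Longrightarrow> finite J \<Longrightarrow>
      ennreal ((cmod (X.gauss_sum r J a t))\<^sup>2)
        \<le> ennreal C * l2_energy (X.gram_sum r J a)"
      "\<And>r J a. 0 < r \<Longrightarrow> r \<le> 1 \<Longrightarrow> finite J \<Longrightarrow>
      energy lborel (\<lambda>t. \<Sum>j\<in>J. a j * complex_of_real (exp (- r * (t - x j)\<^sup>2)))
        \<le> ennreal C * l2_energy (X.gram_sum r J a)"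
    using X.interpolant_bound_finite by blast
  obtain D where D0: "D > 0"
    and D: "\<And>r J a t. 0 < r \<Longrightarrow> r \<le> 1 \<Longrightarrow> finite J \<Longrightarrow>
      ennreal ((cmod (Y.gauss_sum r J a t))\<^sup>2)
        \<le> ennreal D * l2_energy (Y.gram_sum r J a)"
      "\<And>r J a. 0 < r \<Longrightarrow> r \<le> 1 \<Longrightarrow> finite J \<Longrightarrow>
      energy lborel (\<lambda>t. \<Sum>j\<in>J. a j * complex_of_real (exp (- r * (t - y j)\<^sup>2)))
        \<le> ennreal D * l2_energy (Y.gram_sum r J a)"
    using Y.interpolant_bound_finite by blast
  have main: "ennreal ((cmod (kern_sum r J a w))\<^sup>2)
        \<le> ennreal (C * D) * l2_energy (gram2_sum r J a) \<and>
      energy lborel (kern_sum r J a)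
        \<le> ennreal (C * D) * l2_energy (gram2_sum r J a)"
    if r: "0 < r" "r \<le> 1" and J: "finite J" for r J a w
  proof -
    define P where "P = fst ` J"
    define Q where "Q = snd ` J"
    have PQ: "finite P" "finite Q" using J by (auto simp: P_def Q_def)
    define b where "b = zero_extend J a"
    have g2: "(gram2_sum r J a p)
    = (\<Sum>j\<in>P. (\<Sum>k\<in>Q. b (j, k) * complex_of_real (Y.gram r (snd p) k)) * complex_of_real (X.gram r (fst p) j))" for p
    unfolding gram2_def of_real_mult P_def Q_def b_def by (rule grid_sum[OF J])
    \<comment> \<open>\<open>c m k\<close> are the coefficients in the second variable once the
      first is restricted to the node of index \<open>m\<close>. As a function of \<open>t\<close>
      they generate the data of the first-variable problem at that node, and the values of this
      function at the nodes of \<open>y\<close> are the full data.\<close>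
    define c where "c m k = (\<Sum>j\<in>P. b (j, k) * complex_of_real (X.gram r m j))" for m k
    define e where "e t k = complex_of_real (exp (- r * (t - y k)\<^sup>2))" for t k
    define L where "L = l2_energy (gram2_sum r J a)"
    have kern: "(kern_sum r J a (s, t))
      = (\<Sum>j\<in>P. (\<Sum>k\<in>Q. b (j, k) * e t k) * complex_of_real (exp (- r * (s - x j)\<^sup>2)))" for s t
      unfolding kern_def of_real_mult P_def Q_def b_def e_def fst_conv snd_conv by (rule grid_sum[OF J])
    have mixed: "(\<Sum>j\<in>P. (\<Sum>k\<in>Q. b (j, k) * e t k) * complex_of_real (X.gram r m j)) = (\<Sum>k\<in>Q. c m k * e t k)" for m t
      unfolding c_def by (rule grid_sum_swap)
    have full: "(gram2_sum r J a (m, n)) = (\<Sum>k\<in>Q. c m k * complex_of_real (Y.gram r n k))" for m n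
      unfolding g2 c_def fst_conv snd_conv by (rule grid_sum_swap)
    have L: "(\<integral>\<^sup>+m. l2_energy (\<lambda>n. \<Sum>k\<in>Q. c m k * complex_of_real (Y.gram r n k)) \<partial>count_space UNIV) = L"
      unfolding L_def l2_energy_iterated full ..
    have CD: "ennreal (C * D) * L = ennreal C * (\<integral>\<^sup>+m. ennreal D * l2_energy (\<lambda>n. \<Sum>k\<in>Q. c m k * complex_of_real (Y.gram r n k)) \<partial>count_space UNIV)"
      using C0 D0 by (subst nn_integral_cmult) (simp_all add: L ennreal_mult mult.assoc)
    have pt: "ennreal ((cmod (kern_sum r J a (s, t)))\<^sup>2) \<le> ennreal (C * D) * L" for s t
    proof -
      have "ennreal ((cmod (kern_sum r J a (s, t)))\<^sup>2)
        \<le> ennreal C * l2_energy (\<lambda>m. \<Sum>k\<in>Q. c m k * e t k)"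
        unfolding kern mixed[symmetric] by (rule C(1)[OF r PQ(1)])
      also have "\<dots> = ennreal C * (\<integral>\<^sup>+m. ennreal ((cmod (\<Sum>k\<in>Q. c m k * e t k))\<^sup>2) \<partial>count_space UNIV)"
        unfolding energy_def ..
      also have "\<dots> \<le> ennreal C * (\<integral>\<^sup>+m. ennreal D * l2_energy (\<lambda>n. \<Sum>k\<in>Q. c m k * complex_of_real (Y.gram r n k)) \<partial>count_space UNIV)"
        unfolding e_def by (intro mult_left_mono nn_integral_mono D(1)[OF r PQ(2)]) simp
      finally show ?thesis unfolding CD .
    qed
    have "(kern_sum r J a) \<in> borel_measurable borel" by measurable
    then have "energy lborel (kern_sum r J a)
      = (\<integral>\<^sup>+t. energy lborel (\<lambda>s. \<Sum>q\<in>J. a q * complex_of_real (kern r (s, t) q)) \<partial>lborel)"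
      by (rule energy_iterated)
    also have "\<dots> \<le> (\<integral>\<^sup>+t. ennreal C * l2_energy (\<lambda>m. \<Sum>k\<in>Q. c m k * e t k) \<partial>lborel)"
      unfolding kern mixed[symmetric] by (intro nn_integral_mono C(2)[OF r PQ(1)])
    also have "\<dots> = (\<integral>\<^sup>+t. \<integral>\<^sup>+m. ennreal C * ennreal ((cmod (\<Sum>k\<in>Q. c m k * e t k))\<^sup>2) \<partial>count_space UNIV \<partial>lborel)"
      unfolding energy_def by (simp add: nn_integral_cmult)
    \<comment> \<open>Exchanging the sum over the nodes of \<open>x\<close> with the integral over
      \<open>t\<close> prepares the second one-variable bound, which is applied for each
      \<open>m\<close>.\<close>
    also have "\<dots> = (\<integral>\<^sup>+m. \<integral>\<^sup>+t. ennreal C * ennreal ((cmod (\<Sum>k\<in>Q. c m k * e t k))\<^sup>2) \<partial>lborel \<partial>count_space UNIV)"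
      unfolding e_def by (rule nn_integral_count_space_nn_integral) (simp, measurable)
    also have "\<dots> = (\<integral>\<^sup>+m. ennreal C * energy lborel (\<lambda>t. \<Sum>k\<in>Q. c m k * e t k) \<partial>count_space UNIV)"
      unfolding energy_def e_def by (intro nn_integral_cong nn_integral_cmult) measurable
    also have "\<dots> = ennreal C * (\<integral>\<^sup>+m. energy lborel (\<lambda>t. \<Sum>k\<in>Q. c m k * e t k) \<partial>count_space UNIV)"
      by (rule nn_integral_cmult) simp
    also have "\<dots> \<le> ennreal C * (\<integral>\<^sup>+m. ennreal D * l2_energy (\<lambda>n. \<Sum>k\<in>Q. c m k * complex_of_real (Y.gram r n k)) \<partial>count_space UNIV)"
      unfolding e_def by (intro mult_left_mono nn_integral_mono D(2)[OF r PQ(2)]) simp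
    finally have en: "energy lborel (kern_sum r J a) \<le> ennreal (C * D) * L"
      unfolding CD .
    show ?thesis using pt[of "fst w" "snd w"] en by (simp add: L_def)
  qed
  have "C * D > 0" using C0 D0 by simp
  then show thesis by (rule that) (use main in blast)+
qed

text \<open>Truncation and Fatou as on the line; the constant doubles because the truncation error
  is separated from the data \<open>f\<close>.\<close>

lemma interpolant_bound_2:
  obtains C where "C > 0"
    and "\<And>r a S f w. 0 < r \<Longrightarrow> r \<le> 1 \<Longrightarrow> l2_le a S \<Longrightarrow>
      (\<And>p. ((\<lambda>q. a q * complex_of_real (gram2 r p q)) has_sum f p) UNIV) \<Longrightarrow>
      ennreal ((cmod (kern_series r a w))\<^sup>2) \<le> ennreal C * l2_energy f \<and>
      energy lborel (kern_series r a) \<le> ennreal C * l2_energy f \<and>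
      (kern_series r a) \<in> borel_measurable borel"
proof -
  obtain C where C0: "C > 0"
    and C: "\<And>r J a w. 0 < r \<Longrightarrow> r \<le> 1 \<Longrightarrow> finite J \<Longrightarrow>
      ennreal ((cmod (kern_sum r J a w))\<^sup>2)
        \<le> ennreal C * l2_energy (gram2_sum r J a)"
      "\<And>r J a. 0 < r \<Longrightarrow> r \<le> 1 \<Longrightarrow> finite J \<Longrightarrow>
      energy lborel (kern_sum r J a)
        \<le> ennreal C * l2_energy (gram2_sum r J a)"
    using interpolant_bound_finite_2 by blast
  have main: "ennreal ((cmod (kern_series r a w))\<^sup>2) \<le> ennreal (2 * C) * l2_energy f \<and>
      energy lborel (kern_series r a) \<le> ennreal (2 * C) * l2_energy f \<and>
      (kern_series r a) \<in> borel_measurable borel"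
    if r: "0 < r" "r \<le> 1" and a: "l2_le a S"
      and f: "\<And>p. ((\<lambda>q. a q * complex_of_real (gram2 r p q)) has_sum f p) UNIV" for r a S f w
  proof -
    obtain M where "coercive_matrix (gram2 r) M ((gauss_weight r pi / B\<^sup>2) * (gauss_weight r pi / B'\<^sup>2))"
      using coercive_gram2[OF r(1)] by blast
    then interpret coercive_matrix "gram2 r" M "(gauss_weight r pi / B\<^sup>2) * (gauss_weight r pi / B'\<^sup>2)" .
    have app_a: "app a = f" by (rule app_unique[OF f])
    have f_l2: "l2_le f (M\<^sup>2 * S)" using Schur_l2_le[OF a] by (simp add: app_a)
    have f_fin: "l2_energy f < \<infinity>"
      using f_l2 square_summable_iff_l2_le square_summable_iff_energy by blast
    define R where "R = enn2real (l2_energy f)"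
    have R: "ennreal R = l2_energy f" using f_fin unfolding R_def by (intro ennreal_enn2real) simp
    have R0: "0 \<le> R" by (simp add: R_def)
    have fR: "l2_le f R" unfolding R_def by (rule l2_le_of_energy[OF f_fin])
    obtain J \<epsilon> where J: "\<And>n. finite (J n)" "filterlim J (finite_subsets_at_top UNIV) sequentially"
      and \<epsilon>: "\<epsilon> \<longlonglongrightarrow> 0" "\<And>n. l2_le (\<lambda>j. if j \<in> J n then 0 else a j) (\<epsilon> n)"
      using l2_truncation[OF a] by blast
    let ?P = "\<lambda>n. C * (2 * (M\<^sup>2 * \<epsilon> n) + 2 * R)"
    have l2: "l2_le (gram2_sum r (J n) a) (2 * (M\<^sup>2 * \<epsilon> n) + 2 * R)" for n
    proof -
      have "l2_le (\<lambda>p. ((gram2_sum r (J n) a p) - app a p) + f p) (2 * (M\<^sup>2 * \<epsilon> n) + 2 * R)"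
        by (intro l2_le_add app_truncation[OF a J(1) \<epsilon>(2)] fR)
      then show ?thesis by (simp add: app_a)
    qed
    have le_P: "ennreal C * l2_energy (gram2_sum r (J n) a) \<le> ennreal (?P n)" for n
    proof -
      have "0 \<le> 2 * (M\<^sup>2 * \<epsilon> n) + 2 * R" by (rule l2_le_nonneg[OF l2])
      then show ?thesis
        using l2[of n] C0 by (subst ennreal_mult) (auto intro!: mult_left_mono simp: l2_le_energy)
    qed
    have lim: "(\<lambda>n. \<Sum>q\<in>J n. a q * complex_of_real (kern r w q)) \<longlonglongrightarrow> (kern_series r a w)" for w
      by (rule filterlim_compose[OF kern_has_sum[OF r(1) l2_le_cmod_le[OF a], unfolded has_sum_def] J(2)])
    have "?P \<longlonglongrightarrow> C * (2 * (M\<^sup>2 * 0) + 2 * R)" by (intro tendsto_intros \<epsilon>(1))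
    then have P_lim: "(\<lambda>n. ennreal (?P n)) \<longlonglongrightarrow> ennreal (C * (2 * (M\<^sup>2 * 0) + 2 * R))"
      by (rule tendsto_ennrealI)
    have eq: "ennreal (C * (2 * (M\<^sup>2 * 0) + 2 * R)) = ennreal (2 * C) * l2_energy f"
    proof -
      have "C * (2 * (M\<^sup>2 * 0) + 2 * R) = (2 * C) * R" by simp
      then show ?thesis unfolding R[symmetric] using C0 R0 by (simp only: ennreal_mult)
    qed
    have meas: "(kern_sum r (J n) a) \<in> borel_measurable borel" for n
      by measurable
    have "(\<lambda>n. ennreal ((cmod (kern_sum r (J n) a w))\<^sup>2))
      \<longlonglongrightarrow> ennreal ((cmod (kern_series r a w))\<^sup>2)"
      by (intro tendsto_ennrealI tendsto_power tendsto_norm lim)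
    then have "ennreal ((cmod (kern_series r a w))\<^sup>2) \<le> ennreal (2 * C) * l2_energy f"
      unfolding eq[symmetric]
      by (rule LIMSEQ_le[OF _ P_lim]) (use order_trans[OF C(1)[OF r J(1)] le_P] in blast)
    moreover have "energy lborel (kern_series r a) \<le> ennreal (2 * C) * l2_energy f"
      unfolding eq[symmetric]
    proof (rule energy_Fatou[OF _ _ _ P_lim])
      show "(\<lambda>n. \<Sum>q\<in>J n. a q * complex_of_real (kern r w q)) \<longlonglongrightarrow> (kern_series r a w)" for w
        by (rule lim)
      show "energy lborel (kern_sum r (J n) a) \<le> ennreal (?P n)" for n
        by (rule order_trans[OF C(2)[OF r J(1)] le_P])
    qed (use meas in simp)
    moreover have "(kern_series r a) \<in> borel_measurable borel"
      by (rule borel_measurable_LIMSEQ_metric[OF meas lim])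
    ultimately show ?thesis by blast
  qed
  have "2 * C > 0" using C0 by simp
  then show thesis by (rule that) (use main in blast)
qed

end

section \<open>Tensor products and square-integrable spectra on the square\<close>

lemma energy_dominated_tendsto:
  assumes [measurable]: "\<And>n. f n \<in> borel_measurable M" "g \<in> borel_measurable M" "u \<in> borel_measurable M"
    and lim: "\<And>t. (\<lambda>n. f n t) \<longlonglongrightarrow> g t"
    and le: "\<And>n t. cmod (f n t) \<le> K * cmod (u t)" and u: "energy M u < \<infinity>"
  shows "(\<lambda>n. energy M (\<lambda>t. g t - f n t)) \<longlonglongrightarrow> 0"
proof -
  have le_g: "cmod (g t) \<le> K * cmod (u t)" for t
    by (rule LIMSEQ_le_const2[OF tendsto_norm[OF lim]]) (use le in auto)
  have le2: "(cmod (g t - f n t))\<^sup>2 \<le> (4 * K\<^sup>2) * (cmod (u t))\<^sup>2" for n t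
  proof -
    have "cmod (g t - f n t) \<le> 2 * (K * cmod (u t))"
      using norm_triangle_ineq4[of "g t" "f n t"] le_g[of t] le[of n t] by linarith
    then have "(cmod (g t - f n t))\<^sup>2 \<le> (2 * (K * cmod (u t)))\<^sup>2" by (intro power_mono) auto
    then show ?thesis by (simp add: power_mult_distrib mult.assoc)
  qed
  have "(\<lambda>n. \<integral>\<^sup>+t. ennreal ((cmod (g t - f n t))\<^sup>2) \<partial>M) \<longlonglongrightarrow> (\<integral>\<^sup>+t. 0 \<partial>M)"
  proof (rule nn_integral_dominated_convergence[where w = "\<lambda>t. ennreal (4 * K\<^sup>2) * ennreal ((cmod (u t))\<^sup>2)"])
    show "AE t in M. ennreal ((cmod (g t - f n t))\<^sup>2) \<le> ennreal (4 * K\<^sup>2) * ennreal ((cmod (u t))\<^sup>2)" for n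
      using le2 by (intro AE_I2) (simp add: ennreal_leI flip: ennreal_mult)
    show "(\<integral>\<^sup>+t. ennreal (4 * K\<^sup>2) * ennreal ((cmod (u t))\<^sup>2) \<partial>M) < \<infinity>"
      using u by (subst nn_integral_cmult) (auto simp: energy_def ennreal_mult_less_top)
    show "AE t in M. (\<lambda>n. ennreal ((cmod (g t - f n t))\<^sup>2)) \<longlonglongrightarrow> 0"
    proof (rule AE_I2)
      fix t
      have "(\<lambda>n. ennreal ((cmod (g t - f n t))\<^sup>2)) \<longlonglongrightarrow> ennreal ((cmod (g t - g t))\<^sup>2)"
        by (intro tendsto_ennrealI tendsto_intros lim)
      then show "(\<lambda>n. ennreal ((cmod (g t - f n t))\<^sup>2)) \<longlonglongrightarrow> 0" by simp
    qed
  qed measurable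
  then show ?thesis by (simp add: energy_def)
qed

lemma integral_tensor:
  fixes f g :: "real \<Rightarrow> complex"
  assumes f: "integrable lborel f" and g: "integrable lborel g"
  shows "integrable lborel (\<lambda>p. f (fst p) * g (snd p))"
    and "(\<integral>p. f (fst p) * g (snd p) \<partial>lborel) = (\<integral>s. f s \<partial>lborel) * (\<integral>t. g t \<partial>lborel)"
proof -
  have [measurable]: "f \<in> borel_measurable borel" "g \<in> borel_measurable borel" using f g by auto
  have int: "integrable (lborel \<Otimes>\<^sub>M lborel) (\<lambda>(s, t). f s * g t)"
  proof (rule lborel_pair.Fubini_integrable)
    show "integrable lborel (\<lambda>s. \<integral>t. norm (case (s, t) of (s, t) \<Rightarrow> f s * g t) \<partial>lborel)"
      using f g by (simp add: norm_mult)
    show "AE s in lborel. integrable lborel (\<lambda>t. case (s, t) of (s, t) \<Rightarrow> f s * g t)"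
      using g by (intro AE_I2) simp
  qed measurable
  then show "integrable lborel (\<lambda>p. f (fst p) * g (snd p))"
    by (simp add: lborel_prod case_prod_unfold)
  have "(\<integral>p. f (fst p) * g (snd p) \<partial>lborel) = (\<integral>p. (case p of (s, t) \<Rightarrow> f s * g t) \<partial>(lborel \<Otimes>\<^sub>M lborel))"
    by (simp add: lborel_prod case_prod_unfold)
  also have "\<dots> = (\<integral>s. (\<integral>t. f s * g t \<partial>lborel) \<partial>lborel)"
    using lborel_pair.integral_fst'[OF int] by simp
  finally show "(\<integral>p. f (fst p) * g (snd p) \<partial>lborel) = (\<integral>s. f s \<partial>lborel) * (\<integral>t. g t \<partial>lborel)" by simp
qed

lemma ift_tensor:
  fixes f g :: "real \<Rightarrow> complex"
  assumes f: "integrable lborel f" and g: "integrable lborel g"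
  shows "ift (\<lambda>p. f (fst p) * g (snd p)) (s, t) = ift f s * ift g t"
proof -
  have "ift (\<lambda>p. f (fst p) * g (snd p)) (s, t)
    = (\<integral>p. (f (fst p) * cis (s * fst p)) * (g (snd p) * cis (t * snd p)) \<partial>lborel)"
    unfolding ift_def
    by (intro Bochner_Integration.integral_cong refl) (simp add: inner_prod_def cis_mult[symmetric] mult_ac)
  also have "\<dots> = (\<integral>p. f p * cis (s * p) \<partial>lborel) * (\<integral>p. g p * cis (t * p) \<partial>lborel)"
    by (rule integral_tensor(2)) (intro integrable_mult_cis f g, measurable)+
  finally show ?thesis by (simp add: ift_def)
qed

lemma energy_tensor:
  fixes f g :: "real \<Rightarrow> complex"
  assumes [measurable]: "f \<in> borel_measurable borel" "g \<in> borel_measurable borel"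
  shows "energy lborel (\<lambda>p. f (fst p) * g (snd p)) = energy lborel f * energy lborel g"
proof -
  have "energy lborel (\<lambda>p. f (fst p) * g (snd p)) = (\<integral>\<^sup>+t. energy lborel (\<lambda>s. g t * f s) \<partial>lborel)"
    by (subst energy_iterated) (simp_all add: mult.commute borel_prod[symmetric])
  also have "\<dots> = (\<integral>\<^sup>+t. ennreal ((cmod (g t))\<^sup>2) * energy lborel f \<partial>lborel)"
    by (subst energy_scale) auto
  also have "\<dots> = energy lborel g * energy lborel f"
    by (subst nn_integral_multc) (auto simp: energy_def)
  finally show ?thesis by (simp add: mult.commute)
qed

definition band :: "(real \<times> real) set" where
  "band = {-pi..pi} \<times> {-pi..pi}"

text \<open>A property of the spectrum rather than of the function. It vanishes at every point
  outside the square, so that decompositions and dominations hold without exceptional null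
  sets.\<close>

definition bandlimited :: "(real \<times> real \<Rightarrow> complex) \<Rightarrow> bool" where
  "bandlimited G \<longleftrightarrow> G \<in> borel_measurable borel \<and> (\<forall>p. p \<notin> band \<longrightarrow> G p = 0) \<and> energy lborel G < \<infinity>"

lemma band_sets [measurable]: "band \<in> sets borel"
  unfolding band_def by (intro borel_closed closed_Times) auto

lemma emeasure_band: "emeasure lborel band = ennreal ((2 * pi)\<^sup>2)"
proof -
  have "emeasure lborel band = emeasure (lborel \<Otimes>\<^sub>M lborel) ({-pi..pi} \<times> {-pi..pi::real})"
    by (simp only: band_def lborel_prod)
  also have "\<dots> = ennreal (2 * pi) * ennreal (2 * pi)"
    by (subst lborel.emeasure_pair_measure_Times) auto
  also have "\<dots> = ennreal ((2 * pi)\<^sup>2)"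
    unfolding power2_eq_square by (rule ennreal_mult[symmetric]) auto
  finally show ?thesis .
qed

lemma bandlimited_measurable: "bandlimited G \<Longrightarrow> G \<in> borel_measurable borel"
  by (simp add: bandlimited_def)

lemma bandlimited_outside: "bandlimited G \<Longrightarrow> p \<notin> band \<Longrightarrow> G p = 0"
  unfolding bandlimited_def by blast

lemma bandlimited_energy: "bandlimited G \<Longrightarrow> energy lborel G < \<infinity>"
  by (simp add: bandlimited_def)

lemma bandlimited_square_integrable: "bandlimited G \<Longrightarrow> square_integrable lborel G"
  by (simp add: bandlimited_def square_integrable_iff_energy)

lemma bandlimited_add:
  assumes "bandlimited F" "bandlimited G" shows "bandlimited (\<lambda>p. F p + G p)"
proof -
  have [measurable]: "F \<in> borel_measurable borel" "G \<in> borel_measurable borel"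
    using assms by (auto simp: bandlimited_def)
  have "energy lborel (\<lambda>p. F p + G p) \<le> 2 * energy lborel F + 2 * energy lborel G"
    by (rule energy_add_le) auto
  also have "\<dots> < \<infinity>" using assms by (simp add: bandlimited_def ennreal_mult_less_top)
  finally show ?thesis using assms by (auto simp: bandlimited_def)
qed

lemma bandlimited_scale:
  assumes "bandlimited G" shows "bandlimited (\<lambda>p. c * G p)"
proof -
  have [measurable]: "G \<in> borel_measurable borel" using assms by (rule bandlimited_measurable)
  have "energy lborel (\<lambda>p. c * G p) = ennreal ((cmod c)\<^sup>2) * energy lborel G" by (rule energy_scale) simp
  also have "\<dots> < \<infinity>" using bandlimited_energy[OF assms] by (simp add: ennreal_mult_less_top)
  finally show ?thesis using bandlimited_outside[OF assms] by (simp add: bandlimited_def)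
qed

lemma bandlimited_diff:
  assumes "bandlimited F" "bandlimited G" shows "bandlimited (\<lambda>p. F p - G p)"
  using bandlimited_add[OF assms(1) bandlimited_scale[OF assms(2), of "- 1"]] by simp

lemma bandlimited_dominated:
  assumes G: "bandlimited G" and [measurable]: "F \<in> borel_measurable borel"
    and le: "\<And>p. cmod (F p) \<le> K * cmod (G p)"
  shows "bandlimited F"
proof -
  have [measurable]: "G \<in> borel_measurable borel" using G by (rule bandlimited_measurable)
  have "energy lborel F \<le> (\<integral>\<^sup>+p. ennreal (K\<^sup>2) * ennreal ((cmod (G p))\<^sup>2) \<partial>lborel)"
    unfolding energy_def
  proof (rule nn_integral_mono)
    fix p
    have "(cmod (F p))\<^sup>2 \<le> (K * cmod (G p))\<^sup>2" by (intro power_mono le) simp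
    then show "ennreal ((cmod (F p))\<^sup>2) \<le> ennreal (K\<^sup>2) * ennreal ((cmod (G p))\<^sup>2)"
      by (simp add: power_mult_distrib ennreal_leI flip: ennreal_mult)
  qed
  also have "\<dots> = ennreal (K\<^sup>2) * energy lborel G" by (simp add: nn_integral_cmult energy_def)
  also have "\<dots> < \<infinity>" using G by (simp add: bandlimited_def ennreal_mult_less_top)
  finally have "energy lborel F < \<infinity>" .
  moreover have "F p = 0" if "p \<notin> band" for p
    using le[of p] bandlimited_outside[OF G that] by simp
  ultimately show ?thesis by (simp add: bandlimited_def)
qed

lemma energy_indicator:
  assumes "X \<in> sets M"
  shows "energy M (\<lambda>p. indicator X p) = emeasure M X"
proof -
  have "energy M (\<lambda>p. indicator X p) = (\<integral>\<^sup>+p. indicator X p \<partial>M)"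
    unfolding energy_def by (intro nn_integral_cong) (simp add: indicator_def)
  then show ?thesis using assms by simp
qed

lemma bandlimited_indicator_band: "bandlimited (\<lambda>p. indicator band p)"
  unfolding bandlimited_def
proof (intro conjI)
  show "energy lborel (\<lambda>p. indicator band p :: complex) < \<infinity>"
    by (subst energy_indicator) (auto simp: emeasure_band)
qed auto

text \<open>The square has finite measure (2 pi)^2, so Cauchy--Schwarz against its indicator gives
  both integrability and a uniform bound of the transform by the energy.\<close>

lemma bandlimited_ift:
  assumes G: "bandlimited G"
  shows "integrable lborel G" and "ennreal ((cmod (ift G w))\<^sup>2) \<le> ennreal ((2 * pi)\<^sup>2) * energy lborel G"
proof -
  have [measurable]: "G \<in> borel_measurable borel" using G by (rule bandlimited_measurable)
  let ?i = "\<lambda>p. indicator band p * cis (w \<bullet> p) :: complex"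
  have sq_i: "square_integrable lborel ?i"
    using bandlimited_square_integrable[OF bandlimited_dominated[OF bandlimited_indicator_band, of ?i 1]]
    by (simp add: norm_mult)
  have sq_i1: "square_integrable lborel (\<lambda>p. indicator band p :: complex)"
    by (rule bandlimited_square_integrable[OF bandlimited_indicator_band])
  have sq_G: "square_integrable lborel G" by (rule bandlimited_square_integrable[OF G])
  have eq: "G p * indicator band p = G p" "G p * ?i p = G p * cis (w \<bullet> p)" for p
    by (cases "p \<in> band"; simp add: bandlimited_outside[OF G])+
  show "integrable lborel G"
    using Cauchy_Schwarz_integral(1)[OF sq_G sq_i1] unfolding eq .
  have E: "energy lborel G = ennreal (sq_int lborel G)" by (rule energy_eq_integral[OF sq_G])
  have "ennreal (\<integral>p. (cmod (?i p))\<^sup>2 \<partial>lborel) = energy lborel ?i" by (rule energy_eq_integral[OF sq_i, symmetric])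
  also have "\<dots> = energy lborel (\<lambda>p. indicator band p)" by (simp add: energy_def norm_mult)
  also have "\<dots> = ennreal ((2 * pi)\<^sup>2)" by (subst energy_indicator) (auto simp: emeasure_band)
  finally have "(\<integral>p. (cmod (?i p))\<^sup>2 \<partial>lborel) = (2 * pi)\<^sup>2"
    by (subst (asm) ennreal_inj) (auto intro!: integral_nonneg_AE)
  then have "(cmod (ift G w))\<^sup>2 \<le> (sq_int lborel G) * (2 * pi)\<^sup>2"
    using Cauchy_Schwarz_integral(2)[OF sq_G sq_i] unfolding eq ift_def by simp
  then have "ennreal ((cmod (ift G w))\<^sup>2) \<le> ennreal ((2 * pi)\<^sup>2 * (sq_int lborel G))"
    by (intro ennreal_leI) (simp add: mult.commute)
  then show "ennreal ((cmod (ift G w))\<^sup>2) \<le> ennreal ((2 * pi)\<^sup>2) * energy lborel G"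
    unfolding E by (subst (asm) ennreal_mult) (auto intro!: integral_nonneg_AE)
qed

text \<open>A form of \<open>upper\<close> that can be inserted under a further nonnegative
  integral.\<close>

lemma (in riesz_nodes) upper_nn:
  assumes J: "finite J"
  shows "(\<integral>\<^sup>+u. ennreal ((cmod (trig_sum x J a u))\<^sup>2) * indicator {-pi..pi} u \<partial>lborel)
    \<le> ennreal (B\<^sup>2) * ennreal (sq_sum a J)"
proof -
  have "(\<integral>\<^sup>+u. ennreal ((cmod (trig_sum x J a u))\<^sup>2) * indicator {-pi..pi} u \<partial>lborel)
    = energy cell (trig_sum x J a)"
    unfolding energy_def cell_def by (subst nn_integral_restrict_space) auto
  also have "\<dots> = ennreal (sq_int cell (trig_sum x J a))"
    by (rule energy_eq_integral[OF square_integrable_trig_sum])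
  also have "\<dots> \<le> ennreal (B\<^sup>2 * (sq_sum a J))" by (intro ennreal_leI upper J)
  finally show ?thesis by (subst (asm) ennreal_mult) (auto intro: sum_nonneg)
qed

section \<open>Interpolation on the grid as a linear operation on spectra\<close>

context riesz_grid
begin

definition node :: "int \<times> int \<Rightarrow> real \<times> real" where
  "node p = (x (fst p), y (snd p))"

lemma gaussian_node: "gaussian r (w - node q) = kern r w q"
  by (cases w) (simp add: gaussian_def node_def kern_def mult_exp_exp distrib_left)

lemma gaussian_node_node: "gaussian r (node p - node q) = gram2 r p q"
  by (simp add: gaussian_def node_def gram2_def X.gram_def Y.gram_def mult_exp_exp distrib_left)

definition trig_sum2 :: "(int \<times> int) set \<Rightarrow> (int \<times> int \<Rightarrow> complex) \<Rightarrow> real \<times> real \<Rightarrow> complex" where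
  "trig_sum2 K c p = (\<Sum>q\<in>K. c q * cis (- (node q \<bullet> p)))"

text \<open>With \<open>t\<close> frozen the sum is nonharmonic in the first variable with
  coefficients \<open>T j t\<close>; these are nonharmonic sums in the second variable. The upper
  Riesz bound is applied to the former and then to each of the latter.\<close>

lemma trig_sum2_energy:
  assumes K: "finite K"
  shows "energy lborel (\<lambda>p. indicator band p * trig_sum2 K c p)
    \<le> ennreal (B\<^sup>2 * B'\<^sup>2) * ennreal (sq_sum c K)"
proof -
  define P where "P = fst ` K"
  define Q where "Q = snd ` K"
  have PQ: "finite P" "finite Q" using K by (auto simp: P_def Q_def)
  define b where "b = zero_extend K c"
  define T where "T j t = trig_sum y Q (\<lambda>k. b (j, k)) t" for j t
  have [measurable]: "T j \<in> borel_measurable borel" for j unfolding T_def[abs_def] by measurable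
  have eq: "trig_sum2 K c (s, t) = trig_sum x P (\<lambda>j. T j t) s" for s t
  proof -
    have "trig_sum2 K c (s, t) = (\<Sum>q\<in>K. c q * (cis (- (x (fst q) * s)) * cis (- (y (snd q) * t))))"
      by (simp add: trig_sum2_def node_def cis_mult)
    also have "\<dots> = (\<Sum>j\<in>P. (\<Sum>k\<in>Q. b (j, k) * cis (- (y k * t))) * cis (- (x j * s)))"
      unfolding P_def Q_def b_def by (rule grid_sum[OF K])
    finally show ?thesis by (simp add: trig_sum_def T_def)
  qed
  have "continuous_on UNIV (trig_sum2 K c)"
    unfolding trig_sum2_def[abs_def] cis_conv_exp by (intro continuous_intros)
  then have [measurable]: "trig_sum2 K c \<in> borel_measurable borel" by (rule borel_measurable_continuous_onI)
  have "energy lborel (\<lambda>p. indicator band p * trig_sum2 K c p)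
    = (\<integral>\<^sup>+t. energy lborel (\<lambda>s. indicator band (s, t) * trig_sum2 K c (s, t)) \<partial>lborel)"
    by (rule energy_iterated) measurable
  also have "\<dots> = (\<integral>\<^sup>+t. (\<integral>\<^sup>+s. ennreal ((cmod (trig_sum x P (\<lambda>j. T j t) s))\<^sup>2) * indicator {-pi..pi} s \<partial>lborel) * indicator {-pi..pi} t \<partial>lborel)"
  proof (rule nn_integral_cong)
    fix t :: real
    show "energy lborel (\<lambda>s. indicator band (s, t) * trig_sum2 K c (s, t))
      = (\<integral>\<^sup>+s. ennreal ((cmod (trig_sum x P (\<lambda>j. T j t) s))\<^sup>2) * indicator {-pi..pi} s \<partial>lborel) * indicator {-pi..pi} t"
      unfolding energy_def eq
      by (cases "t \<in> {-pi..pi}") (auto simp: indicator_def band_def intro!: nn_integral_cong)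
  qed
  also have "\<dots> \<le> (\<integral>\<^sup>+t. (ennreal (B\<^sup>2) * ennreal (\<Sum>j\<in>P. (cmod (T j t))\<^sup>2)) * indicator {-pi..pi} t \<partial>lborel)"
    by (intro nn_integral_mono mult_right_mono X.upper_nn PQ) simp
  also have "\<dots> = (\<integral>\<^sup>+t. (\<Sum>j\<in>P. ennreal (B\<^sup>2) * (ennreal ((cmod (T j t))\<^sup>2) * indicator {-pi..pi} t)) \<partial>lborel)"
  proof -
    have "ennreal (\<Sum>j\<in>P. (cmod (T j t))\<^sup>2) = (\<Sum>j\<in>P. ennreal ((cmod (T j t))\<^sup>2))" for t
      by (rule sum_ennreal[symmetric]) simp
    then show ?thesis by (simp only: sum_distrib_left sum_distrib_right mult.assoc)
  qed
  also have "\<dots> = (\<Sum>j\<in>P. ennreal (B\<^sup>2) * (\<integral>\<^sup>+t. ennreal ((cmod (T j t))\<^sup>2) * indicator {-pi..pi} t \<partial>lborel))"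
    by (simp add: nn_integral_sum nn_integral_cmult)
  also have "\<dots> \<le> (\<Sum>j\<in>P. ennreal (B\<^sup>2) * (ennreal (B'\<^sup>2) * ennreal (\<Sum>k\<in>Q. (cmod (b (j, k)))\<^sup>2)))"
    unfolding T_def by (intro sum_mono mult_left_mono Y.upper_nn PQ) simp
  also have "\<dots> = ennreal (B\<^sup>2 * B'\<^sup>2) * ennreal (\<Sum>j\<in>P. \<Sum>k\<in>Q. (cmod (b (j, k)))\<^sup>2)"
  proof -
    have "ennreal (\<Sum>j\<in>P. \<Sum>k\<in>Q. (cmod (b (j, k)))\<^sup>2) = (\<Sum>j\<in>P. ennreal (\<Sum>k\<in>Q. (cmod (b (j, k)))\<^sup>2))"
      by (rule sum_ennreal[symmetric]) (simp add: sum_nonneg)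
    moreover have "ennreal (B\<^sup>2 * B'\<^sup>2) = ennreal (B\<^sup>2) * ennreal (B'\<^sup>2)" by (rule ennreal_mult) auto
    ultimately show ?thesis by (simp only: sum_distrib_left mult.assoc)
  qed
  also have "(\<Sum>j\<in>P. \<Sum>k\<in>Q. (cmod (b (j, k)))\<^sup>2) = (sq_sum c K)"
    unfolding P_def Q_def b_def by (rule sum_zero_extend_sq[OF K])
  finally show ?thesis .
qed

text \<open>Duality with \<open>trig_sum2_energy\<close>, as on the line: nodal values of a
  band-limited function are square summable and controlled by its spectrum.\<close>

lemma Bessel2:
  assumes G: "bandlimited G"
  shows "l2_energy (\<lambda>p. ift G (node p)) \<le> ennreal (B\<^sup>2 * B'\<^sup>2) * energy lborel G"
proof -
  have [measurable]: "G \<in> borel_measurable borel" using G by (rule bandlimited_measurable)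
  define E where "E = (sq_int lborel G)"
  have E0: "0 \<le> E" unfolding E_def by (intro integral_nonneg_AE) auto
  have sq_G: "square_integrable lborel G" by (rule bandlimited_square_integrable[OF G])
  have G_int: "integrable lborel G" by (rule bandlimited_ift(1)[OF G])
  have "(\<Sum>q\<in>K. (cmod (ift G (node q)))\<^sup>2) \<le> B\<^sup>2 * B'\<^sup>2 * E" if K: "finite K" for K
  proof -
    define c where "c q = ift G (node q)" for q
    define S where "S = (sq_sum c K)"
    have S0: "0 \<le> S" unfolding S_def by (intro sum_nonneg) auto
    let ?T = "\<lambda>p. indicator band p * cnj (trig_sum2 K c p)"
    have "continuous_on UNIV (trig_sum2 K c)"
      unfolding trig_sum2_def[abs_def] cis_conv_exp by (intro continuous_intros)
    then have [measurable]: "trig_sum2 K c \<in> borel_measurable borel" by (rule borel_measurable_continuous_onI)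
    have en: "energy lborel ?T \<le> ennreal (B\<^sup>2 * B'\<^sup>2 * S)"
    proof -
      have "energy lborel ?T = energy lborel (\<lambda>p. indicator band p * trig_sum2 K c p)"
        by (simp add: energy_def norm_mult)
      also have "\<dots> \<le> ennreal (B\<^sup>2 * B'\<^sup>2) * ennreal S" unfolding S_def by (rule trig_sum2_energy[OF K])
      also have "\<dots> = ennreal (B\<^sup>2 * B'\<^sup>2 * S)" using S0 by (intro ennreal_mult[symmetric]) auto
      finally show ?thesis .
    qed
    then have sq_T: "square_integrable lborel ?T"
      by (auto simp: square_integrable_iff_energy intro: le_less_trans)
    have T_le: "(\<integral>p. (cmod (?T p))\<^sup>2 \<partial>lborel) \<le> B\<^sup>2 * B'\<^sup>2 * S"
      using en S0 unfolding energy_eq_integral[OF sq_T] by (subst (asm) ennreal_le_iff) auto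
    have "complex_of_real S = (\<Sum>q\<in>K. cnj (c q) * c q)"
      unfolding S_def by (simp add: complex_norm_square mult.commute del: of_real_power)
    also have "\<dots> = (\<Sum>q\<in>K. \<integral>p. cnj (c q) * (G p * cis (node q \<bullet> p)) \<partial>lborel)"
      by (simp add: c_def ift_def)
    also have "\<dots> = (\<integral>p. (\<Sum>q\<in>K. cnj (c q) * (G p * cis (node q \<bullet> p))) \<partial>lborel)"
      by (intro Bochner_Integration.integral_sum[symmetric] integrable_mult_right integrable_mult_cis G_int) measurable
    also have "\<dots> = (\<integral>p. G p * ?T p \<partial>lborel)"
    proof (rule Bochner_Integration.integral_cong[OF refl])
      fix p
      have "(\<Sum>q\<in>K. cnj (c q) * (G p * cis (node q \<bullet> p))) = G p * cnj (trig_sum2 K c p)"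
        by (simp add: trig_sum2_def sum_distrib_left cis_cnj mult_ac)
      also have "\<dots> = G p * ?T p" by (cases "p \<in> band") (simp_all add: bandlimited_outside[OF G])
      finally show "(\<Sum>q\<in>K. cnj (c q) * (G p * cis (node q \<bullet> p))) = G p * ?T p" .
    qed
    finally have eq: "complex_of_real S = (\<integral>p. G p * ?T p \<partial>lborel)" .
    have "S\<^sup>2 = (cmod (complex_of_real S))\<^sup>2" by simp
    also have "\<dots> \<le> E * (\<integral>p. (cmod (?T p))\<^sup>2 \<partial>lborel)"
      unfolding eq E_def by (rule Cauchy_Schwarz_integral(2)[OF sq_G sq_T])
    also have "\<dots> \<le> E * (B\<^sup>2 * B'\<^sup>2 * S)" by (intro mult_left_mono T_le E0)
    finally have "S * S \<le> (B\<^sup>2 * B'\<^sup>2 * E) * S" by (simp add: power2_eq_square mult_ac)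
    then have "S \<le> B\<^sup>2 * B'\<^sup>2 * E"
      using S0 E0 by (cases "S = 0") (auto simp: mult_le_cancel_right)
    then show ?thesis by (simp add: S_def c_def)
  qed
  then have "l2_energy (\<lambda>p. ift G (node p)) \<le> ennreal (B\<^sup>2 * B'\<^sup>2 * E)"
    using E0 by (subst l2_energy_le_iff) auto
  then show ?thesis
    unfolding energy_eq_integral[OF sq_G] E_def[symmetric] using E0 by (subst (asm) ennreal_mult) auto
qed

text \<open>Schur's test makes the data square summable, so the solution is unique and the definite
  description denotes \<open>a\<close>. Later arguments can thus exhibit any solution they
  like.\<close>

lemma gaussian_interpolant_eq:
  assumes r: "r > 0" and a: "l2_le a S"
    and sol: "\<And>p. ((\<lambda>q. a q * complex_of_real (gram2 r p q)) has_sum F (node p)) UNIV"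
  shows "gaussian_interpolant node r F w = (kern_series r a w)"
proof -
  obtain M where "coercive_matrix (gram2 r) M ((gauss_weight r pi / B\<^sup>2) * (gauss_weight r pi / B'\<^sup>2))"
    using coercive_gram2[OF r] by blast
  then interpret coercive_matrix "gram2 r" M "(gauss_weight r pi / B\<^sup>2) * (gauss_weight r pi / B'\<^sup>2)" .
  have "app a = (\<lambda>p. F (node p))" by (rule app_unique[OF sol])
  then have "l2_le (\<lambda>p. F (node p)) (M\<^sup>2 * S)" using Schur_l2_le[OF a] by simp
  then have "square_summable (\<lambda>p. F (node p))" using square_summable_iff_l2_le by blast
  from solution_unique[OF this]
  have "interpolation_coeff node r F = a"
    unfolding interpolation_coeff_def gaussian_node_node
    by (rule the1_equality) (use a sol square_summable_iff_l2_le in blast)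
  then show ?thesis by (simp add: gaussian_interpolant_def gaussian_node)
qed

lemma solution_bandlimited:
  assumes r: "r > 0" and G: "bandlimited G"
  obtains a S where "l2_le a S"
    "\<And>p. ((\<lambda>q. a q * complex_of_real (gram2 r p q)) has_sum ift G (node p)) UNIV"
proof -
  obtain M where "coercive_matrix (gram2 r) M ((gauss_weight r pi / B\<^sup>2) * (gauss_weight r pi / B'\<^sup>2))"
    using coercive_gram2[OF r] by blast
  then interpret coercive_matrix "gram2 r" M "(gauss_weight r pi / B\<^sup>2) * (gauss_weight r pi / B'\<^sup>2)" .
  have "l2_energy (\<lambda>p. ift G (node p)) < \<infinity>"
    using bandlimited_energy[OF G] by (intro le_less_trans[OF Bessel2[OF G]]) (simp add: ennreal_mult_less_top)
  then obtain R where "l2_le (\<lambda>p. ift G (node p)) R" using l2_le_of_energy by blast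
  then obtain a S where a: "l2_le a S" "app a = (\<lambda>p. ift G (node p))" using solution_exists by blast
  have "((\<lambda>q. a q * complex_of_real (gram2 r p q)) has_sum app a p) UNIV" for p
    by (rule row_has_sum[OF l2_le_cmod_le[OF a(1)]])
  then show thesis using that a by simp
qed

definition err :: "real \<Rightarrow> (real \<times> real \<Rightarrow> complex) \<Rightarrow> real \<times> real \<Rightarrow> complex" where
  "err r G w = gaussian_interpolant node r (ift G) w - ift G w"

text \<open>The interpolant is bounded by its data and these by the spectrum through
  \<open>Bessel2\<close>; \<open>ift G\<close> itself is bounded by Plancherel and Cauchy--Schwarz.
  Uniformity in r \<le> 1 is what makes convergence stable under limits of spectra.\<close>

lemma err_bound:
  obtains C where "C > 0"
    and "\<And>r G w. 0 < r \<Longrightarrow> r \<le> 1 \<Longrightarrow> bandlimited G \<Longrightarrow>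
      ennreal ((cmod (err r G w))\<^sup>2) \<le> ennreal C * energy lborel G \<and>
      energy lborel (err r G) \<le> ennreal C * energy lborel G \<and> err r G \<in> borel_measurable borel"
proof -
  obtain C where C0: "C > 0"
    and C: "\<And>r a S f w. 0 < r \<Longrightarrow> r \<le> 1 \<Longrightarrow> l2_le a S \<Longrightarrow>
      (\<And>p. ((\<lambda>q. a q * complex_of_real (gram2 r p q)) has_sum f p) UNIV) \<Longrightarrow>
      ennreal ((cmod (kern_series r a w))\<^sup>2) \<le> ennreal C * l2_energy f \<and>
      energy lborel (kern_series r a) \<le> ennreal C * l2_energy f \<and>
      (kern_series r a) \<in> borel_measurable borel"
    using interpolant_bound_2 by blast
  define D where "D = 2 * (C * (B\<^sup>2 * B'\<^sup>2)) + 2 * (2 * pi)\<^sup>2"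
  have D0: "D > 0" using C0 by (simp add: D_def add_nonneg_pos)
  have "ennreal ((cmod (err r G w))\<^sup>2) \<le> ennreal D * energy lborel G \<and>
      energy lborel (err r G) \<le> ennreal D * energy lborel G \<and> err r G \<in> borel_measurable borel"
    if r: "0 < r" "r \<le> 1" and G: "bandlimited G" for r G w
  proof -
    have [measurable]: "G \<in> borel_measurable borel" using G by (rule bandlimited_measurable)
    obtain a S where a: "l2_le a S"
      and sol: "\<And>p. ((\<lambda>q. a q * complex_of_real (gram2 r p q)) has_sum ift G (node p)) UNIV"
      using solution_bandlimited[OF r(1) G] by blast
    define I where "I w = (kern_series r a w)" for w
    let ?E = "energy lborel G"
    have err: "err r G w = I w - ift G w" for w
      unfolding err_def I_def by (subst gaussian_interpolant_eq[OF r(1) a sol]) simp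
    have CB: "ennreal C * l2_energy (\<lambda>p. ift G (node p)) \<le> ennreal (C * (B\<^sup>2 * B'\<^sup>2)) * ?E"
      using mult_left_mono[OF Bessel2[OF G], of "ennreal C"] C0 by (simp add: ennreal_mult mult.assoc)
    have I: "ennreal ((cmod (I w))\<^sup>2) \<le> ennreal (C * (B\<^sup>2 * B'\<^sup>2)) * ?E"
      "energy lborel I \<le> ennreal (C * (B\<^sup>2 * B'\<^sup>2)) * ?E" "I \<in> borel_measurable borel" for w
      using C[OF r a sol, of w] CB unfolding I_def[abs_def] by (auto intro: order_trans)
    have DE: "2 * (ennreal (C * (B\<^sup>2 * B'\<^sup>2)) * ?E) + 2 * (ennreal ((2 * pi)\<^sup>2) * ?E) = ennreal D * ?E"
    proof -
      have "ennreal D = 2 * ennreal (C * (B\<^sup>2 * B'\<^sup>2)) + 2 * ennreal ((2 * pi)\<^sup>2)"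
        unfolding D_def using C0 by (simp add: ennreal_plus ennreal_mult)
      then show ?thesis by (simp only: distrib_right mult.assoc)
    qed
    have "(cmod (err r G w))\<^sup>2 \<le> 2 * (cmod (I w))\<^sup>2 + 2 * (cmod (ift G w))\<^sup>2"
      unfolding err using cmod_add_squared_le[of "I w" "- ift G w"] by simp
    then have "ennreal ((cmod (err r G w))\<^sup>2) \<le> ennreal (2 * (cmod (I w))\<^sup>2 + 2 * (cmod (ift G w))\<^sup>2)"
      by (rule ennreal_leI)
    also have "\<dots> = 2 * ennreal ((cmod (I w))\<^sup>2) + 2 * ennreal ((cmod (ift G w))\<^sup>2)"
      by (simp add: ennreal_plus ennreal_mult)
    also have "\<dots> \<le> ennreal D * ?E"
      unfolding DE[symmetric] by (intro add_mono mult_left_mono I bandlimited_ift(2)[OF G]) simp_all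
    finally have 1: "ennreal ((cmod (err r G w))\<^sup>2) \<le> ennreal D * ?E" .
    have m: "ift G \<in> borel_measurable borel" by (rule measurable_ift) measurable
    have err': "err r G = (\<lambda>w. I w - ift G w)" by (simp add: fun_eq_iff err)
    have "energy lborel (err r G) \<le> 2 * energy lborel I + 2 * energy lborel (ift G)"
      unfolding err' using I(3) m by (intro energy_diff_le) auto
    also have "\<dots> \<le> ennreal D * ?E"
      unfolding DE[symmetric]
      by (intro add_mono mult_left_mono I Plancherel_le_2 bandlimited_ift(1)[OF G]) simp_all
    finally have 2: "energy lborel (err r G) \<le> ennreal D * ?E" .
    have "err r G \<in> borel_measurable borel" unfolding err' using I(3) m by measurable
    with 1 2 show ?thesis by blast
  qed
  with D0 that show thesis by blast
qed

text \<open>Adding two solutions solves the problem with added data; since any solution determines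
  the interpolant, interpolation is additive.\<close>

lemma err_add:
  assumes r: "r > 0" and F: "bandlimited F" and G: "bandlimited G"
  shows "err r (\<lambda>p. F p + G p) w = err r F w + err r G w"
proof -
  obtain a S where a: "l2_le a S"
    and sol_a: "\<And>p. ((\<lambda>q. a q * complex_of_real (gram2 r p q)) has_sum ift F (node p)) UNIV"
    using solution_bandlimited[OF r F] by blast
  obtain b T where b: "l2_le b T"
    and sol_b: "\<And>p. ((\<lambda>q. b q * complex_of_real (gram2 r p q)) has_sum ift G (node p)) UNIV"
    using solution_bandlimited[OF r G] by blast
  have ift: "ift (\<lambda>p. F p + G p) w = ift F w + ift G w" for w
    by (rule ift_add[OF bandlimited_ift(1)[OF F] bandlimited_ift(1)[OF G]])
  have "((\<lambda>q. (a q + b q) * complex_of_real (gram2 r p q)) has_sum ift (\<lambda>p. F p + G p) (node p)) UNIV" for p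
    unfolding ift distrib_right by (intro has_sum_add sol_a sol_b)
  from gaussian_interpolant_eq[OF r l2_le_add[OF a b] this]
  have "gaussian_interpolant node r (ift (\<lambda>p. F p + G p)) w = (\<Sum>\<^sub>\<infinity>q. (a q + b q) * complex_of_real (kern r w q))" .
  also have "\<dots> = (kern_series r a w) + (kern_series r b w)"
    unfolding distrib_right
    using kern_has_sum[OF r l2_le_cmod_le[OF a]] kern_has_sum[OF r l2_le_cmod_le[OF b]]
    by (intro infsumI has_sum_add) auto
  finally show ?thesis
    unfolding err_def gaussian_interpolant_eq[OF r a sol_a] gaussian_interpolant_eq[OF r b sol_b] ift by simp
qed

lemma err_scale:
  assumes r: "r > 0" and G: "bandlimited G"
  shows "err r (\<lambda>p. c * G p) w = c * err r G w"
proof -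
  obtain a S where a: "l2_le a S"
    and sol_a: "\<And>p. ((\<lambda>q. a q * complex_of_real (gram2 r p q)) has_sum ift G (node p)) UNIV"
    using solution_bandlimited[OF r G] by blast
  have "((\<lambda>q. (c * a q) * complex_of_real (gram2 r p q)) has_sum ift (\<lambda>p. c * G p) (node p)) UNIV" for p
    unfolding ift_scale mult.assoc by (intro has_sum_cmult_right sol_a)
  from gaussian_interpolant_eq[OF r l2_le_scale[OF a] this]
  have "gaussian_interpolant node r (ift (\<lambda>p. c * G p)) w = (\<Sum>\<^sub>\<infinity>q. (c * a q) * complex_of_real (kern r w q))" .
  also have "\<dots> = c * (kern_series r a w)"
    unfolding mult.assoc by (rule infsum_cmult_right')
  finally show ?thesis
    unfolding err_def gaussian_interpolant_eq[OF r a sol_a] ift_scale by (simp add: right_diff_distrib)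
qed

end

section \<open>Recovery of band-limited functions\<close>

lemma eventually_at_right_0_unit: "\<forall>\<^sub>F r in at_right (0::real). 0 < r \<and> r \<le> 1"
  by (rule eventually_at_rightI[of 0 1]) auto

context riesz_grid
begin

text \<open>Uniform and L2 convergence are carried along together, both as bounds of squares, so
  that \<open>err_bound\<close> acts on the two at once.\<close>

definition recoverable :: "(real \<times> real \<Rightarrow> complex) \<Rightarrow> bool" where
  "recoverable G \<longleftrightarrow> bandlimited G \<and> (\<forall>\<epsilon>>0. \<forall>\<^sub>F r in at_right 0.
     (\<forall>w. ennreal ((cmod (err r G w))\<^sup>2) \<le> ennreal \<epsilon>) \<and> energy lborel (err r G) \<le> ennreal \<epsilon>)"

lemma measurable_err:
  assumes "0 < r" "r \<le> 1" "bandlimited G" shows "err r G \<in> borel_measurable borel"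
  using err_bound assms by metis

lemma cmod_squared_add_bound:
  assumes "ennreal ((cmod a)\<^sup>2) \<le> ennreal (\<epsilon> / 4)" "ennreal ((cmod b)\<^sup>2) \<le> ennreal (\<epsilon> / 4)" "\<epsilon> > 0"
  shows "ennreal ((cmod (a + b))\<^sup>2) \<le> ennreal \<epsilon>"
proof -
  have "(cmod a)\<^sup>2 \<le> \<epsilon> / 4" "(cmod b)\<^sup>2 \<le> \<epsilon> / 4" using assms by (simp_all add: ennreal_le_iff)
  then show ?thesis using cmod_add_squared_le[of a b] by (intro ennreal_leI) linarith
qed

lemma energy_add_bound:
  assumes "f \<in> borel_measurable M" "g \<in> borel_measurable M"
    and "energy M f \<le> ennreal (\<epsilon> / 4)" "energy M g \<le> ennreal (\<epsilon> / 4)" "\<epsilon> > 0"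
  shows "energy M (\<lambda>t. f t + g t) \<le> ennreal \<epsilon>"
proof -
  have "energy M (\<lambda>t. f t + g t) \<le> 2 * energy M f + 2 * energy M g" by (rule energy_add_le[OF assms(1,2)])
  also have "\<dots> \<le> 2 * ennreal (\<epsilon> / 4) + 2 * ennreal (\<epsilon> / 4)" by (intro add_mono mult_left_mono assms) auto
  also have "\<dots> = ennreal (2 * (\<epsilon> / 4) + 2 * (\<epsilon> / 4))"
  proof -
    have "2 * ennreal d + 2 * ennreal d = ennreal (2 * d + 2 * d)" if "0 \<le> d" for d
    proof -
      have "2 * ennreal d + 2 * ennreal d = (2 + 2) * ennreal d" by (simp only: distrib_right)
      also have "\<dots> = ennreal ((2 + 2) * d)" using that by (simp add: ennreal_mult)
      finally show ?thesis by (simp only: distrib_right)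
    qed
    then show ?thesis using assms(5) by (metis less_eq_real_def divide_nonneg_pos zero_less_numeral)
  qed
  also have "2 * (\<epsilon> / 4) + 2 * (\<epsilon> / 4) = \<epsilon>" by simp
  finally show ?thesis .
qed

lemma recoverable_add:
  assumes F: "recoverable F" and G: "recoverable G" shows "recoverable (\<lambda>p. F p + G p)"
  unfolding recoverable_def
proof (intro conjI allI impI)
  have bF: "bandlimited F" and bG: "bandlimited G" using F G by (auto simp: recoverable_def)
  show "bandlimited (\<lambda>p. F p + G p)" by (rule bandlimited_add[OF bF bG])
  fix \<epsilon> :: real assume \<epsilon>: "\<epsilon> > 0"
  have evF: "\<forall>\<^sub>F r in at_right 0. (\<forall>w. ennreal ((cmod (err r F w))\<^sup>2) \<le> ennreal (\<epsilon> / 4)) \<and> energy lborel (err r F) \<le> ennreal (\<epsilon> / 4)"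
    using F \<epsilon> unfolding recoverable_def by (auto dest!: spec[of _ "\<epsilon> / 4"])
  have evG: "\<forall>\<^sub>F r in at_right 0. (\<forall>w. ennreal ((cmod (err r G w))\<^sup>2) \<le> ennreal (\<epsilon> / 4)) \<and> energy lborel (err r G) \<le> ennreal (\<epsilon> / 4)"
    using G \<epsilon> unfolding recoverable_def by (auto dest!: spec[of _ "\<epsilon> / 4"])
  show "\<forall>\<^sub>F r in at_right 0. (\<forall>w. ennreal ((cmod (err r (\<lambda>p. F p + G p) w))\<^sup>2) \<le> ennreal \<epsilon>) \<and>
    energy lborel (err r (\<lambda>p. F p + G p)) \<le> ennreal \<epsilon>"
    using evF evG eventually_at_right_0_unit
  proof eventually_elim
    case (elim r)
    then have r: "0 < r" "r \<le> 1" by auto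
    have eq: "err r (\<lambda>p. F p + G p) = (\<lambda>w. err r F w + err r G w)"
      by (rule ext) (rule err_add[OF r(1) bF bG])
    show ?case
      unfolding eq using elim \<epsilon> measurable_err[OF r bF] measurable_err[OF r bG]
      by (intro conjI allI cmod_squared_add_bound energy_add_bound) auto
  qed
qed

lemma recoverable_scale:
  assumes G: "recoverable G" shows "recoverable (\<lambda>p. c * G p)"
  unfolding recoverable_def
proof (intro conjI allI impI)
  have bG: "bandlimited G" using G by (auto simp: recoverable_def)
  show "bandlimited (\<lambda>p. c * G p)" by (rule bandlimited_scale[OF bG])
  fix \<epsilon> :: real assume \<epsilon>: "\<epsilon> > 0"
  define \<delta> where "\<delta> = \<epsilon> / ((cmod c)\<^sup>2 + 1)"
  have pos: "(cmod c)\<^sup>2 + 1 > 0" by (simp add: add_nonneg_pos)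
  have \<delta>: "\<delta> > 0" using \<epsilon> pos by (simp add: \<delta>_def)
  have "(cmod c)\<^sup>2 * \<delta> \<le> ((cmod c)\<^sup>2 + 1) * \<delta>" using \<delta> by (intro mult_right_mono) auto
  also have "\<dots> = \<epsilon>" using pos by (simp add: \<delta>_def)
  finally have c\<delta>: "(cmod c)\<^sup>2 * \<delta> \<le> \<epsilon>" .
  have le: "ennreal ((cmod c)\<^sup>2) * e \<le> ennreal \<epsilon>" if "e \<le> ennreal \<delta>" for e
  proof -
    have "ennreal ((cmod c)\<^sup>2) * e \<le> ennreal ((cmod c)\<^sup>2) * ennreal \<delta>" using that by (intro mult_left_mono) auto
    also have "\<dots> = ennreal ((cmod c)\<^sup>2 * \<delta>)" using \<delta> by (intro ennreal_mult[symmetric]) auto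
    also have "\<dots> \<le> ennreal \<epsilon>" by (intro ennreal_leI c\<delta>)
    finally show ?thesis .
  qed
  have "\<forall>\<^sub>F r in at_right 0. (\<forall>w. ennreal ((cmod (err r G w))\<^sup>2) \<le> ennreal \<delta>) \<and> energy lborel (err r G) \<le> ennreal \<delta>"
    using G \<delta> unfolding recoverable_def by blast
  then show "\<forall>\<^sub>F r in at_right 0. (\<forall>w. ennreal ((cmod (err r (\<lambda>p. c * G p) w))\<^sup>2) \<le> ennreal \<epsilon>) \<and>
    energy lborel (err r (\<lambda>p. c * G p)) \<le> ennreal \<epsilon>"
    using eventually_at_right_0_unit
  proof eventually_elim
    case (elim r)
    then have r: "0 < r" "r \<le> 1" by auto
    have eq: "err r (\<lambda>p. c * G p) = (\<lambda>w. c * err r G w)"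
      by (rule ext) (rule err_scale[OF r(1) bG])
    have "energy lborel (\<lambda>w. c * err r G w) = ennreal ((cmod c)\<^sup>2) * energy lborel (err r G)"
      using measurable_err[OF r bG] by (intro energy_scale) simp
    moreover have "ennreal ((cmod (c * err r G w))\<^sup>2) = ennreal ((cmod c)\<^sup>2) * ennreal ((cmod (err r G w))\<^sup>2)" for w
      unfolding norm_mult power_mult_distrib by (rule ennreal_mult) auto
    ultimately show ?case unfolding eq using elim le by simp
  qed
qed

text \<open>The density argument: the error of G - F is bounded by its energy uniformly in
  \<open>r\<close>, and the error of \<open>F\<close> becomes small. The quarters of \<epsilon>
  offset the factor 2 in |a + b|^2 \<le> 2 |a|^2 + 2 |b|^2.\<close>

lemma recoverable_limit:
  assumes bG: "bandlimited G"
    and approx: "\<And>\<delta>. \<delta> > 0 \<Longrightarrow> \<exists>F. recoverable F \<and> energy lborel (\<lambda>p. G p - F p) \<le> ennreal \<delta>"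
  shows "recoverable G"
  unfolding recoverable_def
proof (intro conjI allI impI bG)
  fix \<epsilon> :: real assume \<epsilon>: "\<epsilon> > 0"
  obtain C where C0: "C > 0"
    and C: "\<And>r G w. 0 < r \<Longrightarrow> r \<le> 1 \<Longrightarrow> bandlimited G \<Longrightarrow>
      ennreal ((cmod (err r G w))\<^sup>2) \<le> ennreal C * energy lborel G \<and>
      energy lborel (err r G) \<le> ennreal C * energy lborel G \<and> err r G \<in> borel_measurable borel"
    using err_bound by blast
  define \<delta> where "\<delta> = \<epsilon> / 4 / C"
  have \<delta>: "\<delta> > 0" "C * \<delta> = \<epsilon> / 4" using \<epsilon> C0 by (auto simp: \<delta>_def)
  obtain F where F: "recoverable F" and le: "energy lborel (\<lambda>p. G p - F p) \<le> ennreal \<delta>"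
    using approx[OF \<delta>(1)] by blast
  have bF: "bandlimited F" using F by (auto simp: recoverable_def)
  have bD: "bandlimited (\<lambda>p. G p - F p)" by (rule bandlimited_diff[OF bG bF])
  have "ennreal C * energy lborel (\<lambda>p. G p - F p) \<le> ennreal C * ennreal \<delta>"
    by (intro mult_left_mono le) simp
  also have "\<dots> = ennreal (\<epsilon> / 4)"
    unfolding \<delta>(2)[symmetric] using C0 \<delta>(1) by (intro ennreal_mult[symmetric]) auto
  finally have small: "ennreal C * energy lborel (\<lambda>p. G p - F p) \<le> ennreal (\<epsilon> / 4)" .
  have evF: "\<forall>\<^sub>F r in at_right 0. (\<forall>w. ennreal ((cmod (err r F w))\<^sup>2) \<le> ennreal (\<epsilon> / 4)) \<and> energy lborel (err r F) \<le> ennreal (\<epsilon> / 4)"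
    using F \<epsilon> unfolding recoverable_def by (auto dest!: spec[of _ "\<epsilon> / 4"])
  then show "\<forall>\<^sub>F r in at_right 0. (\<forall>w. ennreal ((cmod (err r G w))\<^sup>2) \<le> ennreal \<epsilon>) \<and> energy lborel (err r G) \<le> ennreal \<epsilon>"
    using eventually_at_right_0_unit
  proof eventually_elim
    case (elim r)
    then have r: "0 < r" "r \<le> 1" by auto
    have "err r (\<lambda>p. F p + (G p - F p)) = (\<lambda>w. err r F w + err r (\<lambda>p. G p - F p) w)"
      by (rule ext) (rule err_add[OF r(1) bF bD])
    then have eq: "err r G = (\<lambda>w. err r F w + err r (\<lambda>p. G p - F p) w)" by simp
    have D: "ennreal ((cmod (err r (\<lambda>p. G p - F p) w))\<^sup>2) \<le> ennreal (\<epsilon> / 4)"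
      "energy lborel (err r (\<lambda>p. G p - F p)) \<le> ennreal (\<epsilon> / 4)" for w
      using C[OF r bD, of w] small by (auto intro: order_trans)
    show ?case
      unfolding eq using elim \<epsilon> measurable_err[OF r bF] measurable_err[OF r bD] D
      by (intro conjI allI cmod_squared_add_bound energy_add_bound) auto
  qed
qed

text \<open>Kernel, data and coefficients all factorise, so products of solutions on the line solve
  the problem on the grid and their interpolant is the product. Summability over pairs comes from
  the row bounds on the grid; iterated summation then identifies the value.\<close>

lemma solution_tensor:
  assumes r: "r > 0" and a: "l2_le a S" and b: "l2_le b T"
    and f: "\<And>m. ((\<lambda>j. a j * complex_of_real (X.gram r m j)) has_sum f m) UNIV"
    and g: "\<And>n. ((\<lambda>k. b k * complex_of_real (Y.gram r n k)) has_sum g n) UNIV"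
  shows "l2_le (\<lambda>q. a (fst q) * b (snd q)) (S * T)"
    and "((\<lambda>q. (a (fst q) * b (snd q)) * complex_of_real (gram2 r p q)) has_sum f (fst p) * g (snd p)) UNIV"
    and "(\<Sum>\<^sub>\<infinity>q. (a (fst q) * b (snd q)) * complex_of_real (kern r (s, t) q))
      = (X.gauss_series r a s) * (Y.gauss_series r b t)"
proof -
  show l2: "l2_le (\<lambda>q. a (fst q) * b (snd q)) (S * T)"
    unfolding l2_le_def norm_mult power_mult_distrib
    by (intro allI impI grid_sum_le l2_leD[OF a] l2_leD[OF b]) auto
  have prod: "(F has_sum (c * d)) UNIV"
    if "\<And>j k. F (j, k) = F1 j * F2 k" "(F1 has_sum c) UNIV" "(F2 has_sum d) UNIV" "F summable_on UNIV"
    for F :: "int \<times> int \<Rightarrow> complex" and F1 F2 c d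
  proof -
    have "(F has_sum (c * d)) (Sigma UNIV (\<lambda>_. UNIV))"
    proof (rule has_sum_SigmaI)
      show "((\<lambda>k. F (j, k)) has_sum F1 j * d) UNIV" for j
        unfolding that(1) by (intro has_sum_cmult_right that(3))
      show "((\<lambda>j. F1 j * d) has_sum c * d) UNIV" by (intro has_sum_cmult_left that(2))
      show "F summable_on Sigma UNIV (\<lambda>_. UNIV)" using that(4) by simp
    qed
    then show ?thesis by simp
  qed
  obtain M where "coercive_matrix (gram2 r) M ((gauss_weight r pi / B\<^sup>2) * (gauss_weight r pi / B'\<^sup>2))"
    using coercive_gram2[OF r] by blast
  then interpret coercive_matrix "gram2 r" M "(gauss_weight r pi / B\<^sup>2) * (gauss_weight r pi / B'\<^sup>2)" .
  show "((\<lambda>q. (a (fst q) * b (snd q)) * complex_of_real (gram2 r p q)) has_sum f (fst p) * g (snd p)) UNIV"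
  proof (rule prod[OF _ f g])
    show "a (fst (j, k)) * b (snd (j, k)) * complex_of_real (gram2 r p (j, k))
      = a j * complex_of_real (X.gram r (fst p) j) * (b k * complex_of_real (Y.gram r (snd p) k))" for j k
      by (simp add: gram2_def)
    show "(\<lambda>q. (a (fst q) * b (snd q)) * complex_of_real (gram2 r p q)) summable_on UNIV"
      by (rule row_summable[OF l2_le_cmod_le[OF l2]])
  qed
  show "(\<Sum>\<^sub>\<infinity>q. (a (fst q) * b (snd q)) * complex_of_real (kern r (s, t) q))
      = (X.gauss_series r a s) * (Y.gauss_series r b t)"
  proof (rule infsumI, rule prod[OF _ X.gauss_series_has_sum[OF r l2_le_cmod_le[OF a]] Y.gauss_series_has_sum[OF r l2_le_cmod_le[OF b]]])
    show "a (fst (j, k)) * b (snd (j, k)) * complex_of_real (kern r (s, t) (j, k))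
      = a j * complex_of_real (exp (- r * (s - x j)\<^sup>2)) * (b k * complex_of_real (exp (- r * (t - y k)\<^sup>2)))" for j k
      by (simp add: kern_def)
    show "(\<lambda>q. (a (fst q) * b (snd q)) * complex_of_real (kern r (s, t) q)) summable_on UNIV"
      by (rule has_sum_imp_summable[OF kern_has_sum[OF r, where a = "\<lambda>q. a (fst q) * b (snd q)", OF l2_le_cmod_le[OF l2]]])
  qed
qed

text \<open>For a rectangle the spectrum factorises, hence so does the interpolant. In terms of the
  one-variable errors \<open>u\<close> and \<open>v\<close> the error is u * (v + ift k) + ift h *
  v; each product has one small and one bounded factor, in the uniform norm as well as in
  energy.\<close>

lemma recoverable_rectangle:
  assumes A: "A \<in> sets borel" and A': "A' \<in> sets borel"
  shows "recoverable (\<lambda>p. indicator ((A \<times> A') \<inter> band) p)"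
  unfolding recoverable_def
proof (intro conjI allI impI)
  define h where "h u = (indicator (A \<inter> {-pi..pi}) u :: complex)" for u
  define k where "k u = (indicator (A' \<inter> {-pi..pi}) u :: complex)" for u
  have [measurable]: "h \<in> borel_measurable borel" "k \<in> borel_measurable borel"
    unfolding h_def[abs_def] k_def[abs_def] using A A' by measurable
  have h1: "cmod (h u) \<le> 1" and k1: "cmod (k u) \<le> 1" for u by (auto simp: h_def k_def indicator_def)
  have hs: "h u = 0" and ks: "k u = 0" if "pi < \<bar>u\<bar>" for u using that by (auto simp: h_def k_def indicator_def)
  let ?G = "\<lambda>p :: real \<times> real. indicator ((A \<times> A') \<inter> band) p :: complex"
  have G_eq: "?G = (\<lambda>p. h (fst p) * k (snd p))"
    by (auto simp: fun_eq_iff h_def k_def indicator_def band_def)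
  have G_meas: "?G \<in> borel_measurable borel" unfolding G_eq borel_prod[symmetric] by measurable
  show bG: "bandlimited ?G"
    by (rule bandlimited_dominated[OF bandlimited_indicator_band G_meas, of 1]) (auto simp: indicator_def)
  have supp: "h u = 0" "k u = 0" if "\<not> (- 1 < \<bar>u\<bar> \<and> \<bar>u\<bar> \<le> pi)" for u
  proof -
    have "pi < \<bar>u\<bar>" using that by auto
    then show "h u = 0" "k u = 0" by (rule hs, rule ks)
  qed
  have mhk: "h \<in> borel_measurable borel" "k \<in> borel_measurable borel" by measurable
  have pi1: "- 1 \<le> pi" using pi_ge_zero by linarith
  note hb = norm_ift_le_measure[where k = h and H = 1 and \<beta> = "- 1", OF mhk(1) h1 pi1 supp(1)]
  note kb = norm_ift_le_measure[where k = k and H = 1 and \<beta> = "- 1", OF mhk(2) k1 pi1 supp(2)]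
  define K where "K = 2 * (pi + 1)"
  \<comment> \<open>A common bound for the squared uniform norm and the energy of both
    transforms.\<close>
  define L where "L = K\<^sup>2 + 2 * pi * K"
  have K0: "K > 0" unfolding K_def by (intro mult_pos_pos add_pos_pos) auto
  have L0: "L > 0" using K0 by (simp add: L_def add_pos_pos)
  have hi: "integrable lborel h" by (rule hb(4))
  have hE: "energy lborel (ift h) \<le> ennreal L"
  proof (rule order_trans)
    show "energy lborel (ift h) \<le> ennreal (2 * pi * (1\<^sup>2 * (2 * (pi - - 1))))" by (rule hb(3))
    show "ennreal (2 * pi * (1\<^sup>2 * (2 * (pi - - 1)))) \<le> ennreal L" by (rule ennreal_leI) (simp add: L_def K_def)
  qed
  have hS: "(cmod (ift h t))\<^sup>2 \<le> L" for t
  proof -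
    have "cmod (ift h t) \<le> K" using hb(2)[of t] by (simp add: K_def)
    then have "(cmod (ift h t))\<^sup>2 \<le> K\<^sup>2" by (intro power_mono) auto
    then show ?thesis using K0 by (simp add: L_def add_increasing2)
  qed
  have ki: "integrable lborel k" by (rule kb(4))
  have kE: "energy lborel (ift k) \<le> ennreal L"
  proof (rule order_trans)
    show "energy lborel (ift k) \<le> ennreal (2 * pi * (1\<^sup>2 * (2 * (pi - - 1))))" by (rule kb(3))
    show "ennreal (2 * pi * (1\<^sup>2 * (2 * (pi - - 1)))) \<le> ennreal L" by (rule ennreal_leI) (simp add: L_def K_def)
  qed
  have kS: "(cmod (ift k t))\<^sup>2 \<le> L" for t
  proof -
    have "cmod (ift k t) \<le> K" using kb(2)[of t] by (simp add: K_def)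
    then have "(cmod (ift k t))\<^sup>2 \<le> K\<^sup>2" by (intro power_mono) auto
    then show ?thesis using K0 by (simp add: L_def add_increasing2)
  qed
  fix \<epsilon> :: real assume \<epsilon>: "\<epsilon> > 0"
  \<comment> \<open>Since \<delta> \<le> 1, the total error \<delta> (4 \<delta> + 6 L) is at most
    \<delta> (4 + 6 L).\<close>
  define \<delta> where "\<delta> = min 1 (\<epsilon> / (4 + 6 * L))"
  have \<delta>: "0 < \<delta>" "\<delta> \<le> 1" using \<epsilon> L0 by (auto simp: \<delta>_def)
  have total: "2 * (\<delta> * (2 * \<delta> + 2 * L)) + 2 * (L * \<delta>) \<le> \<epsilon>"
  proof -
    have "2 * (\<delta> * (2 * \<delta> + 2 * L)) + 2 * (L * \<delta>) = \<delta> * (4 * \<delta> + 6 * L)" by (simp add: algebra_simps)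
    also have "\<dots> \<le> (\<epsilon> / (4 + 6 * L)) * (4 + 6 * L)"
      using \<delta> L0 \<epsilon> by (intro mult_mono) (auto simp: \<delta>_def)
    also have "\<dots> = \<epsilon>" using L0 by simp
    finally show ?thesis .
  qed
  have G_ift: "ift ?G (s, t) = ift h s * ift k t" for s t
    unfolding G_eq by (rule ift_tensor[OF hi ki])
  have mom: "\<exists>R. l2_le (\<lambda>m. ift h (x m)) R" "\<exists>R. l2_le (\<lambda>m. ift k (y m)) R"
  proof -
    have "square_integrable cell h" "square_integrable cell k"
      using square_integrable_cell_bounded[OF _ h1] square_integrable_cell_bounded[OF _ k1] by auto
    moreover have "(\<integral>u. h u * cis (t * u) \<partial>cell) = ift h t" "(\<integral>u. k u * cis (t * u) \<partial>cell) = ift k t" for t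
      using hs ks by (subst integral_cell_eq_lborel; simp add: ift_def)+
    ultimately show "\<exists>R. l2_le (\<lambda>m. ift h (x m)) R" "\<exists>R. l2_le (\<lambda>m. ift k (y m)) R"
      using X.Bessel[of h] Y.Bessel[of k] by auto
  qed
  have evX: "\<forall>\<^sub>F r in at_right 0. \<forall>a S. l2_le a S \<longrightarrow>
      (\<forall>m. ((\<lambda>j. a j * complex_of_real (X.gram r m j)) has_sum ift h (x m)) UNIV) \<longrightarrow>
      (\<forall>t. (cmod ((X.gauss_series r a t) - ift h t))\<^sup>2 \<le> \<delta>) \<and>
      energy lborel (\<lambda>t. (X.gauss_series r a t) - ift h t) \<le> ennreal \<delta>"
    by (rule X.interpolant_converges[where H = 1]) (use h1 hs \<delta> in auto)
  have evY: "\<forall>\<^sub>F r in at_right 0. \<forall>a S. l2_le a S \<longrightarrow>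
      (\<forall>m. ((\<lambda>j. a j * complex_of_real (Y.gram r m j)) has_sum ift k (y m)) UNIV) \<longrightarrow>
      (\<forall>t. (cmod ((Y.gauss_series r a t) - ift k t))\<^sup>2 \<le> \<delta>) \<and>
      energy lborel (\<lambda>t. (Y.gauss_series r a t) - ift k t) \<le> ennreal \<delta>"
    by (rule Y.interpolant_converges[where H = 1]) (use k1 ks \<delta> in auto)
  show "\<forall>\<^sub>F r in at_right 0. (\<forall>w. ennreal ((cmod (err r ?G w))\<^sup>2) \<le> ennreal \<epsilon>) \<and> energy lborel (err r ?G) \<le> ennreal \<epsilon>"
    using evX evY eventually_at_right_0_unit
  proof eventually_elim
    case (elim r)
    then have r: "0 < r" by auto
    obtain a S where a: "l2_le a S" and sa: "\<And>m. ((\<lambda>j. a j * complex_of_real (X.gram r m j)) has_sum ift h (x m)) UNIV"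
      using mom(1) X.gram_solution_exists[OF r] by metis
    obtain b T where b: "l2_le b T" and sb: "\<And>m. ((\<lambda>j. b j * complex_of_real (Y.gram r m j)) has_sum ift k (y m)) UNIV"
      using mom(2) Y.gram_solution_exists[OF r] by metis
    define u where "u s = (X.gauss_series r a s) - ift h s" for s
    define v where "v t = (Y.gauss_series r b t) - ift k t" for t
    have u: "(cmod (u s))\<^sup>2 \<le> \<delta>" "energy lborel u \<le> ennreal \<delta>" for s
      using elim(1) a sa unfolding u_def[abs_def] by blast+
    have v: "(cmod (v s))\<^sup>2 \<le> \<delta>" "energy lborel v \<le> ennreal \<delta>" for s
      using elim(2) b sb unfolding v_def[abs_def] by blast+
    have mF: "ift h \<in> borel_measurable borel" "ift k \<in> borel_measurable borel" by (rule measurable_ift, measurable)+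
    have mu: "u \<in> borel_measurable borel"
      unfolding u_def[abs_def] by (intro borel_measurable_diff X.measurable_gauss_series[OF r a] mF)
    have mv: "v \<in> borel_measurable borel"
      unfolding v_def[abs_def] by (intro borel_measurable_diff Y.measurable_gauss_series[OF r b] mF)
    have vk: "(\<lambda>t. v t + ift k t) \<in> borel_measurable borel" using mv mF by simp
    have sol: "((\<lambda>q. (a (fst q) * b (snd q)) * complex_of_real (gram2 r p q)) has_sum ift ?G (node p)) UNIV" for p
      using solution_tensor(2)[OF r a b sa sb, of p] unfolding node_def G_ift .
    have err: "err r ?G w = u (fst w) * (v (snd w) + ift k (snd w)) + ift h (fst w) * v (snd w)" for w :: "real \<times> real"
    proof -
      obtain s t where w: "w = (s, t)" by (cases w)
      have "gaussian_interpolant node r (ift ?G) w = (u s + ift h s) * (v t + ift k t)"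
        unfolding gaussian_interpolant_eq[OF r solution_tensor(1)[OF r a b sa sb] sol] w
        unfolding solution_tensor(3)[OF r a b sa sb] by (simp add: u_def v_def)
      then show ?thesis by (simp add: err_def w G_ift algebra_simps)
    qed
    have err': "err r ?G = (\<lambda>w. u (fst w) * (v (snd w) + ift k (snd w)) + ift h (fst w) * v (snd w))"
      by (rule ext) (rule err)
    show ?case
    proof (intro conjI allI)
      fix w :: "real \<times> real"
      let ?s = "fst w" and ?t = "snd w"
      have "(cmod (err r ?G w))\<^sup>2 \<le> 2 * (cmod (u ?s * (v ?t + ift k ?t)))\<^sup>2 + 2 * (cmod (ift h ?s * v ?t))\<^sup>2"
        unfolding err by (rule cmod_add_squared_le)
      also have "\<dots> = 2 * ((cmod (u ?s))\<^sup>2 * (cmod (v ?t + ift k ?t))\<^sup>2) + 2 * ((cmod (ift h ?s))\<^sup>2 * (cmod (v ?t))\<^sup>2)"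
        by (simp add: norm_mult power_mult_distrib)
      also have "\<dots> \<le> 2 * (\<delta> * (2 * \<delta> + 2 * L)) + 2 * (L * \<delta>)"
      proof (intro add_mono mult_left_mono mult_mono u v hS)
        show "(cmod (v ?t + ift k ?t))\<^sup>2 \<le> 2 * \<delta> + 2 * L"
          using cmod_add_squared_le[of "v ?t" "ift k ?t"] v(1)[of ?t] kS[of ?t] by linarith
      qed (use \<delta> L0 in auto)
      also note total
      finally show "ennreal ((cmod (err r ?G w))\<^sup>2) \<le> ennreal \<epsilon>" by (rule ennreal_leI)
    next
      have m1: "(\<lambda>w. u (fst w) * (v (snd w) + ift k (snd w))) \<in> borel_measurable lborel"
        "(\<lambda>w. ift h (fst w) * v (snd w)) \<in> borel_measurable lborel"
        using mu mv mF by (simp_all add: borel_prod[symmetric])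
      have "energy lborel (err r ?G) \<le> 2 * energy lborel (\<lambda>w. u (fst w) * (v (snd w) + ift k (snd w)))
        + 2 * energy lborel (\<lambda>w. ift h (fst w) * v (snd w))"
        unfolding err' by (rule energy_add_le[OF m1])
      also have "\<dots> = 2 * (energy lborel u * energy lborel (\<lambda>t. v t + ift k t)) + 2 * (energy lborel (ift h) * energy lborel v)"
        unfolding energy_tensor[OF mu vk] energy_tensor[OF mF(1) mv] ..
      also have "\<dots> \<le> 2 * (ennreal \<delta> * (2 * ennreal \<delta> + 2 * ennreal L)) + 2 * (ennreal L * ennreal \<delta>)"
      proof (intro add_mono mult_left_mono mult_mono u v hE)
        have "energy lborel (\<lambda>t. v t + ift k t) \<le> 2 * energy lborel v + 2 * energy lborel (ift k)"
          using mv mF by (intro energy_add_le) auto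
        also have "\<dots> \<le> 2 * ennreal \<delta> + 2 * ennreal L" by (intro add_mono mult_left_mono v kE) auto
        finally show "energy lborel (\<lambda>t. v t + ift k t) \<le> 2 * ennreal \<delta> + 2 * ennreal L" .
      qed auto
      also have "\<dots> = ennreal (2 * (\<delta> * (2 * \<delta> + 2 * L)) + 2 * (L * \<delta>))"
        using \<delta> L0 by (simp add: ennreal_plus ennreal_mult)
      also have "\<dots> \<le> ennreal \<epsilon>" by (intro ennreal_leI total)
      finally show "energy lborel (err r ?G) \<le> ennreal \<epsilon>" .
    qed
  qed
qed

text \<open>Dynkin's argument: rectangles are closed under intersection and generate the Borel sets.
  Complements inside the square follow by linearity, countable disjoint unions as energy limits of
  finite ones.\<close>

lemma recoverable_indicator:
  assumes "A \<in> sets borel"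
  shows "recoverable (\<lambda>p. indicator (A \<inter> band) p)"
proof -
  let ?E = "{a \<times> b | a b. a \<in> sets (borel :: real measure) \<and> b \<in> sets (borel :: real measure)}"
  have sets_eq: "sets (borel :: (real \<times> real) measure) = sigma_sets UNIV ?E"
    unfolding borel_prod[symmetric] sets_pair_measure by simp
  have diff: "recoverable (\<lambda>p. F p - G p)" if "recoverable F" "recoverable G" for F G
    using recoverable_add[OF that(1) recoverable_scale[OF that(2), of "- 1"]] by simp
  have band: "recoverable (\<lambda>p. indicator band p)"
    using recoverable_rectangle[of UNIV UNIV] by simp
  have "A \<in> sigma_sets UNIV ?E" using assms by (simp only: sets_eq)
  moreover have "?E \<subseteq> Pow UNIV" by simp
  moreover note Int_stable_pair_measure_generator[of "borel :: real measure" "borel :: real measure"]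
  ultimately have "Int_stable ?E" "?E \<subseteq> Pow UNIV" "A \<in> sigma_sets UNIV ?E" by simp_all
  then show ?thesis
  proof (induct rule: sigma_sets_induct_disjoint)
    case (basic A)
    then show ?case using recoverable_rectangle by auto
  next
    case empty
    show ?case using recoverable_scale[OF band, of 0] by simp
  next
    case (compl A)
    have "(\<lambda>p. indicator ((UNIV - A) \<inter> band) p :: complex) = (\<lambda>p. indicator band p - indicator (A \<inter> band) p)"
      by (auto simp: fun_eq_iff indicator_def)
    then show ?case using diff[OF band compl(2)] by simp
  next
    case (union A)
    have A: "A i \<in> sets borel" for i using union(2) by (auto simp: sets_eq)
    define S where "S n p = (\<Sum>i<n. indicator (A i \<inter> band) p :: complex)" for n p
    have S: "recoverable (S n)" for n
    proof (induction n)
      case 0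
      show ?case using recoverable_scale[OF band, of 0] by (simp add: S_def[abs_def])
    next
      case (Suc n)
      then show ?case using recoverable_add[OF Suc union(3)[of n]] by (simp add: S_def[abs_def])
    qed
    have S_eq: "S n p = indicator ((\<Union>i<n. A i) \<inter> band) p" for n p
    proof -
      have "disjoint_family_on (\<lambda>i. A i \<inter> band) {..<n}"
        using union(1) by (auto simp: disjoint_family_on_def)
      then have "indicator (\<Union>i<n. A i \<inter> band) p = (\<Sum>i<n. indicator (A i \<inter> band) p :: complex)"
        by (intro indicator_UN_disjoint) auto
      then show ?thesis by (simp add: S_def)
    qed
    let ?U = "\<Union>i. A i"
    have U: "?U \<in> sets borel" using A by auto
    have mU: "(\<lambda>p. indicator (?U \<inter> band) p :: complex) \<in> borel_measurable borel" using U by measurable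
    have bU: "bandlimited (\<lambda>p. indicator (?U \<inter> band) p)"
      by (rule bandlimited_dominated[OF bandlimited_indicator_band mU, of 1]) (auto simp: indicator_def)
    have lim: "(\<lambda>n. energy lborel (\<lambda>p. indicator (?U \<inter> band) p - S n p)) \<longlonglongrightarrow> 0"
    proof (rule energy_dominated_tendsto[where K = 1 and u = "\<lambda>p. indicator band p"])
      show "S n \<in> borel_measurable lborel" for n
        using S[of n] by (auto simp: recoverable_def bandlimited_def)
      show "(\<lambda>n. S n p) \<longlonglongrightarrow> indicator (?U \<inter> band) p" for p
      proof (cases "\<exists>i. p \<in> A i")
        case True
        then obtain i where i: "p \<in> A i" by blast
        have "S n p = indicator (?U \<inter> band) p" if "Suc i \<le> n" for n
          unfolding S_eq using i that by (auto simp: indicator_def)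
        then have "\<forall>\<^sub>F n in sequentially. S n p = indicator (?U \<inter> band) p"
          unfolding eventually_sequentially by blast
        then show ?thesis by (rule tendsto_eventually)
      next
        case False
        then have "S n p = indicator (?U \<inter> band) p" for n unfolding S_eq by (auto simp: indicator_def)
        then show ?thesis by simp
      qed
      show "cmod (S n p) \<le> 1 * cmod (indicator band p)" for n p
        unfolding S_eq by (auto simp: indicator_def)
      show "energy lborel (\<lambda>p. indicator band p :: complex) < \<infinity>"
        by (rule bandlimited_energy[OF bandlimited_indicator_band])
    qed (use mU in auto)
    show ?case
    proof (rule recoverable_limit[OF bU])
      fix \<delta> :: real assume "\<delta> > 0"
      then have "\<forall>\<^sub>F n in sequentially. energy lborel (\<lambda>p. indicator (?U \<inter> band) p - S n p) < ennreal \<delta>"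
        using lim by (intro order_tendstoD) auto
      then obtain n where "energy lborel (\<lambda>p. indicator (?U \<inter> band) p - S n p) < ennreal \<delta>"
        by (auto simp: eventually_sequentially)
      then show "\<exists>F. recoverable F \<and> energy lborel (\<lambda>p. indicator (?U \<inter> band) p - F p) \<le> ennreal \<delta>"
        using S by (intro exI[of _ "S n"]) auto
    qed
  qed
qed

text \<open>Simple functions approximate the spectrum in energy by dominated convergence. Their
  domination by 2 |G| also makes them vanish outside the square, so they are combinations of
  indicators of sets inside it.\<close>

lemma recoverable_bandlimited:
  assumes G: "bandlimited G"
  shows "recoverable G"
proof -
  have [measurable]: "G \<in> borel_measurable borel" using G by (rule bandlimited_measurable)
  obtain F where F: "\<And>i. simple_function lborel (F i)"
    and lim: "\<And>p. (\<lambda>i. F i p) \<longlonglongrightarrow> G p" and bound: "\<And>i p. cmod (F i p) \<le> 2 * cmod (G p)"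
    using borel_measurable_implies_sequence_metric[of G lborel 0] by auto
  have mF: "F i \<in> borel_measurable borel" for i using borel_measurable_simple_function[OF F] by simp
  have "recoverable (F i)" for i
  proof -
    have fin: "finite (F i ` UNIV)" using simple_functionD(1)[OF F[of i]] by simp
    have sum_rec: "recoverable (\<lambda>p. \<Sum>c\<in>C. c * indicator (F i -` {c} \<inter> band) p)" if "finite C" for C
      using that
    proof induction
      case empty
      show ?case using recoverable_scale[OF recoverable_indicator[of "{}"], of 0] by simp
    next
      case (insert c C)
      have "F i -` {c} \<in> sets borel" using measurable_sets[OF mF, of "{c}"] by simp
      then show ?case
        unfolding sum.insert[OF insert(1,2)]
        by (intro recoverable_add recoverable_scale recoverable_indicator insert(3))
    qed
    have "F i p = (\<Sum>c\<in>F i ` UNIV. c * indicator (F i -` {c} \<inter> band) p)" for p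
    proof (cases "p \<in> band")
      case True
      have "(\<Sum>c\<in>F i ` UNIV. c * indicator (F i -` {c} \<inter> band) p) = (\<Sum>c\<in>F i ` UNIV. if c = F i p then c else 0)"
        using True by (intro sum.cong) (auto simp: indicator_def)
      also have "\<dots> = F i p" using fin by simp
      finally show ?thesis ..
    next
      case False
      then show ?thesis using bound[of i p] bandlimited_outside[OF G False] by simp
    qed
    then have "F i = (\<lambda>p. \<Sum>c\<in>F i ` UNIV. c * indicator (F i -` {c} \<inter> band) p)" by (rule ext)
    then show ?thesis using sum_rec[OF fin] by simp
  qed
  moreover have conv: "(\<lambda>i. energy lborel (\<lambda>p. G p - F i p)) \<longlonglongrightarrow> 0"
    by (rule energy_dominated_tendsto[OF _ _ _ lim bound]) (use mF bandlimited_energy[OF G] in auto)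
  ultimately show ?thesis
  proof (intro recoverable_limit[OF G])
    fix \<delta> :: real assume rec: "\<And>i. recoverable (F i)" and "\<delta> > 0"
    then have "\<forall>\<^sub>F n in sequentially. energy lborel (\<lambda>p. G p - F n p) < ennreal \<delta>"
      using conv by (intro order_tendstoD) auto
    then obtain n where "energy lborel (\<lambda>p. G p - F n p) < ennreal \<delta>"
      by (auto simp: eventually_sequentially)
    then show "\<exists>H. recoverable H \<and> energy lborel (\<lambda>p. G p - H p) \<le> ennreal \<delta>"
      using rec by (intro exI[of _ "F n"]) auto
  qed
qed

end

section \<open>The Paley--Wiener space\<close>

lemma energy_lebesgue: "energy lebesgue f = energy lborel f"
  unfolding energy_def by (rule nn_integral_completion)

text \<open>The given notions use the completed measure, while the tools for transforms and product
  measures are stated for Borel functions. Representatives are chosen for real and imaginary part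
  separately.\<close>

lemma lebesgue_borel_representative:
  fixes f :: "'a::euclidean_space \<Rightarrow> complex"
  assumes f: "f \<in> borel_measurable lebesgue"
  obtains f' where "f' \<in> borel_measurable borel" "AE x in lebesgue. f x = f' x"
proof -
  have "(\<lambda>x. Re (f x)) \<in> borel_measurable lebesgue" "(\<lambda>x. Im (f x)) \<in> borel_measurable lebesgue"
    using f by measurable
  from this[THEN completion_ex_borel_measurable_real] obtain a b
    where a: "a \<in> borel_measurable lborel" "AE x in lborel. Re (f x) = a x"
      and b: "b \<in> borel_measurable lborel" "AE x in lborel. Im (f x) = b x" by blast
  define f' where "f' x = complex_of_real (a x) + \<i> * complex_of_real (b x)" for x
  have "f' \<in> borel_measurable borel" unfolding f'_def[abs_def] using a(1) b(1) by simp
  moreover have "AE x in lborel. f x = f' x"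
    using a(2) b(2) by eventually_elim (simp add: f'_def complex_eq_iff)
  ultimately show thesis using that AE_completion by blast
qed

text \<open>Norm convergence implies weak convergence, by Cauchy--Schwarz for the
  difference.\<close>

lemma L2_tendsto_integral_mult:
  assumes f: "L2_tendsto M f g sequentially" and \<phi>: "square_integrable M \<phi>"
  shows "(\<lambda>n. \<integral>t. f n t * \<phi> t \<partial>M) \<longlonglongrightarrow> (\<integral>t. g t * \<phi> t \<partial>M)"
proof -
  have g: "square_integrable M g" and ev: "\<forall>\<^sub>F n in sequentially. square_integrable M (f n)"
    and lim: "(\<lambda>n. L2_norm M (\<lambda>t. f n t - g t)) \<longlonglongrightarrow> 0"
    using f by (auto simp: L2_tendsto_def)
  have nonneg: "0 \<le> L2_norm M h" for h by (simp add: L2_norm_def integral_nonneg_AE)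
  have "(\<lambda>n. (\<integral>t. f n t * \<phi> t \<partial>M) - (\<integral>t. g t * \<phi> t \<partial>M)) \<longlonglongrightarrow> 0"
  proof (rule Lim_null_comparison)
    show "(\<lambda>n. L2_norm M (\<lambda>t. f n t - g t) * L2_norm M \<phi>) \<longlonglongrightarrow> 0"
      using tendsto_mult[OF lim tendsto_const[of "L2_norm M \<phi>"]] by simp
    show "\<forall>\<^sub>F n in sequentially. norm ((\<integral>t. f n t * \<phi> t \<partial>M) - (\<integral>t. g t * \<phi> t \<partial>M))
      \<le> L2_norm M (\<lambda>t. f n t - g t) * L2_norm M \<phi>"
      using ev
    proof eventually_elim
      case (elim n)
      have "(\<integral>t. f n t * \<phi> t \<partial>M) - (\<integral>t. g t * \<phi> t \<partial>M) = (\<integral>t. (f n t - g t) * \<phi> t \<partial>M)"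
        unfolding left_diff_distrib
        by (intro Bochner_Integration.integral_diff[symmetric] Cauchy_Schwarz_integral(1) elim g \<phi>)
      moreover have "(cmod (\<integral>t. (f n t - g t) * \<phi> t \<partial>M))\<^sup>2 \<le> (L2_norm M (\<lambda>t. f n t - g t) * L2_norm M \<phi>)\<^sup>2"
        unfolding power_mult_distrib L2_norm_squared
        by (rule Cauchy_Schwarz_integral(2)[OF square_integrable_diff[OF elim g] \<phi>])
      then have "cmod (\<integral>t. (f n t - g t) * \<phi> t \<partial>M) \<le> L2_norm M (\<lambda>t. f n t - g t) * L2_norm M \<phi>"
        by (rule power2_le_imp_le) (intro mult_nonneg_nonneg nonneg)
      ultimately show ?case by simp
    qed
  qed
  then show ?thesis by (rule LIM_zero_cancel)
qed

section \<open>The Gaussian approximate identity in the plane\<close>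

definition gauss_weight2 :: "real \<Rightarrow> real \<times> real \<Rightarrow> real" where
  "gauss_weight2 r v = gauss_weight r (fst v) * gauss_weight r (snd v)"

lemma gauss_weight2_nonneg: "r > 0 \<Longrightarrow> 0 \<le> gauss_weight2 r v"
  by (simp add: gauss_weight2_def gauss_weight_nonneg)

lemma gauss_weight2_eq:
  assumes "r > 0"
  shows "gauss_weight2 r v = exp (- ((norm v)\<^sup>2) / (4 * r)) / (4 * pi * r)"
proof -
  have "(norm v)\<^sup>2 = (fst v)\<^sup>2 + (snd v)\<^sup>2"
    by (cases v) (simp add: norm_Pair)
  then have "- ((norm v)\<^sup>2) / (4 * r) = - ((fst v)\<^sup>2) / (4 * r) + - ((snd v)\<^sup>2) / (4 * r)"
    by (simp add: add_divide_distrib diff_divide_distrib)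
  then have "exp (- ((norm v)\<^sup>2) / (4 * r)) = exp (- ((fst v)\<^sup>2) / (4 * r)) * exp (- ((snd v)\<^sup>2) / (4 * r))"
    by (simp only: exp_add)
  moreover have "sqrt (4 * pi * r) * sqrt (4 * pi * r) = 4 * pi * r" using assms by simp
  ultimately show ?thesis by (simp add: gauss_weight2_def gauss_weight_def)
qed

lemma gauss_weight2_le: "r > 0 \<Longrightarrow> gauss_weight2 r v \<le> 1 / (4 * pi * r)"
  unfolding gauss_weight2_eq by (intro divide_right_mono) auto

lemma measurable_gauss_weight2 [measurable]: "(\<lambda>s. gauss_weight2 r (s - z)) \<in> borel_measurable borel"
proof -
  have "continuous_on UNIV (\<lambda>s. gauss_weight2 r (s - z))"
    unfolding gauss_weight2_def gauss_weight_def by (cases "r = 0") (auto intro!: continuous_intros)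
  then show ?thesis by (rule borel_measurable_continuous_onI)
qed

lemma gauss_weight2_integral:
  assumes r: "r > 0"
  shows "integrable lborel (\<lambda>s. gauss_weight2 r (s - z))" "(\<integral>s. gauss_weight2 r (s - z) \<partial>lborel) = 1"
proof -
  have one: "integrable lborel (\<lambda>u. complex_of_real (gauss_weight r (u - c)))"
    "(\<integral>u. complex_of_real (gauss_weight r (u - c)) \<partial>lborel) = 1" for c
  proof -
    have i: "integrable lborel (\<lambda>u. gauss_weight r (- c + 1 * u))"
      by (rule lborel_integrable_real_affine[OF integrable_gauss_weight[OF r]]) simp
    then show "integrable lborel (\<lambda>u. complex_of_real (gauss_weight r (u - c)))" by simp
    have "(\<integral>u. gauss_weight r (u - c) \<partial>lborel) = 1"
      using integral_gauss_weight[OF r] lborel_integral_real_affine[of 1 "gauss_weight r" "- c"] by simp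
    then show "(\<integral>u. complex_of_real (gauss_weight r (u - c)) \<partial>lborel) = 1" by simp
  qed
  have eq: "complex_of_real (gauss_weight r (fst s - fst z)) * complex_of_real (gauss_weight r (snd s - snd z))
    = complex_of_real (gauss_weight2 r (s - z))" for s
    by (simp add: gauss_weight2_def)
  have "integrable lborel (\<lambda>s. complex_of_real (gauss_weight2 r (s - z)))"
    using integral_tensor(1)[OF one(1) one(1), of "fst z" "snd z"] unfolding eq .
  then show "integrable lborel (\<lambda>s. gauss_weight2 r (s - z))"
    using integrable_Re by fastforce
  have "(\<integral>s. complex_of_real (gauss_weight2 r (s - z)) \<partial>lborel) = 1"
    using integral_tensor(2)[OF one(1) one(1), of "fst z" "snd z"] unfolding eq one(2) by simp
  then show "(\<integral>s. gauss_weight2 r (s - z) \<partial>lborel) = 1"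
    by (simp only: integral_complex_of_real of_real_eq_1_iff)
qed

text \<open>Off a \<open>\<delta>\<close>-neighbourhood of \<open>z\<close>, where \<open>F\<close> need not be bounded, \<open>\<bar>F\<bar> \<le> 1 + \<bar>F\<bar>\<^sup>2\<close> is used.\<close>

lemma gauss_weight2_approximate_identity:
  assumes cont: "continuous_on UNIV F" and fin: "energy lborel F < \<infinity>"
  shows "((\<lambda>r. \<integral>s. F s * complex_of_real (gauss_weight2 r (s - z)) \<partial>lborel) \<longlongrightarrow> F z) (at_right 0)"
proof (rule tendstoI)
  fix e :: real assume e: "e > 0"
  have [measurable]: "F \<in> borel_measurable borel" by (rule borel_measurable_continuous_onI[OF cont])
  have sq: "integrable lborel (\<lambda>s. (cmod (F s))\<^sup>2)"
    using fin square_integrable_iff_energy[of lborel F] by (simp add: square_integrable_def)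
  define E where "E = (sq_int lborel F)"
  have "isCont F z" 
    by (rule bspec[OF continuous_on_eq_continuous_at[OF open_UNIV, THEN iffD1, OF cont]]) simp
  then obtain \<delta> where \<delta>: "\<delta> > 0" and near: "\<And>s. dist s z < \<delta> \<Longrightarrow> dist (F s) (F z) < e / 2"
    unfolding continuous_at_eps_delta using e by (metis half_gt_zero)
  define a where "a = 1 + cmod (F z)"
  have a: "0 \<le> a" by (simp add: a_def)
  \<comment> \<open>The three terms bound the part near \<open>z\<close>, the far part of |F|^2
    against the largest weight occurring there, and the far part of the constant
    \<open>a\<close>.\<close>
  define b where "b r = e / 2 + E * (exp (- (\<delta>\<^sup>2) / (4 * r)) / (4 * pi * r)) + 2 * a * exp (- (\<delta>\<^sup>2) / (8 * r))" for r
  have "((\<lambda>r. exp (- (\<delta>\<^sup>2) / (4 * r)) / (4 * pi * r)) \<longlongrightarrow> 0) (at_right 0)"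
    "((\<lambda>r. exp (- (\<delta>\<^sup>2) / (8 * r))) \<longlongrightarrow> 0) (at_right 0)"
    using \<delta> by real_asymp+
  then have "(b \<longlongrightarrow> e / 2 + E * 0 + 2 * a * 0) (at_right 0)"
    unfolding b_def[abs_def] by (intro tendsto_intros)
  then have "(b \<longlongrightarrow> e / 2) (at_right 0)" by simp
  then have ev: "\<forall>\<^sub>F r in at_right 0. b r < e" by (rule order_tendstoD(2)) (use e in simp)
  show "\<forall>\<^sub>F r in at_right 0. dist (\<integral>s. F s * complex_of_real (gauss_weight2 r (s - z)) \<partial>lborel) (F z) < e"
    using ev eventually_at_right_0_unit
  proof eventually_elim
    case (elim r)
    then have r: "r > 0" by simp
    let ?W = "\<lambda>s. gauss_weight2 r (s - z)" and ?V = "\<lambda>s. gauss_weight2 (2 * r) (s - z)"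
    let ?S = "exp (- (\<delta>\<^sup>2) / (4 * r)) / (4 * pi * r)" and ?T = "exp (- (\<delta>\<^sup>2) / (8 * r))"
    let ?m = "\<lambda>s. e / 2 * ?W s + (cmod (F s))\<^sup>2 * ?S + 2 * a * ?T * ?V s"
    have W0: "0 \<le> ?W s" and V0: "0 \<le> ?V s" for s using r by (simp_all add: gauss_weight2_nonneg)
    have S0: "0 \<le> ?S" using r by simp
    have le: "cmod ((F s - F z) * complex_of_real (?W s)) \<le> ?m s" for s
    proof -
      have eq: "cmod ((F s - F z) * complex_of_real (?W s)) = cmod (F s - F z) * ?W s"
        using W0 by (simp add: norm_mult)
      show ?thesis
      proof (cases "dist s z < \<delta>")
        case True
        have "cmod (F s - F z) * ?W s \<le> e / 2 * ?W s"
          using near[OF True] W0 by (intro mult_right_mono) (auto simp: dist_norm)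
        moreover have "0 \<le> (cmod (F s))\<^sup>2 * ?S" by (rule mult_nonneg_nonneg[OF zero_le_power2 S0])
        moreover have "0 \<le> 2 * a * ?T * ?V s" by (intro mult_nonneg_nonneg a V0) auto
        ultimately show ?thesis unfolding eq by linarith
      next
        case False
        then have d: "\<delta>\<^sup>2 \<le> (norm (s - z))\<^sup>2" using \<delta> by (intro power_mono) (auto simp: dist_norm)
        have WS: "?W s \<le> ?S"
          unfolding gauss_weight2_eq[OF r] using r d by (intro divide_right_mono) (auto simp: divide_right_mono)
        \<comment> \<open>Half of the exponent becomes a small factor, since s and \<open>z\<close>
          are at least \<delta> apart; the other half is the weight with parameter 2 r, which is
          still integrable. The factor 2 adjusts its normalisation.\<close>
        have WV: "?W s \<le> 2 * ?T * ?V s"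
        proof -
          have "- ((norm (s - z))\<^sup>2) / (4 * r) \<le> - (\<delta>\<^sup>2) / (8 * r) + - ((norm (s - z))\<^sup>2) / (4 * (2 * r))"
            using r d by (simp add: field_simps)
          then have "exp (- ((norm (s - z))\<^sup>2) / (4 * r)) \<le> ?T * exp (- ((norm (s - z))\<^sup>2) / (4 * (2 * r)))"
            unfolding exp_add[symmetric] exp_le_cancel_iff .
          then have "exp (- ((norm (s - z))\<^sup>2) / (4 * r)) / (4 * pi * r)
            \<le> ?T * exp (- ((norm (s - z))\<^sup>2) / (4 * (2 * r))) / (4 * pi * r)"
            using r by (intro divide_right_mono) auto
          also have "\<dots> = 2 * ?T * (exp (- ((norm (s - z))\<^sup>2) / (4 * (2 * r))) / (4 * pi * (2 * r)))"
            by simp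
          finally show ?thesis using r by (simp only: gauss_weight2_eq mult_pos_pos zero_less_numeral)
        qed
        have "cmod (F s) \<le> 1 + (cmod (F s))\<^sup>2"
        proof -
          have "2 * cmod (F s) \<le> (cmod (F s))\<^sup>2 + 1"
            using zero_le_power2[of "cmod (F s) - 1"] by (simp add: power2_diff)
          then show ?thesis using norm_ge_zero[of "F s"] by linarith
        qed
        then have "cmod (F s - F z) \<le> (cmod (F s))\<^sup>2 + a"
          using norm_triangle_ineq4[of "F s" "F z"] by (simp add: a_def)
        then have "cmod (F s - F z) * ?W s \<le> ((cmod (F s))\<^sup>2 + a) * ?W s" using W0 by (rule mult_right_mono)
        also have "\<dots> = (cmod (F s))\<^sup>2 * ?W s + a * ?W s" by (rule distrib_right)
        also have "\<dots> \<le> (cmod (F s))\<^sup>2 * ?S + a * (2 * ?T * ?V s)"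
          using a by (intro add_mono mult_left_mono WS WV) auto
        finally have "cmod (F s - F z) * ?W s \<le> (cmod (F s))\<^sup>2 * ?S + 2 * a * ?T * ?V s" by (simp only: mult_ac)
        moreover have "0 \<le> e / 2 * ?W s" using W0[of s] e by simp
        ultimately show ?thesis unfolding eq by linarith
      qed
    qed
    have r2: "2 * r > 0" using r by simp
    have int_m: "integrable lborel ?m"
      by (intro Bochner_Integration.integrable_add integrable_mult_right integrable_mult_left
          gauss_weight2_integral(1) r r2 sq)
    have int_d: "integrable lborel (\<lambda>s. (F s - F z) * complex_of_real (?W s))"
    proof (rule Bochner_Integration.integrable_bound[OF int_m])
      show "AE s in lborel. norm ((F s - F z) * complex_of_real (?W s)) \<le> norm (?m s)"
        unfolding real_norm_def by (intro AE_I2 order_trans[OF le abs_ge_self])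
    qed measurable
    have int_W: "integrable lborel (\<lambda>s. F z * complex_of_real (?W s))"
      using gauss_weight2_integral(1)[OF r] by simp
    have "(\<integral>s. F s * complex_of_real (?W s) \<partial>lborel)
      = (\<integral>s. (F s - F z) * complex_of_real (?W s) + F z * complex_of_real (?W s) \<partial>lborel)"
      by (simp add: algebra_simps)
    also have "\<dots> = (\<integral>s. (F s - F z) * complex_of_real (?W s) \<partial>lborel) + F z"
      by (subst Bochner_Integration.integral_add[OF int_d int_W])
         (simp add: gauss_weight2_integral(2)[OF r])
    finally have "dist (\<integral>s. F s * complex_of_real (?W s) \<partial>lborel) (F z)
      = cmod (\<integral>s. (F s - F z) * complex_of_real (?W s) \<partial>lborel)" by (simp add: dist_norm)
    also have "\<dots> \<le> (\<integral>s. ?m s \<partial>lborel)"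
      by (rule order_trans[OF integral_norm_bound integral_mono[OF integrable_norm[OF int_d] int_m le]])
    also have "\<dots> = e / 2 * (\<integral>s. ?W s \<partial>lborel) + (sq_int lborel F) * ?S + 2 * a * ?T * (\<integral>s. ?V s \<partial>lborel)"
    proof -
      have 1: "integrable lborel (\<lambda>s. e / 2 * ?W s)" "integrable lborel (\<lambda>s. (cmod (F s))\<^sup>2 * ?S)"
        "integrable lborel (\<lambda>s. 2 * a * ?T * ?V s)"
        by (intro integrable_mult_right integrable_mult_left gauss_weight2_integral(1) r r2 sq)+
      show ?thesis
        unfolding Bochner_Integration.integral_add[OF Bochner_Integration.integrable_add[OF 1(1,2)] 1(3)]
          Bochner_Integration.integral_add[OF 1(1,2)]
        by (simp only: integral_mult_right_zero integral_mult_left_zero)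
    qed
    also have "\<dots> = b r"
      unfolding gauss_weight2_integral(2)[OF r] gauss_weight2_integral(2)[OF r2] b_def E_def by simp
    also have "\<dots> < e" using elim by simp
    finally show ?case .
  qed
qed

lemma integrable_gauss_tensor:
  assumes e: "e > 0"
  shows "integrable lborel (\<lambda>p :: real \<times> real. complex_of_real (exp (- e * (fst p)\<^sup>2)) * complex_of_real (exp (- e * (snd p)\<^sup>2)))"
  using integrable_gauss[OF e] by (intro integral_tensor(1)) simp_all

lemma ift_gauss_tensor:
  assumes e: "e > 0"
  shows "ift (\<lambda>p. complex_of_real (exp (- e * (fst p)\<^sup>2)) * complex_of_real (exp (- e * (snd p)\<^sup>2))) v
    = complex_of_real ((2 * pi)\<^sup>2 * gauss_weight2 e v)"
proof -
  have i: "integrable lborel (\<lambda>u. complex_of_real (exp (- e * u\<^sup>2)))" using integrable_gauss[OF e] by simp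
  obtain s t where v: "v = (s, t)" by (cases v)
  show ?thesis
    unfolding v ift_tensor[OF i i] ift_gauss[OF e]
    by (simp add: gauss_weight2_def power2_eq_square mult_ac)
qed

text \<open>Both sides of the definition of the \<open>L\<^sub>2\<close> transform are tested against a modulated Gaussian;
  letting its width grow recovers \<open>F z\<close> from the transform.\<close>

lemma fourier_transform_L2_test:
  assumes F: "fourier_transform_L2 F H" and e: "e > 0"
  shows "(\<integral>x. H x * (cis (z \<bullet> x) * (complex_of_real (exp (- e * (fst x)\<^sup>2)) * complex_of_real (exp (- e * (snd x)\<^sup>2)))) \<partial>lebesgue)
    = (\<integral>s. F s * complex_of_real ((2 * pi)\<^sup>2 * gauss_weight2 e (s - z)) \<partial>lebesgue)"
proof -
  define \<gamma> where "\<gamma> x = complex_of_real (exp (- e * (fst x)\<^sup>2)) * complex_of_real (exp (- e * (snd x)\<^sup>2))" for x :: "real \<times> real"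
  define \<phi> where "\<phi> x = cis (z \<bullet> x) * \<gamma> x" for x
  define k where "k s = complex_of_real ((2 * pi)\<^sup>2 * gauss_weight2 e (s - z))" for s
  have \<gamma>_int: "integrable lborel \<gamma>" unfolding \<gamma>_def[abs_def] by (rule integrable_gauss_tensor[OF e])
  have [measurable]: "\<gamma> \<in> borel_measurable borel" using \<gamma>_int by auto
  have [measurable]: "\<phi> \<in> borel_measurable borel" unfolding \<phi>_def[abs_def] by measurable
  have [measurable]: "k \<in> borel_measurable borel" unfolding k_def[abs_def] by measurable
  have cnj_\<gamma>: "cnj (\<gamma> x) = \<gamma> x" for x by (simp add: \<gamma>_def)
  have g: "(\<lambda>x. cnj (\<phi> x)) = (\<lambda>x. \<gamma> x * cis (- (z \<bullet> x)))"
    by (simp add: \<phi>_def cis_cnj cnj_\<gamma> mult.commute fun_eq_iff)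
  have g_int: "integrable lborel (\<lambda>x. cnj (\<phi> x))"
    unfolding g by (intro integrable_mult_cis \<gamma>_int) measurable
  \<comment> \<open>The test function is chosen for this: the transform of its conjugate is, up to
    (2 pi)^2, the Gaussian weight centred at \<open>z\<close>.\<close>
  have ift_g: "ift (\<lambda>x. cnj (\<phi> x)) s = k s" for s
  proof -
    have "ift (\<lambda>x. cnj (\<phi> x)) s = ift \<gamma> (s - z)"
      unfolding g ift_def by (simp add: mult.assoc cis_mult inner_diff_left)
    then show ?thesis unfolding \<gamma>_def[abs_def] ift_gauss_tensor[OF e] k_def .
  qed
  have cnj_k: "cnj (k s) = k s" for s by (simp add: k_def)
  have sq_\<phi>: "square_integrable lebesgue \<phi>"
  proof -
    have e2: "2 * e > 0" using e by simp
    have sq: "(exp (- e * t\<^sup>2))\<^sup>2 = exp (- (2 * e) * t\<^sup>2)" for t :: real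
      by (simp add: exp_double[symmetric])
    have "complex_of_real ((cmod (\<phi> x))\<^sup>2) = complex_of_real (exp (- (2 * e) * (fst x)\<^sup>2)) * complex_of_real (exp (- (2 * e) * (snd x)\<^sup>2))" for x
      unfolding \<phi>_def \<gamma>_def norm_mult power_mult_distrib norm_of_real abs_exp_cancel sq by simp
    then have "integrable lborel (\<lambda>x. complex_of_real ((cmod (\<phi> x))\<^sup>2))"
      using integrable_gauss_tensor[OF e2] by simp
    then have "integrable lborel (\<lambda>x. (cmod (\<phi> x))\<^sup>2)" using integrable_Re by fastforce
    then have "square_integrable lborel \<phi>" by (simp add: square_integrable_def)
    then show ?thesis
      by (auto simp: square_integrable_iff_energy energy_lebesgue intro: measurable_completion)
  qed
  have sq_k: "square_integrable lebesgue k"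
  proof -
    have "integrable lborel (\<lambda>s. (cmod (k s))\<^sup>2)"
    proof (rule Bochner_Integration.integrable_bound)
      show "integrable lborel (\<lambda>s. (2 * pi)\<^sup>2 * (2 * pi)\<^sup>2 * (1 / (4 * pi * e)) * gauss_weight2 e (s - z))"
        by (intro integrable_mult_right gauss_weight2_integral(1) e)
      show "AE s in lborel. norm ((cmod (k s))\<^sup>2) \<le> norm ((2 * pi)\<^sup>2 * (2 * pi)\<^sup>2 * (1 / (4 * pi * e)) * gauss_weight2 e (s - z))"
      proof (rule AE_I2)
        fix s
        have W0: "0 \<le> gauss_weight2 e (s - z)" by (rule gauss_weight2_nonneg[OF e])
        have "(cmod (k s))\<^sup>2 = ((2 * pi)\<^sup>2 * (2 * pi)\<^sup>2) * (gauss_weight2 e (s - z) * gauss_weight2 e (s - z))"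
          unfolding k_def norm_of_real power2_abs by (simp add: power2_eq_square)
        also have "\<dots> \<le> ((2 * pi)\<^sup>2 * (2 * pi)\<^sup>2) * ((1 / (4 * pi * e)) * gauss_weight2 e (s - z))"
          by (intro mult_left_mono mult_right_mono gauss_weight2_le e W0) simp
        finally have le: "(cmod (k s))\<^sup>2 \<le> (2 * pi)\<^sup>2 * (2 * pi)\<^sup>2 * (1 / (4 * pi * e)) * gauss_weight2 e (s - z)"
          by (simp only: mult.assoc)
        then show "norm ((cmod (k s))\<^sup>2) \<le> norm ((2 * pi)\<^sup>2 * (2 * pi)\<^sup>2 * (1 / (4 * pi * e)) * gauss_weight2 e (s - z))"
          unfolding real_norm_def using zero_le_power2[of "cmod (k s)"] by linarith
      qed
    qed measurable
    then have "square_integrable lborel k" by (simp add: square_integrable_def)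
    then show ?thesis
      by (auto simp: square_integrable_iff_energy energy_lebesgue intro: measurable_completion)
  qed
  obtain u :: "nat \<Rightarrow> real \<times> real \<Rightarrow> complex" where u: "\<And>n. integrable lebesgue (u n)"
    and uF: "L2_tendsto lebesgue u F sequentially"
    and uH: "L2_tendsto lebesgue (\<lambda>n. fourier_integral (u n)) H sequentially"
    using F unfolding fourier_transform_L2_def by blast
  \<comment> \<open>For the integrable approximants the identity is the multiplication formula. The
    conjugations translate between the exponent of \<open>fourier_integral\<close> and the opposite
    one of \<open>ift\<close>; both sides then pass to the L2 limit.\<close>
  have same: "(\<integral>x. fourier_integral (u n) x * \<phi> x \<partial>lebesgue) = (\<integral>s. u n s * k s \<partial>lebesgue)" for n
  proof -
    have un_meas: "u n \<in> borel_measurable lebesgue" using u[of n] by auto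
    obtain v where v: "v \<in> borel_measurable borel" and ae: "AE x in lebesgue. u n x = v x"
      using lebesgue_borel_representative[OF un_meas] by blast
    note [measurable] = v
    have leb: "f \<in> borel_measurable lebesgue" if "f \<in> borel_measurable borel" for f :: "real \<times> real \<Rightarrow> complex"
      using that by (intro measurable_completion) simp
    have "integrable lebesgue v"
      using u[of n] by (subst (asm) integrable_cong_AE[OF un_meas leb[OF v] ae])
    then have v_int: "integrable lborel v" by (simp add: integrable_completion)
    then have cv_int: "integrable lborel (\<lambda>t. cnj (v t))" by simp
    have fou: "fourier_integral (u n) x = cnj (ift (\<lambda>t. cnj (v t)) x)" for x
    proof -
      have "fourier_integral (u n) x = (\<integral>t. u n t * cis (- (x \<bullet> t)) \<partial>lebesgue)"
        by (simp add: fourier_integral_def cis_conv_exp)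
      also have "\<dots> = (\<integral>t. v t * cis (- (x \<bullet> t)) \<partial>lebesgue)"
      proof (rule integral_cong_AE)
        have c: "(\<lambda>t. cis (- (x \<bullet> t))) \<in> borel_measurable lebesgue" by (rule leb) measurable
        show "(\<lambda>t. u n t * cis (- (x \<bullet> t))) \<in> borel_measurable lebesgue"
          "(\<lambda>t. v t * cis (- (x \<bullet> t))) \<in> borel_measurable lebesgue"
          by (intro borel_measurable_times un_meas leb[OF v] c)+
        show "AE t in lebesgue. u n t * cis (- (x \<bullet> t)) = v t * cis (- (x \<bullet> t))"
          using ae by eventually_elim simp
      qed
      also have "\<dots> = (\<integral>t. v t * cis (- (x \<bullet> t)) \<partial>lborel)" by (rule integral_completion) measurable
      also have "\<dots> = (\<integral>t. cnj (cnj (v t) * cis (x \<bullet> t)) \<partial>lborel)" by (simp add: cis_cnj)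
      also have "\<dots> = cnj (ift (\<lambda>t. cnj (v t)) x)" unfolding ift_def by (rule Bochner_Integration.integral_cnj)
      finally show ?thesis .
    qed
    have i: "ift (\<lambda>t. cnj (v t)) \<in> borel_measurable borel" by (rule measurable_ift) measurable
    have "(\<lambda>x. cnj (ift (\<lambda>t. cnj (v t)) x)) \<in> borel_measurable borel" by (rule measurable_cnj[OF i])
    then have m: "(\<lambda>x. cnj (ift (\<lambda>t. cnj (v t)) x) * \<phi> x) \<in> borel_measurable lborel" by simp
    have "(\<integral>x. fourier_integral (u n) x * \<phi> x \<partial>lebesgue) = (\<integral>x. cnj (ift (\<lambda>t. cnj (v t)) x * cnj (\<phi> x)) \<partial>lborel)"
      unfolding fou integral_completion[OF m] by simp
    also have "\<dots> = cnj (\<integral>x. ift (\<lambda>t. cnj (v t)) x * cnj (\<phi> x) \<partial>lborel)" by (rule Bochner_Integration.integral_cnj)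
    also have "\<dots> = cnj (\<integral>s. cnj (v s) * k s \<partial>lborel)"
      unfolding ift_multiplication_formula[OF cv_int g_int] ift_g ..
    also have "\<dots> = (\<integral>s. cnj (cnj (v s) * k s) \<partial>lborel)" by (rule Bochner_Integration.integral_cnj[symmetric])
    also have "\<dots> = (\<integral>s. v s * k s \<partial>lborel)" by (simp add: cnj_k)
    also have "\<dots> = (\<integral>s. v s * k s \<partial>lebesgue)" by (rule integral_completion[symmetric]) measurable
    also have "\<dots> = (\<integral>s. u n s * k s \<partial>lebesgue)"
    proof (rule integral_cong_AE)
      show "(\<lambda>s. v s * k s) \<in> borel_measurable lebesgue" "(\<lambda>s. u n s * k s) \<in> borel_measurable lebesgue"
        using leb[OF v] un_meas sq_k by (auto simp: square_integrable_def)
      show "AE s in lebesgue. v s * k s = u n s * k s" using ae by eventually_elim simp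
    qed
    finally show ?thesis .
  qed
  have "(\<lambda>n. \<integral>s. u n s * k s \<partial>lebesgue) \<longlonglongrightarrow> (\<integral>x. H x * \<phi> x \<partial>lebesgue)"
    using L2_tendsto_integral_mult[OF uH sq_\<phi>] unfolding same .
  with L2_tendsto_integral_mult[OF uF sq_k]
  have "(\<integral>x. H x * \<phi> x \<partial>lebesgue) = (\<integral>s. F s * k s \<partial>lebesgue)" by (rule LIMSEQ_unique[rotated])
  then show ?thesis unfolding \<phi>_def \<gamma>_def k_def .
qed

text \<open>The spectrum is a Borel version of the given transform, cut off to the square and
  divided by the (2 pi)^2 that \<open>ift\<close> omits. Gaussian tests give one identity for every
  parameter \<open>e\<close>; as \<open>e\<close> tends to 0, continuity of \<open>F\<close> sends
  one side to F z and dominated convergence sends the other to ift G z. Equality thus holds at every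
  point, not merely almost everywhere.\<close>

lemma paley_wiener_ift:
  assumes "F \<in> paley_wiener"
  obtains G where "bandlimited G" "F = ift G"
proof -
  obtain H where sqF: "square_integrable lebesgue F" and cont: "continuous_on UNIV F"
    and FH: "fourier_transform_L2 F H" and supp: "AE x in lebesgue. x \<notin> {-pi..pi} \<times> {-pi..pi} \<longrightarrow> H x = 0"
    using assms unfolding paley_wiener_def by blast
  have F_borel [measurable]: "F \<in> borel_measurable borel" by (rule borel_measurable_continuous_onI[OF cont])
  have F_fin: "energy lborel F < \<infinity>" using sqF by (simp add: square_integrable_iff_energy energy_lebesgue)
  have sqH: "square_integrable lebesgue H"
    using FH unfolding fourier_transform_L2_def L2_tendsto_def by blast
  then have H_meas: "H \<in> borel_measurable lebesgue" by (simp add: square_integrable_def)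
  obtain H' where [measurable]: "H' \<in> borel_measurable borel" and aeH: "AE x in lebesgue. H x = H' x"
    using lebesgue_borel_representative[OF H_meas] by blast
  define c where "c = complex_of_real ((2 * pi)\<^sup>2)"
  have c0: "c \<noteq> 0" by (simp add: c_def)
  define G where "G x = indicator band x * H' x / c" for x
  have G_borel [measurable]: "G \<in> borel_measurable borel" unfolding G_def[abs_def] by measurable
  have aeG: "AE x in lebesgue. H x = c * G x"
    using aeH supp by eventually_elim (auto simp: G_def indicator_def band_def c0)
  have G_band: "bandlimited G"
    unfolding bandlimited_def
  proof (intro conjI allI impI)
    have "energy lborel (\<lambda>x. inverse c * (c * G x)) = ennreal ((cmod (inverse c))\<^sup>2) * energy lborel (\<lambda>x. c * G x)"
      by (rule energy_scale) measurable
    moreover have "energy lborel (\<lambda>x. c * G x) = energy lebesgue H"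
    proof -
      have "energy lborel (\<lambda>x. c * G x) = energy lebesgue (\<lambda>x. c * G x)" by (rule energy_lebesgue[symmetric])
      also have "\<dots> = energy lebesgue H"
        unfolding energy_def
      proof (rule nn_integral_cong_AE)
        show "AE t in lebesgue. ennreal ((cmod (c * G t))\<^sup>2) = ennreal ((cmod (H t))\<^sup>2)"
          using aeG by eventually_elim simp
      qed
      finally show ?thesis .
    qed
    ultimately show "energy lborel G < \<infinity>"
      using sqH c0 by (simp add: square_integrable_iff_energy ennreal_mult_less_top mult.assoc[symmetric])
  qed (auto simp: G_def)
  have G_int: "integrable lborel G" by (rule bandlimited_ift(1)[OF G_band])
  have leb: "f \<in> borel_measurable lebesgue" if "f \<in> borel_measurable borel" for f :: "real \<times> real \<Rightarrow> complex"
    using that by (intro measurable_completion) simp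
  let ?\<gamma> = "\<lambda>e x. complex_of_real (exp (- e * (fst x)\<^sup>2)) * complex_of_real (exp (- e * (snd x)\<^sup>2))"
  have test: "(\<integral>x. G x * (cis (z \<bullet> x) * ?\<gamma> e x) \<partial>lborel) = (\<integral>s. F s * complex_of_real (gauss_weight2 e (s - z)) \<partial>lborel)"
    if e: "e > 0" for e z
  proof -
    have \<gamma>m [measurable]: "?\<gamma> e \<in> borel_measurable borel" using integrable_gauss_tensor[OF e] by auto
    have "c * (\<integral>x. G x * (cis (z \<bullet> x) * ?\<gamma> e x) \<partial>lborel) = (\<integral>x. c * G x * (cis (z \<bullet> x) * ?\<gamma> e x) \<partial>lborel)"
      by (simp add: mult.assoc)
    also have "\<dots> = (\<integral>x. c * G x * (cis (z \<bullet> x) * ?\<gamma> e x) \<partial>lebesgue)"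
      by (rule integral_completion[symmetric]) measurable
    also have "\<dots> = (\<integral>x. H x * (cis (z \<bullet> x) * ?\<gamma> e x) \<partial>lebesgue)"
    proof (rule integral_cong_AE)
      have "(\<lambda>x. cis (z \<bullet> x) * ?\<gamma> e x) \<in> borel_measurable lebesgue" by (rule leb) measurable
      then show "(\<lambda>x. H x * (cis (z \<bullet> x) * ?\<gamma> e x)) \<in> borel_measurable lebesgue"
        by (rule borel_measurable_times[OF H_meas])
      show "(\<lambda>x. c * G x * (cis (z \<bullet> x) * ?\<gamma> e x)) \<in> borel_measurable lebesgue" by (rule leb) measurable
      show "AE x in lebesgue. c * G x * (cis (z \<bullet> x) * ?\<gamma> e x) = H x * (cis (z \<bullet> x) * ?\<gamma> e x)"
        using aeG by eventually_elim simp
    qed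
    also have "\<dots> = (\<integral>s. F s * complex_of_real ((2 * pi)\<^sup>2 * gauss_weight2 e (s - z)) \<partial>lebesgue)"
      by (rule fourier_transform_L2_test[OF FH e])
    also have "\<dots> = (\<integral>s. F s * complex_of_real ((2 * pi)\<^sup>2 * gauss_weight2 e (s - z)) \<partial>lborel)"
      by (rule integral_completion) measurable
    also have "\<dots> = (\<integral>s. c * (F s * complex_of_real (gauss_weight2 e (s - z))) \<partial>lborel)"
      by (simp add: c_def mult_ac)
    also have "\<dots> = c * (\<integral>s. F s * complex_of_real (gauss_weight2 e (s - z)) \<partial>lborel)"
      by (rule integral_mult_right_zero)
    finally show ?thesis using c0 by simp
  qed
  have "F z = ift G z" for z
  proof (rule LIMSEQ_unique)
    define e where "e n = 1 / real (Suc n)" for n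
    have e: "e n > 0" for n by (simp add: e_def)
    have e0: "e \<longlonglongrightarrow> 0" unfolding e_def[abs_def] by real_asymp
    have "filterlim e (at_right 0) sequentially" unfolding e_def[abs_def] by real_asymp
    then show "(\<lambda>n. \<integral>s. F s * complex_of_real (gauss_weight2 (e n) (s - z)) \<partial>lborel) \<longlonglongrightarrow> F z"
      by (rule filterlim_compose[OF gauss_weight2_approximate_identity[OF cont F_fin]])
    have "(\<lambda>n. \<integral>x. G x * (cis (z \<bullet> x) * ?\<gamma> (e n) x) \<partial>lborel) \<longlonglongrightarrow> (\<integral>x. G x * cis (z \<bullet> x) \<partial>lborel)"
    proof (rule integral_dominated_convergence[where w = "\<lambda>x. cmod (G x)"])
      show "(\<lambda>x. G x * (cis (z \<bullet> x) * ?\<gamma> (e n) x)) \<in> borel_measurable lborel" for n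
      proof -
        have [measurable]: "?\<gamma> (e n) \<in> borel_measurable borel" using integrable_gauss_tensor[OF e] by auto
        show ?thesis by measurable
      qed
      show "AE x in lborel. (\<lambda>n. G x * (cis (z \<bullet> x) * ?\<gamma> (e n) x)) \<longlonglongrightarrow> G x * cis (z \<bullet> x)"
      proof (rule AE_I2)
        fix x :: "real \<times> real"
        have "(\<lambda>n. G x * (cis (z \<bullet> x) * ?\<gamma> (e n) x)) \<longlonglongrightarrow> G x * (cis (z \<bullet> x) * ?\<gamma> 0 x)"
          by (intro tendsto_intros e0)
        then show "(\<lambda>n. G x * (cis (z \<bullet> x) * ?\<gamma> (e n) x)) \<longlonglongrightarrow> G x * cis (z \<bullet> x)" by simp
      qed
      show "AE x in lborel. norm (G x * (cis (z \<bullet> x) * ?\<gamma> (e n) x)) \<le> cmod (G x)" for n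
      proof (rule AE_I2)
        fix x :: "real \<times> real"
        have "exp (- e n * (fst x)\<^sup>2) * exp (- e n * (snd x)\<^sup>2) \<le> 1 * 1"
          using e[of n] by (intro mult_mono) auto
        then have "cmod (G x) * (exp (- e n * (fst x)\<^sup>2) * exp (- e n * (snd x)\<^sup>2)) \<le> cmod (G x) * 1"
          by (intro mult_left_mono) auto
        then show "norm (G x * (cis (z \<bullet> x) * ?\<gamma> (e n) x)) \<le> cmod (G x)" by (simp add: norm_mult)
      qed
      show "integrable lborel (\<lambda>x. cmod (G x))" using G_int by (rule integrable_norm)
    qed measurable
    then show "(\<lambda>n. \<integral>s. F s * complex_of_real (gauss_weight2 (e n) (s - z)) \<partial>lborel) \<longlonglongrightarrow> ift G z"
      unfolding test[OF e] ift_def .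
  qed
  then have "F = ift G" by (rule ext)
  with G_band show thesis by (rule that)
qed

theorem theorem5p5:
  fixes x y :: "int \<Rightarrow> real"
    and z :: "int \<times> int \<Rightarrow> real \<times> real"
    and F :: "real \<times> real \<Rightarrow> complex"
  assumes "riesz_basis_sequence x"
    and "riesz_basis_sequence y"
    and "\<And>l k. z (l, k) = (x l, y k)"
    and "F \<in> paley_wiener"
  shows "L2_tendsto lebesgue (\<lambda>r. gaussian_interpolant z r F) F (at_right 0) \<and>
      uniform_limit UNIV (\<lambda>r. gaussian_interpolant z r F) F (at_right 0)"
proof -
  obtain B where "riesz_nodes x B" using riesz_nodes_exist[OF assms(1)] .
  moreover obtain B' where "riesz_nodes y B'" using riesz_nodes_exist[OF assms(2)] .
  ultimately interpret riesz_grid x B y B' by (rule riesz_grid.intro)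
  have z: "z = node" by (rule ext) (simp add: node_def assms(3) split_paired_all)
  obtain G where G: "bandlimited G" and F: "F = ift G" using paley_wiener_ift[OF assms(4)] .
  have sqF: "square_integrable lebesgue F" using assms(4) by (simp add: paley_wiener_def)
  have err: "gaussian_interpolant z r F w - F w = err r G w" for r w
    by (simp add: err_def z F)
  \<comment> \<open>Halving \<open>e\<close> leaves room for the strict inequalities in both limits;
    \<open>recoverable\<close> bounds squares, hence (e / 2)^2.\<close>
  have small: "\<forall>\<^sub>F r in at_right 0. (\<forall>w. cmod (err r G w) \<le> e / 2) \<and> energy lborel (err r G) \<le> ennreal ((e / 2)\<^sup>2)"
    if "e > 0" for e
  proof -
    have "\<forall>\<^sub>F r in at_right 0. (\<forall>w. ennreal ((cmod (err r G w))\<^sup>2) \<le> ennreal ((e / 2)\<^sup>2)) \<and>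
      energy lborel (err r G) \<le> ennreal ((e / 2)\<^sup>2)"
      using recoverable_bandlimited[OF G] that unfolding recoverable_def
      by (auto dest!: spec[of _ "(e / 2)\<^sup>2"])
    then show ?thesis
    proof eventually_elim
      case (elim r)
      have "cmod (err r G w) \<le> e / 2" for w
      proof (rule power2_le_imp_le)
        have "ennreal ((cmod (err r G w))\<^sup>2) \<le> ennreal ((e / 2)\<^sup>2)" using elim by blast
        then show "(cmod (err r G w))\<^sup>2 \<le> (e / 2)\<^sup>2" by (subst (asm) ennreal_le_iff) auto
      qed (use that in simp)
      with elim show ?case by blast
    qed
  qed
  have leb: "f \<in> borel_measurable lebesgue" if "f \<in> borel_measurable borel" for f :: "real \<times> real \<Rightarrow> complex"
    using that by (intro measurable_completion) simp
  have meas: "\<forall>\<^sub>F r in at_right 0. err r G \<in> borel_measurable lebesgue"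
    using eventually_at_right_0_unit by eventually_elim (auto intro!: leb measurable_err G)
  have "L2_tendsto lebesgue (\<lambda>r. gaussian_interpolant z r F) F (at_right 0)"
    unfolding L2_tendsto_def
  proof (intro conjI sqF)
    show "\<forall>\<^sub>F r in at_right 0. square_integrable lebesgue (gaussian_interpolant z r F)"
      using small[of 1, simplified] meas
    proof eventually_elim
      case (elim r)
      have "energy lborel (err r G) < \<infinity>" using elim by (auto intro: le_less_trans)
      then have "square_integrable lebesgue (err r G)"
        using elim by (simp add: square_integrable_iff_energy energy_lebesgue)
      \<comment> \<open>The interpolant is the sum of its error and \<open>F\<close>, written as a
        difference with - F so that the rule for differences applies.\<close>
      moreover have "square_integrable lebesgue (\<lambda>w. - F w)" using sqF by (simp add: square_integrable_def)
      ultimately have "square_integrable lebesgue (\<lambda>w. err r G w - - F w)" by (rule square_integrable_diff)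
      moreover have "(\<lambda>w. err r G w - - F w) = gaussian_interpolant z r F" by (simp add: err[symmetric])
      ultimately show ?case by simp
    qed
    show "((\<lambda>r. L2_norm lebesgue (\<lambda>w. gaussian_interpolant z r F w - F w)) \<longlongrightarrow> 0) (at_right 0)"
      unfolding err
    proof (rule tendstoI)
      fix e :: real assume e: "e > 0"
      show "\<forall>\<^sub>F r in at_right 0. dist (L2_norm lebesgue (err r G)) 0 < e"
        using small[OF e] meas
      proof eventually_elim
        case (elim r)
        have "L2_norm lebesgue (err r G) \<le> e / 2"
          using elim e by (intro L2_norm_le) (auto simp: energy_lebesgue)
        moreover have "0 \<le> L2_norm lebesgue (err r G)" by (simp add: L2_norm_def integral_nonneg_AE)
        ultimately show ?case using e by simp
      qed
    qed
  qed
  moreover have "uniform_limit UNIV (\<lambda>r. gaussian_interpolant z r F) F (at_right 0)"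
  proof (rule uniform_limitI)
    fix e :: real assume e: "e > 0"
    show "\<forall>\<^sub>F r in at_right 0. \<forall>w\<in>UNIV. dist (gaussian_interpolant z r F w) (F w) < e"
      using small[OF e]
    proof eventually_elim
      case (elim r)
      show ?case
      proof
        fix w
        have "cmod (err r G w) \<le> e / 2" using elim by blast
        then show "dist (gaussian_interpolant z r F w) (F w) < e" using e by (simp add: dist_norm err)
      qed
    qed
  qed
  ultimately show ?thesis by blast
qed

end
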